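(* Let $\mathcal{C}\subset\mathbb{P}^7$ be the smooth canonical model of $X_{\mathrm{ns}}(13)$ over $\mathbb{Q}$ given by the 15 quadrics listed in the context, let $X,Y,Z$ be the linear forms in $x_1,\dots,x_8$ listed in the context, and let $\mathcal{C}'\subset\mathbb{A}^3$ be the affine model of $X_{\mathrm{ns}}(13)$ with coordinates $x,y,t$ given by $p(x,y,1)=0$, $t^2=q_{\mathrm{ns}}(x,y)$, with $p$ and $q_{\mathrm{ns}}$ as in the context. Put $s=A/B\in\mathbb{Q}(\mathcal{C})$, where \begin{align*} A=&78953974807x_1^2 + 26x_1x_2 - 25x_1x_3 - x_1x_4 + 2x_3^2 +238115162692x_4x_7 \\ &+ 209337250703x_4x_8 - 582346348536x_5^2 + 727177285412x_5x_6 + 78542213920x_5x_7 \\ &- 563548816331x_5x_8 + 65380280758x_6^2 - 244488381626x_6x_7 + 82647686352x_6x_8 \\ &+ 136959277010x_7^2 + 250609762421x_7x_8 - 257891423548x_8^2, \end{align*} \begin{align*} B=&33279035581x_3^2 - 20440236060x_3x_4 + 161001990516x_3x_5 + 177481085270x_3x_6 \\ &- 284601313488x_3x_7 - 214125958084x_3x_8 - 116902000189x_4^2 + 103367036819x_4x_5 \\ &+ 124067876928x_4x_6 - 155405328616x_4x_7 - 193679032128x_4x_8 - 57688123584x_5^2 \\ &- 123976858837x_5x_6 - 194732784800x_5x_7 - 165341806053x_5x_8 - 126114432327x_6^2 \\ &+ 524882113804x_6x_7 + 271440452599x_6x_8 - 236487356215x_7^2 - 365606104840x_7x_8 \\ &-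 113208254802x_8^2. \end{align*} Then $$x\longmapsto X/Z,\qquad y\longmapsto Y/Z,\qquad t\longmapsto s\cdot (Y/Z)^2$$ defines an isomorphism of function fields $\mathbb{Q}(\mathcal{C}')\to\mathbb{Q}(\mathcal{C})$ over $\mathbb{Q}$.
   Context: $X_{\mathrm{ns}}(13)$ is the modular curve over $\mathbb{Q}$ attached to a non-split Cartan subgroup of $\mathrm{GL}_2(\mathbb{F}_{13})$; it has genus 8. Its double-cover quotient $X_{\mathrm{ns}}^+(13)$, attached to the normalizer of the non-split Cartan subgroup, is identified with the plane quartic $p(X,Y,Z)=0$ where $$p(X,Y,Z)=(-Y-Z)X^3+(2Y^2+ZY)X^2+(-Y^3+ZY^2-2Z^2Y+Z^3)X+(2Z^2Y^2-3Z^3Y).$$ The polynomial $q_{\mathrm{ns}}$ is \begin{align*} q_{\mathrm{ns}}(x,y)=&(-11y^8 - 20y^7 - 41y^6 - 85y^5 - 260y^4 - 586y^3 - 635y^2 - 312y - 56)x^2 \\ &+(22y^9 + 29y^8 + 51y^7 + 109y^6 + 372y^5 + 866y^4 + 1124y^3 + 840y^2 + 340y + 56)x \\ &-11y^{10} + 2y^9 - y^8 + 8y^7 - 70y^6 - 68y^5 - 453y^4 - 1016y^3 - 740y^2 - 168y. \end{align*} The linear forms $X,Y,Z$ (giving the double cover $\mathcal{C}\to X_{\mathrm{ns}}^+(13)$) are \begin{align*} X&=-3x_1+2x_2,\\ Y&=-3x_1+x_2+2x_4-2x_5,\\ Z&=x_1+x_2+x_4-x_5. \end{align*} The curve $\mathcal{C}\subset\mathbb{P}^7$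 is given by the 15 equations \begin{align*} &x_1^2 - x_1x_3 - x_1x_4 - x_1x_7 + x_1x_8 + x_2x_4 + x_2x_5 + 2x_3x_4 - 2x_3x_5 - x_3x_8 + 2x_4x_5 \\ &\quad+x_4x_7 + x_5x_8 - x_7^2 + x_7x_8=0, \\ &-x_1x_3 + 2x_1x_5 + x_1x_8 - 2x_3x_4 - x_3x_5 + x_3x_6 - x_3x_7 - x_4x_5 - x_4x_6 + x_4x_7 \\ &\quad +x_4x_8 - x_5^2 + x_5x_6 - 3x_5x_8 - x_6x_7 - 3x_6x_8 + x_7^2 - x_8^2=0, \\ &-x_1x_3 + 2x_1x_4 + x_1x_5 - 2x_1x_6 + 4x_1x_8 + x_2x_4 + x_2x_5 - x_3x_4 + x_3x_6 - x_3x_7 - x_4^2 \\ &\quad +x_4x_5 - 2x_4x_8 + 2x_5x_7 + x_5x_8 - 2x_6x_8 + x_7x_8 - x_8^2=0, \\ &x_1x_3 + x_1x_4 + x_1x_5 - 3x_1x_6 + x_1x_7 + 2x_1x_8 - x_2x_3 - x_2x_4 + x_2x_5 + x_2x_6 - x_3^2 \\ &\quad - x_3x_4 - x_3x_5 + x_3x_6 - x_3x_8 - 2x_4x_5 - x_4x_8 + x_5x_6 + x_5x_7 + 2x_6^2 - 2x_6x_7 + x_7^2 \\ &\quad +x_7x_8 - x_8^2=0, \\ &x_1x_2 - x_1x_3 + x_1x_5 + x_1x_6 - x_1x_7 + x_1x_8 + x_2^2 + x_2x_3 - x_2x_4 - x_2x_5 - x_2x_6 + x_3^2 \\ &\quad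 - x_3x_4 - x_3x_5 - x_3x_6 + x_3x_8 - x_4^2 + x_4x_5 + 2x_4x_6 + x_4x_7 - 2x_4x_8 - x_5^2 + 2x_5x_6 \\ &\quad +x_5x_7 - 2x_5x_8 + x_6x_7 - x_6x_8 + x_7x_8 - x_8^2=0, \\ &2x_1x_2 + x_1x_3 - x_1x_4 + x_1x_6 - x_1x_7 - x_1x_8 + x_2x_3 - 2x_2x_4 - x_2x_5 - x_2x_6 + x_2x_7 \\ &\quad +x_3^2 - 2x_3x_4 - x_3x_6 - x_3x_7 + x_4x_5 + x_4x_6 + x_4x_7 + 2x_4x_8 + x_5x_6 - 2x_5x_8 \\ &\quad +x_6x_7 - x_6x_8=0, \\ &-x_1^2 + x_1x_2 + 2x_1x_3 + x_1x_5 - x_1x_6 - x_1x_7 + 2x_1x_8 - x_2^2 - x_2x_3 + x_2x_6 + x_2x_7 \\ &\quad +x_2x_8 - x_3x_4 - x_3x_5 - x_3x_8 - x_4^2 + x_4x_6 + x_5^2 - x_5x_6 - x_6x_7 - x_6x_8=0, \\ &-x_1^2 - x_1x_2 + x_1x_5 + 2x_1x_6 + x_1x_7 + x_1x_8 + x_2x_3 - x_2x_4 - x_2x_5 + x_2x_7 + x_2x_8 - x_3x_5 \\ &\quad +x_3x_6 - x_3x_7 + x_4x_5 - x_4x_6 + x_4x_7 - x_5^2 + x_5x_6 + x_5x_7 - x_5x_8 - 2x_6x_8 + x_7x_8 - x_8^2=0, \\ &-2x_1x_2 + 2x_1x_3 - x_1x_4 - x_1x_5 + x_1x_7 - x_1x_8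 - x_2x_4 + 2x_2x_5 + 2x_2x_6 + x_2x_8 - x_3^2 \\ &\quad +x_3x_4 + x_3x_5 + x_3x_6 + x_3x_7 - x_3x_8 + x_4^2 + x_4x_5 + x_4x_7 - x_5^2 - 2x_5x_6 - x_5x_7 \\ &\quad +x_5x_8 - x_6x_7 + x_6x_8 - x_7^2 + x_7x_8=0, \\ &-2x_1x_3 - x_1x_4 + x_1x_5 - x_1x_7 + 2x_1x_8 + x_2^2 + x_2x_3 - x_2x_4 - x_2x_7 + x_3x_4 + x_3x_5 \\ &\quad +2x_3x_6 - 2x_3x_7 + 2x_3x_8 - x_4^2 + 2x_4x_5 + 2x_4x_7 - x_4x_8 - x_5^2 + 2x_5x_7 - x_5x_8 \\ &\quad +2x_6x_7 - 2x_6x_8 + 2x_7x_8 - 2x_8^2=0, \\ &-x_1x_2 + 2x_1x_4 - x_1x_6 + x_1x_7 + x_1x_8 - x_2^2 + 2x_2x_4 + x_2x_5 - x_2x_6 + 2x_2x_7 \\ &\quad +2x_2x_8 - x_4x_6 - x_4x_7 - x_4x_8 + x_5x_6 + x_5x_7 + x_5x_8=0, \\ &x_1x_3 + 2x_1x_4 - x_1x_5 - x_1x_6 + x_1x_7 + x_1x_8 - x_2^2 - x_2x_3 - x_2x_4 + x_2x_5 + x_2x_6 \\ &\quad +x_2x_7 - 2x_2x_8 - x_3^2 + 2x_3x_5 + x_3x_6 + x_3x_7 - x_3x_8 + x_4x_5 - x_4x_6 - x_4x_7 - x_4x_8 \\ &\quad - x_5x_6 + x_5x_7 + 2x_5x_8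 - x_6x_7 + x_6x_8 - x_7^2 + x_7x_8=0, \\ &-x_1^2 + x_1x_2 + 2x_1x_3 - x_1x_4 + x_1x_6 - x_1x_7 - x_2x_3 - 2x_2x_4 - 2x_2x_5 - x_2x_7 - x_2x_8 \\ &\quad - x_3^2 - x_3x_5 + x_3x_7 - x_3x_8 + x_4^2 + x_4x_5 + 2x_4x_7 + x_4x_8 + x_5x_6 + x_5x_7 - x_5x_8 \\ &\quad +2x_6x_8 + 2x_7^2 + 2x_7x_8 - 2x_8^2=0, \\ &x_1^2 + 2x_1x_2 - x_1x_3 - x_1x_4 + x_1x_6 - x_1x_8 - x_2^2 + 2x_2x_3 - 2x_2x_5 + x_2x_7 + 3x_3^2 - x_3x_4 \\ &\quad - 2x_3x_6 - x_3x_7 - x_4^2 + 3x_4x_6 + 2x_5^2 + x_5x_6 + x_5x_7 - 2x_6^2 - x_6x_7 + x_6x_8 - x_7^2 \\ &\quad - 2x_7x_8 + 2x_8^2=0, \\ &2x_1^2 - 2x_1x_2 + x_1x_4 + 3x_1x_5 - 2x_1x_6 - 2x_1x_7 - 2x_1x_8 + x_2^2 - x_2x_3 - 3x_2x_5 - x_2x_7 \\ &\quad - 3x_3x_4 + x_3x_6 + x_3x_8 + x_4^2 + 3x_4x_5 - 2x_4x_6 + x_4x_7 + x_4x_8 + 2x_5^2 - 4x_5x_6 - 2x_5x_8 \\ &\quad +2x_6x_7 + x_7^2 - 2x_7x_8 + x_8^2=0. \end{align*} $\mathbb{Q}(\mathcal{C})$ and $\mathbb{Q}(\mathcal{C}')$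 denote the function fields over $\mathbb{Q}$. *)

theory Defs
  imports
    "HOL-Library.Poly_Mapping"
    "HOL-Library.Numeral_Type"
    "HOL-Algebra.Algebraic_Closure_Type"
begin

section \<open>Polynomials over the rationals\<close>

text \<open>A monomial is a finitely supported map from the variables to their exponents.\<close>

type_synonym 'v qpoly = "('v \<Rightarrow>\<^sub>0 nat) \<Rightarrow>\<^sub>0 rat"

definition var :: "'v \<Rightarrow> 'v qpoly" where
  "var i = Poly_Mapping.single (Poly_Mapping.single i 1) 1"

definition const :: "rat \<Rightarrow> 'v qpoly" where
  "const c = Poly_Mapping.single 0 c"

text \<open>The zero polynomial is homogeneous of every degree.\<close>

definition homogeneous :: "nat \<Rightarrow> 'v qpoly \<Rightarrow> bool" where
  "homogeneous d f \<longleftrightarrow>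
    (\<forall>m \<in> Poly_Mapping.keys f. (\<Sum>i \<in> Poly_Mapping.keys m. Poly_Mapping.lookup m i) = d)"

abbreviation qpoly_ring :: "'v qpoly ring" where
  "qpoly_ring \<equiv> ring_of_type_algebra"


section \<open>Function fields\<close>

text \<open>
  Fractions \<open>f / g\<close> with \<open>(f, g) \<in> D\<close>, where \<open>f / g\<close> and \<open>f' / g'\<close> are identified if
  \<open>f g' - f' g \<in> I\<close>. If \<open>I\<close> is prime and the denominators in \<open>D\<close> lie outside \<open>I\<close>, this is an
  equivalence relation and the operations below are independent of the representatives.
  If \<open>(f, g) \<notin> D\<close>, then \<open>frac I D f g\<close> is the empty set, which is not in the carrier.
\<close>

definition frac_rel :: "'a::comm_ring_1 set \<Rightarrow> ('a \<times> 'a) set \<Rightarrow> (('a \<times> 'a) \<times> ('a \<times> 'a)) set" where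
  "frac_rel I D = {((f, g), (f', g')). (f, g) \<in> D \<and> (f', g') \<in> D \<and> f * g' - f' * g \<in> I}"

definition frac :: "'a::comm_ring_1 set \<Rightarrow> ('a \<times> 'a) set \<Rightarrow> 'a \<Rightarrow> 'a \<Rightarrow> ('a \<times> 'a) set" where
  "frac I D f g = frac_rel I D `` {(f, g)}"

definition frac_ring :: "'a::comm_ring_1 set \<Rightarrow> ('a \<times> 'a) set \<Rightarrow> ('a \<times> 'a) set ring" where
  "frac_ring I D = \<lparr>
    carrier = D // frac_rel I D,
    monoid.mult = (\<lambda>a b. \<Union>(f, g) \<in> a. \<Union>(f', g') \<in> b. frac I D (f * f') (g * g')),
    one = frac I D 1 1,
    ring.zero = frac I D 0 1,
    add = (\<lambda>a b. \<Union>(f, g) \<in> a. \<Union>(f', g') \<in> b. frac I D (f * g' + f' * g) (g * g'))\<rparr>"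

text \<open>
  The function field of the affine variety with prime ideal \<open>I\<close> consists of all fractions with
  denominator not in \<open>I\<close>, and that of the projective variety with homogeneous prime ideal \<open>I\<close>
  of those whose numerator and denominator are moreover homogeneous of the same degree.
\<close>

definition affine_fractions :: "'v qpoly set \<Rightarrow> ('v qpoly \<times> 'v qpoly) set" where
  "affine_fractions I = {(f, g). g \<notin> I}"

definition projective_fractions :: "'v qpoly set \<Rightarrow> ('v qpoly \<times> 'v qpoly) set" where
  "projective_fractions I =
    {(f, g). g \<notin> I \<and> (\<exists>d. homogeneous d f \<and> homogeneous d g)}"

definition affine_function_field :: "'v qpoly set \<Rightarrow> ('v qpoly \<times> 'v qpoly) set ring" where
  "affine_function_field I = frac_ring I (affine_fractions I)"

definition projective_function_field :: "'v qpoly set \<Rightarrow> ('v qpoly \<times> 'v qpoly) set ring" where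
  "projective_function_field I = frac_ring I (projective_fractions I)"


section \<open>The affine model\<close>

definition p_ns :: "'a::comm_ring_1 \<Rightarrow> 'a \<Rightarrow> 'a \<Rightarrow> 'a" where
  "p_ns x y z =
    (- y - z) * x ^ 3 + (2 * y ^ 2 + z * y) * x ^ 2 + (- (y ^ 3) + z * y ^ 2 - 2 * z ^ 2 * y
      + z ^ 3) * x + (2 * z ^ 2 * y ^ 2 - 3 * z ^ 3 * y)"

definition q_ns :: "'a::comm_ring_1 \<Rightarrow> 'a \<Rightarrow> 'a" where
  "q_ns x y =
    (- 11 * y ^ 8 - 20 * y ^ 7 - 41 * y ^ 6 - 85 * y ^ 5 - 260 * y ^ 4 - 586 * y ^ 3
      - 635 * y ^ 2 - 312 * y - 56) * x ^ 2 + (22 * y ^ 9 + 29 * y ^ 8 + 51 * y ^ 7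
      + 109 * y ^ 6 + 372 * y ^ 5 + 866 * y ^ 4 + 1124 * y ^ 3 + 840 * y ^ 2 + 340 * y
      + 56) * x - 11 * y ^ 10 + 2 * y ^ 9 - y ^ 8 + 8 * y ^ 7 - 70 * y ^ 6 - 68 * y ^ 5
      - 453 * y ^ 4 - 1016 * y ^ 3 - 740 * y ^ 2 - 168 * y"

text \<open>
  The coordinates \<open>x, y, t\<close> are \<open>var 1, var 2, var 3\<close>; in the type \<open>3\<close>, the numeral \<open>3\<close>
  equals \<open>0\<close>, so these are three distinct variables.
\<close>

definition ideal_C' :: "3 qpoly set" where
  "ideal_C' = Idl\<^bsub>qpoly_ring\<^esub>
    {p_ns (var 1) (var 2) 1, (var 3) ^ 2 - q_ns (var 1) (var 2)}"

abbreviation function_field_C' :: "(3 qpoly \<times> 3 qpoly) set ring" where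
  "function_field_C' \<equiv> affine_function_field ideal_C'"

abbreviation fun_C' :: "3 qpoly \<Rightarrow> (3 qpoly \<times> 3 qpoly) set" where
  "fun_C' f \<equiv> frac ideal_C' (affine_fractions ideal_C') f 1"


section \<open>The canonical model\<close>

text \<open>
  The homogeneous coordinates \<open>x\<^sub>1, \<dots>, x\<^sub>8\<close> are \<open>var 1, \<dots>, var 8\<close>; in the type \<open>8\<close>, the
  numeral \<open>8\<close> equals \<open>0\<close>, so these are eight distinct variables. The forms below are functions
  of an arbitrary tuple \<open>x\<close> of ring elements.
\<close>

definition canonical_quadrics :: "(8 \<Rightarrow> 'a::comm_ring_1) \<Rightarrow> 'a set" where
  "canonical_quadrics x = {
    x 1 ^ 2 - x 1 * x 3 - x 1 * x 4 - x 1 * x 7 + x 1 * x 8 + x 2 * x 4 + x 2 * x 5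
      + 2 * x 3 * x 4 - 2 * x 3 * x 5 - x 3 * x 8 + 2 * x 4 * x 5 + x 4 * x 7 + x 5 * x 8
      - x 7 ^ 2 + x 7 * x 8,
    - x 1 * x 3 + 2 * x 1 * x 5 + x 1 * x 8 - 2 * x 3 * x 4 - x 3 * x 5 + x 3 * x 6
      - x 3 * x 7 - x 4 * x 5 - x 4 * x 6 + x 4 * x 7 + x 4 * x 8 - x 5 ^ 2 + x 5 * x 6
      - 3 * x 5 * x 8 - x 6 * x 7 - 3 * x 6 * x 8 + x 7 ^ 2 - x 8 ^ 2,
    - x 1 * x 3 + 2 * x 1 * x 4 + x 1 * x 5 - 2 * x 1 * x 6 + 4 * x 1 * x 8 + x 2 * x 4
      + x 2 * x 5 - x 3 * x 4 + x 3 * x 6 - x 3 * x 7 - x 4 ^ 2 + x 4 * x 5 - 2 * x 4 * x 8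
      + 2 * x 5 * x 7 + x 5 * x 8 - 2 * x 6 * x 8 + x 7 * x 8 - x 8 ^ 2,
    x 1 * x 3 + x 1 * x 4 + x 1 * x 5 - 3 * x 1 * x 6 + x 1 * x 7 + 2 * x 1 * x 8
      - x 2 * x 3 - x 2 * x 4 + x 2 * x 5 + x 2 * x 6 - x 3 ^ 2 - x 3 * x 4 - x 3 * x 5
      + x 3 * x 6 - x 3 * x 8 - 2 * x 4 * x 5 - x 4 * x 8 + x 5 * x 6 + x 5 * x 7
      + 2 * x 6 ^ 2 - 2 * x 6 * x 7 + x 7 ^ 2 + x 7 * x 8 - x 8 ^ 2,
    x 1 * x 2 - x 1 * x 3 + x 1 * x 5 + x 1 * x 6 - x 1 * x 7 + x 1 * x 8 + x 2 ^ 2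
      + x 2 * x 3 - x 2 * x 4 - x 2 * x 5 - x 2 * x 6 + x 3 ^ 2 - x 3 * x 4 - x 3 * x 5
      - x 3 * x 6 + x 3 * x 8 - x 4 ^ 2 + x 4 * x 5 + 2 * x 4 * x 6 + x 4 * x 7
      - 2 * x 4 * x 8 - x 5 ^ 2 + 2 * x 5 * x 6 + x 5 * x 7 - 2 * x 5 * x 8 + x 6 * x 7
      - x 6 * x 8 + x 7 * x 8 - x 8 ^ 2,
    2 * x 1 * x 2 + x 1 * x 3 - x 1 * x 4 + x 1 * x 6 - x 1 * x 7 - x 1 * x 8 + x 2 * x 3
      - 2 * x 2 * x 4 - x 2 * x 5 - x 2 * x 6 + x 2 * x 7 + x 3 ^ 2 - 2 * x 3 * x 4
      - x 3 * x 6 - x 3 * x 7 + x 4 * x 5 + x 4 * x 6 + x 4 * x 7 + 2 * x 4 * x 8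
      + x 5 * x 6 - 2 * x 5 * x 8 + x 6 * x 7 - x 6 * x 8,
    - (x 1 ^ 2) + x 1 * x 2 + 2 * x 1 * x 3 + x 1 * x 5 - x 1 * x 6 - x 1 * x 7
      + 2 * x 1 * x 8 - x 2 ^ 2 - x 2 * x 3 + x 2 * x 6 + x 2 * x 7 + x 2 * x 8 - x 3 * x 4
      - x 3 * x 5 - x 3 * x 8 - x 4 ^ 2 + x 4 * x 6 + x 5 ^ 2 - x 5 * x 6 - x 6 * x 7
      - x 6 * x 8,
    - (x 1 ^ 2) - x 1 * x 2 + x 1 * x 5 + 2 * x 1 * x 6 + x 1 * x 7 + x 1 * x 8 + x 2 * x 3
      - x 2 * x 4 - x 2 * x 5 + x 2 * x 7 + x 2 * x 8 - x 3 * x 5 + x 3 * x 6 - x 3 * x 7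
      + x 4 * x 5 - x 4 * x 6 + x 4 * x 7 - x 5 ^ 2 + x 5 * x 6 + x 5 * x 7 - x 5 * x 8
      - 2 * x 6 * x 8 + x 7 * x 8 - x 8 ^ 2,
    - 2 * x 1 * x 2 + 2 * x 1 * x 3 - x 1 * x 4 - x 1 * x 5 + x 1 * x 7 - x 1 * x 8
      - x 2 * x 4 + 2 * x 2 * x 5 + 2 * x 2 * x 6 + x 2 * x 8 - x 3 ^ 2 + x 3 * x 4
      + x 3 * x 5 + x 3 * x 6 + x 3 * x 7 - x 3 * x 8 + x 4 ^ 2 + x 4 * x 5 + x 4 * x 7
      - x 5 ^ 2 - 2 * x 5 * x 6 - x 5 * x 7 + x 5 * x 8 - x 6 * x 7 + x 6 * x 8 - x 7 ^ 2
      + x 7 * x 8,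
    - 2 * x 1 * x 3 - x 1 * x 4 + x 1 * x 5 - x 1 * x 7 + 2 * x 1 * x 8 + x 2 ^ 2
      + x 2 * x 3 - x 2 * x 4 - x 2 * x 7 + x 3 * x 4 + x 3 * x 5 + 2 * x 3 * x 6
      - 2 * x 3 * x 7 + 2 * x 3 * x 8 - x 4 ^ 2 + 2 * x 4 * x 5 + 2 * x 4 * x 7 - x 4 * x 8
      - x 5 ^ 2 + 2 * x 5 * x 7 - x 5 * x 8 + 2 * x 6 * x 7 - 2 * x 6 * x 8 + 2 * x 7 * x 8
      - 2 * x 8 ^ 2,
    - x 1 * x 2 + 2 * x 1 * x 4 - x 1 * x 6 + x 1 * x 7 + x 1 * x 8 - x 2 ^ 2
      + 2 * x 2 * x 4 + x 2 * x 5 - x 2 * x 6 + 2 * x 2 * x 7 + 2 * x 2 * x 8 - x 4 * x 6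
      - x 4 * x 7 - x 4 * x 8 + x 5 * x 6 + x 5 * x 7 + x 5 * x 8,
    x 1 * x 3 + 2 * x 1 * x 4 - x 1 * x 5 - x 1 * x 6 + x 1 * x 7 + x 1 * x 8 - x 2 ^ 2
      - x 2 * x 3 - x 2 * x 4 + x 2 * x 5 + x 2 * x 6 + x 2 * x 7 - 2 * x 2 * x 8 - x 3 ^ 2
      + 2 * x 3 * x 5 + x 3 * x 6 + x 3 * x 7 - x 3 * x 8 + x 4 * x 5 - x 4 * x 6
      - x 4 * x 7 - x 4 * x 8 - x 5 * x 6 + x 5 * x 7 + 2 * x 5 * x 8 - x 6 * x 7
      + x 6 * x 8 - x 7 ^ 2 + x 7 * x 8,
    - (x 1 ^ 2) + x 1 * x 2 + 2 * x 1 * x 3 - x 1 * x 4 + x 1 * x 6 - x 1 * x 7 - x 2 * x 3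
      - 2 * x 2 * x 4 - 2 * x 2 * x 5 - x 2 * x 7 - x 2 * x 8 - x 3 ^ 2 - x 3 * x 5
      + x 3 * x 7 - x 3 * x 8 + x 4 ^ 2 + x 4 * x 5 + 2 * x 4 * x 7 + x 4 * x 8 + x 5 * x 6
      + x 5 * x 7 - x 5 * x 8 + 2 * x 6 * x 8 + 2 * x 7 ^ 2 + 2 * x 7 * x 8 - 2 * x 8 ^ 2,
    x 1 ^ 2 + 2 * x 1 * x 2 - x 1 * x 3 - x 1 * x 4 + x 1 * x 6 - x 1 * x 8 - x 2 ^ 2
      + 2 * x 2 * x 3 - 2 * x 2 * x 5 + x 2 * x 7 + 3 * x 3 ^ 2 - x 3 * x 4 - 2 * x 3 * x 6
      - x 3 * x 7 - x 4 ^ 2 + 3 * x 4 * x 6 + 2 * x 5 ^ 2 + x 5 * x 6 + x 5 * x 7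
      - 2 * x 6 ^ 2 - x 6 * x 7 + x 6 * x 8 - x 7 ^ 2 - 2 * x 7 * x 8 + 2 * x 8 ^ 2,
    2 * x 1 ^ 2 - 2 * x 1 * x 2 + x 1 * x 4 + 3 * x 1 * x 5 - 2 * x 1 * x 6 - 2 * x 1 * x 7
      - 2 * x 1 * x 8 + x 2 ^ 2 - x 2 * x 3 - 3 * x 2 * x 5 - x 2 * x 7 - 3 * x 3 * x 4
      + x 3 * x 6 + x 3 * x 8 + x 4 ^ 2 + 3 * x 4 * x 5 - 2 * x 4 * x 6 + x 4 * x 7
      + x 4 * x 8 + 2 * x 5 ^ 2 - 4 * x 5 * x 6 - 2 * x 5 * x 8 + 2 * x 6 * x 7 + x 7 ^ 2
      - 2 * x 7 * x 8 + x 8 ^ 2}"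

definition ideal_C :: "8 qpoly set" where
  "ideal_C = Idl\<^bsub>qpoly_ring\<^esub> (canonical_quadrics var)"

abbreviation function_field_C :: "(8 qpoly \<times> 8 qpoly) set ring" where
  "function_field_C \<equiv> projective_function_field ideal_C"

abbreviation frac_C :: "8 qpoly \<Rightarrow> 8 qpoly \<Rightarrow> (8 qpoly \<times> 8 qpoly) set" where
  "frac_C f g \<equiv> frac ideal_C (projective_fractions ideal_C) f g"

definition form_X :: "(8 \<Rightarrow> 'a::comm_ring_1) \<Rightarrow> 'a" where
  "form_X x =
    - 3 * x 1 + 2 * x 2"

definition form_Y :: "(8 \<Rightarrow> 'a::comm_ring_1) \<Rightarrow> 'a" where
  "form_Y x =
    - 3 * x 1 + x 2 + 2 * x 4 - 2 * x 5"

definition form_Z :: "(8 \<Rightarrow> 'a::comm_ring_1) \<Rightarrow> 'a" where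
  "form_Z x =
    x 1 + x 2 + x 4 - x 5"

definition form_A :: "(8 \<Rightarrow> 'a::comm_ring_1) \<Rightarrow> 'a" where
  "form_A x =
    78953974807 * x 1 ^ 2 + 26 * x 1 * x 2 - 25 * x 1 * x 3 - x 1 * x 4 + 2 * x 3 ^ 2
      + 238115162692 * x 4 * x 7 + 209337250703 * x 4 * x 8 - 582346348536 * x 5 ^ 2
      + 727177285412 * x 5 * x 6 + 78542213920 * x 5 * x 7 - 563548816331 * x 5 * x 8
      + 65380280758 * x 6 ^ 2 - 244488381626 * x 6 * x 7 + 82647686352 * x 6 * x 8
      + 136959277010 * x 7 ^ 2 + 250609762421 * x 7 * x 8 - 257891423548 * x 8 ^ 2"

definition form_B :: "(8 \<Rightarrow> 'a::comm_ring_1) \<Rightarrow> 'a" where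
  "form_B x =
    33279035581 * x 3 ^ 2 - 20440236060 * x 3 * x 4 + 161001990516 * x 3 * x 5
      + 177481085270 * x 3 * x 6 - 284601313488 * x 3 * x 7 - 214125958084 * x 3 * x 8
      - 116902000189 * x 4 ^ 2 + 103367036819 * x 4 * x 5 + 124067876928 * x 4 * x 6
      - 155405328616 * x 4 * x 7 - 193679032128 * x 4 * x 8 - 57688123584 * x 5 ^ 2
      - 123976858837 * x 5 * x 6 - 194732784800 * x 5 * x 7 - 165341806053 * x 5 * x 8
      - 126114432327 * x 6 ^ 2 + 524882113804 * x 6 * x 7 + 271440452599 * x 6 * x 8
      - 236487356215 * x 7 ^ 2 - 365606104840 * x 7 * x 8 - 113208254802 * x 8 ^ 2"

definition s_C :: "(8 qpoly \<times> 8 qpoly) set" where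
  "s_C = frac_C (form_A var) (form_B var)"

text \<open>The first conjunct says that \<open>\<phi>\<close> is the identity on constants.\<close>

definition coordinate_assignment ::
    "((3 qpoly \<times> 3 qpoly) set \<Rightarrow> (8 qpoly \<times> 8 qpoly) set) \<Rightarrow> bool" where
  "coordinate_assignment \<phi> \<longleftrightarrow>
    (\<forall>c. \<phi> (fun_C' (const c)) = frac_C (const c) 1) \<and>
    \<phi> (fun_C' (var 1)) = frac_C (form_X var) (form_Z var) \<and>
    \<phi> (fun_C' (var 2)) = frac_C (form_Y var) (form_Z var) \<and>
    \<phi> (fun_C' (var 3)) =
      s_C \<otimes>\<^bsub>function_field_C\<^esub> (frac_C (form_Y var) (form_Z var) [^]\<^bsub>function_field_C\<^esub> (2::nat))"

end

theory Submission
  imports Defs "HOL-Analysis.Continuum_Not_Denumerable"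
    "HOL-Computational_Algebra.Computational_Algebra"
    "HOL-Number_Theory.Cong"
begin

text \<open>
  Both function fields are realised as one and the same subfield of the complex numbers, namely the
  field generated by the coordinates of a generic point of the curve; the isomorphism is then forced.

  For the affine model, choose a real transcendental \<open>y\<close>, a real root \<open>x\<close> of the cubic
  \<open>p(_, y, 1)\<close> and \<open>t = \<surd> q(x, y)\<close>. The cubic is irreducible over \<open>\<rat>(y)\<close>, because at \<open>y = 1\<close> it
  has no rational root, so every polynomial relation between \<open>x\<close> and \<open>y\<close> is a multiple of \<open>p\<close>. The
  point is chosen with \<open>q(x, y) < 0\<close>; then \<open>t\<close> is purely imaginary, so \<open>f(x, y) + t g(x, y) = 0\<close>
  forces \<open>f(x, y) = g(x, y) = 0\<close>. Hence the ideal of \<open>\<C>'\<close> is the kernel of evaluation at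
  \<open>(x, y, t)\<close>, and in particular prime (\<open>double_cover_kernel\<close>, \<open>ideal_C'_iff\<close>).

  For the canonical model, the covering involution of \<open>X\<^sub>n\<^sub>s(13) \<longrightarrow> X\<^sub>n\<^sub>s\<^sup>+(13)\<close> acts on the eight
  coordinates. One eigenspace is spanned by \<open>X, Y, Z\<close>, the other one by
  \<open>a = x\<^sub>1 - 2x\<^sub>8\<close>, \<open>b = x\<^sub>2 - 2x\<^sub>7\<close>, \<open>c = x\<^sub>3 + x\<^sub>7 - x\<^sub>8\<close>, \<open>d = x\<^sub>4 + x\<^sub>5\<close>, \<open>e = x\<^sub>6 - x\<^sub>8\<close>.
  In these coordinates the fifteen quadrics become three quadrics in \<open>a, \<dots>, e\<close>, six bilinear
  relations, and six formulas for the products of \<open>X, Y, Z\<close>. The bilinear relations determine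
  \<open>(a : \<dots> : e)\<close> as a tuple of cubic forms on the plane quartic, and the formula for \<open>Z\<^sup>2\<close> yields a
  quartic form \<open>K\<close>: the curve is parametrised by \<open>(X, Y, Z) = (x, y, 1) T\<close> and these cubics, where
  \<open>T\<^sup>2 = K(x, y)\<close> (\<open>relations_parametrised\<close>). Moreover \<open>q\<close> is \<open>K\<close> times the square of a
  rational function modulo \<open>p\<close>, so both models have the same generic point.

  What remains is that the quadrics generate all relations between the coordinates of this point
  \<open>U\<close>, i.e. that a form vanishing at \<open>U\<close> lies in the ideal (\<open>homogeneous_vanishing_imp_ideal_C\<close>).
  A canonical curve of genus 8 has degree 14 and is arithmetically Cohen-Macaulay; cutting it by the
  hyperplane \<open>l = a - b - c + d - e = 0\<close> and normalising with \<open>b\<close> leaves an Artinian ring of dimension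
  \<open>14 = 1 + 6 + 6 + 1\<close>. Explicit certificates show that modulo the quadrics and \<open>l\<close> every form of degree
  \<open>d\<close> is a rational combination of fourteen elements \<open>b ^ (d - k) * f\<close> with \<open>(k, f)\<close> in
  \<open>standard_basis\<close> (\<open>homogeneous_imp_reducible\<close>). These are independent on the fourteen points with
  \<open>l = 0\<close>, which lie over only seven points of the quartic: \<open>(-1, 0)\<close>, \<open>(1, 0)\<close>, the two points
  \<open>(s, s)\<close> with \<open>s\<^sup>2 = 2\<close>, and three conjugate cubic points (\<open>normal_form_unique\<close>). So a form that
  vanishes at \<open>U\<close> is \<open>l\<close> times a form of smaller degree modulo the quadrics, and the latter vanishes at
  \<open>U\<close> as well; descent on the degree finishes the argument.

  The values of fractions at \<open>U\<close> then form the field \<open>\<rat>(x, y, t)\<close> in both cases. The forms \<open>A\<close> and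
  \<open>B\<close> enter only through the identity \<open>A / B * y\<^sup>2 = t\<close> at \<open>U\<close> (\<open>s_relation\<close>).
\<close>

section \<open>Evaluation of polynomials\<close>

definition qeval :: "('v \<Rightarrow> 'a::field_char_0) \<Rightarrow> 'v qpoly \<Rightarrow> 'a" where
  "qeval v f = (\<Sum>m \<in> Poly_Mapping.keys f. of_rat (Poly_Mapping.lookup f m) *
     (\<Prod>i \<in> Poly_Mapping.keys m. v i ^ Poly_Mapping.lookup m i))"

lemma qeval_superset:
  assumes "finite A" "Poly_Mapping.keys f \<subseteq> A"
  shows "qeval v f = (\<Sum>m \<in> A. of_rat (Poly_Mapping.lookup f m) *
     (\<Prod>i \<in> Poly_Mapping.keys m. v i ^ Poly_Mapping.lookup m i))"
  unfolding qeval_def by (rule sum.mono_neutral_left) (use assms in \<open>auto simp: in_keys_iff\<close>)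

lemma qeval_add: "qeval v (f + g) = qeval v f + qeval v g"
proof -
  let ?A = "Poly_Mapping.keys f \<union> Poly_Mapping.keys g"
  have "Poly_Mapping.keys (f + g) \<subseteq> ?A" by (rule Poly_Mapping.keys_add)
  then show ?thesis
    by (simp add: qeval_superset[of ?A] lookup_add of_rat_add algebra_simps sum.distrib)
qed

lemma qeval_0: "qeval v 0 = 0"
  by (simp add: qeval_def)

lemma qeval_single:
  "qeval v (Poly_Mapping.single m c) = of_rat c * (\<Prod>i \<in> Poly_Mapping.keys m. v i ^
    Poly_Mapping.lookup m i)"
  by (simp add: qeval_def)

lemma monomial_value_add:
  fixes v :: "'v \<Rightarrow> 'a::field_char_0"
  shows "(\<Prod>i \<in> Poly_Mapping.keys (m + n). v i ^ Poly_Mapping.lookup (m + n) i) =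
    (\<Prod>i \<in> Poly_Mapping.keys m. v i ^ Poly_Mapping.lookup m i) *
    (\<Prod>i \<in> Poly_Mapping.keys n. v i ^ Poly_Mapping.lookup n i)"
proof -
  let ?A = "Poly_Mapping.keys m \<union> Poly_Mapping.keys n"
  have *: "(\<Prod>i \<in> Poly_Mapping.keys k. v i ^ Poly_Mapping.lookup k i) = (\<Prod>i \<in> ?A. v i ^
    Poly_Mapping.lookup k i)"
    if "Poly_Mapping.keys k \<subseteq> ?A" for k
    by (rule prod.mono_neutral_left) (use that in \<open>auto simp: in_keys_iff\<close>)
  show ?thesis
    unfolding *[OF Poly_Mapping.keys_add] *[OF Un_upper1] *[OF Un_upper2]
    by (simp add: lookup_add power_add prod.distrib)
qed

lemma qpoly_as_sum:
  "f = (\<Sum>m \<in> Poly_Mapping.keys f. Poly_Mapping.single m (Poly_Mapping.lookup f m))"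
  for f :: "'a \<Rightarrow>\<^sub>0 'b::comm_monoid_add"
  by (rule poly_mapping_eqI) (auto simp: lookup_sum lookup_single when_def in_keys_iff)

lemma qpoly_term_induct [case_names zero add]:
  fixes f :: "'a \<Rightarrow>\<^sub>0 'b::comm_monoid_add"
  assumes "P 0" "\<And>m c f. P f \<Longrightarrow> P (Poly_Mapping.single m c + f)"
  shows "P f"
proof -
  have "P (\<Sum>m \<in> A. Poly_Mapping.single m (Poly_Mapping.lookup f m))" if "finite A" for A
    using that by (induction A) (use assms in auto)
  then show ?thesis
    using qpoly_as_sum[of f] by (metis Poly_Mapping.finite_keys)
qed

lemma qeval_mult: "qeval v (f * g) = qeval v f * qeval v g"
proof (induction f rule: qpoly_term_induct)
  case zero
  then show ?case by (simp add: qeval_0)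
next
  case (add m c f)
  have "qeval v (Poly_Mapping.single m c * g) = qeval v (Poly_Mapping.single m c) * qeval v g"
  proof (induction g rule: qpoly_term_induct)
    case zero
    then show ?case by (simp add: qeval_0)
  next
    case (add n d g)
    then show ?case
      by (simp add: distrib_left qeval_add mult_single qeval_single monomial_value_add of_rat_mult)
  qed
  with add show ?case by (simp add: distrib_right qeval_add)
qed

lemma qeval_const: "qeval v (const c) = of_rat c"
  by (simp add: const_def qeval_single)

lemma const_1: "const 1 = 1"
  by (simp add: const_def)

lemma const_numeral: "const (numeral n) = numeral n"
  by (simp add: const_def)

lemma const_mult: "const a * const b = const (a * b)"
  by (simp add: const_def mult_single)

lemma qeval_1: "qeval v 1 = 1"
  using qeval_const[of v 1] by (simp add: const_1)

lemma qeval_var: "qeval v (var i) = v i"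
  by (simp add: var_def qeval_single)

lemma qeval_numeral: "qeval v (numeral n) = numeral n"
  using qeval_const[of v "numeral n"] by (simp add: const_numeral)

lemma qeval_uminus: "qeval v (- f) = - qeval v f"
  using qeval_add[of v f "- f"] by (simp add: qeval_0 eq_neg_iff_add_eq_0 add.commute)

lemma qeval_diff: "qeval v (f - g) = qeval v f - qeval v g"
  using qeval_add[of v f "- g"] by (simp add: qeval_uminus)

lemma qeval_power: "qeval v (f ^ n) = qeval v f ^ n"
  by (induction n) (simp_all add: qeval_1 qeval_mult)

lemma qeval_sum: "qeval v (sum f A) = (\<Sum>x \<in> A. qeval v (f x))"
  by (induction A rule: infinite_finite_induct) (simp_all add: qeval_0 qeval_add)

lemmas qeval_simps = qeval_0 qeval_1 qeval_add qeval_mult qeval_const qeval_var qeval_numeral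
  qeval_uminus
  qeval_diff qeval_power qeval_sum

lemma qpoly_induct [case_names const add mult]:
  fixes f :: "'v qpoly"
  assumes const: "\<And>c. P (const c)"
    and add: "\<And>f g. P f \<Longrightarrow> P g \<Longrightarrow> P (f + g)"
    and mult: "\<And>i f. P f \<Longrightarrow> P (var i * f)"
  shows "P f"
proof -
  have single: "P (Poly_Mapping.single m c)" for m :: "'v \<Rightarrow>\<^sub>0 nat" and c
  proof (induction m rule: qpoly_term_induct)
    case zero
    then show ?case using const[of c] by (simp add: const_def)
  next
    case (add i k m)
    have step: "Poly_Mapping.single (Poly_Mapping.single i (Suc k) + m) c =
        var i * Poly_Mapping.single (Poly_Mapping.single i k + m) c" for k
      by (simp add: var_def mult_single add.assoc[symmetric] single_add[symmetric])
    show ?case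
      by (induction k) (use add in \<open>simp_all add: step mult\<close>)
  qed
  show ?thesis
  proof (induction f rule: qpoly_term_induct)
    case zero
    then show ?case using const[of 0] by (simp add: const_def)
  qed (simp add: add single)
qed

lemma qpoly_ring_simps:
  "carrier qpoly_ring = UNIV" "x \<otimes>\<^bsub>qpoly_ring\<^esub> y = x * y" "x \<oplus>\<^bsub>qpoly_ring\<^esub> y = x + y"
  "\<one>\<^bsub>qpoly_ring\<^esub> = 1" "\<zero>\<^bsub>qpoly_ring\<^esub> = 0"
  by (simp_all add: ring_of_type_algebra_def)

lemma qpoly_Idl_ideal: "ideal (Idl\<^bsub>qpoly_ring\<^esub> (S :: 'v qpoly set)) qpoly_ring"
  by (rule ring.genideal_ideal) (auto intro: ring_from_type_algebra simp: qpoly_ring_simps)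

lemma qpoly_Idl_closed:
  fixes S :: "'v qpoly set"
  defines "I \<equiv> Idl\<^bsub>qpoly_ring\<^esub> S"
  shows "0 \<in> I" "f \<in> I \<Longrightarrow> g \<in> I \<Longrightarrow> f + g \<in> I" "f \<in> I \<Longrightarrow> h * f \<in> I" "f \<in> S \<Longrightarrow> f \<in> I"
proof -
  interpret ideal I qpoly_ring
    unfolding I_def by (rule qpoly_Idl_ideal)
  show "0 \<in> I" using additive_subgroup.zero_closed[OF is_additive_subgroup] by (simp add:
    qpoly_ring_simps)
  show "f + g \<in> I" if "f \<in> I" "g \<in> I" using additive_subgroup.a_closed[OF is_additive_subgroup that]
    by (simp add: qpoly_ring_simps)
  show "h * f \<in> I" if "f \<in> I" using I_l_closed[OF that, of h] by (simp add: qpoly_ring_simps)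
  show "f \<in> I" if "f \<in> S"
    using ring.genideal_self[OF ring_from_type_algebra, of S] that
    by (auto simp: I_def qpoly_ring_simps)
qed

lemma kernel_ideal: "ideal {f :: 'v qpoly. qeval v f = 0} qpoly_ring"
proof (rule idealI)
  show "ring qpoly_ring" by (rule ring_from_type_algebra)
  show "subgroup {f. qeval v f = 0} (add_monoid qpoly_ring)"
  proof (rule group.subgroupI)
    show "group (add_monoid qpoly_ring)"
      using ring_from_type_algebra abelian_group.a_group ring.is_abelian_group by blast
    fix a :: "'v qpoly"
    assume "a \<in> {f. qeval v f = 0}"
    moreover have "inv\<^bsub>add_monoid qpoly_ring\<^esub> a = - a"
      by (intro group.inv_equality[OF \<open>group (add_monoid qpoly_ring)\<close>]) (auto simp:
        ring_of_type_algebra_def)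
    ultimately show "inv\<^bsub>add_monoid qpoly_ring\<^esub> a \<in> {f. qeval v f = 0}"
      by (simp add: qeval_simps)
  qed (auto simp: ring_of_type_algebra_def qeval_simps intro: exI[of _ 0])
qed (auto simp: qpoly_ring_simps qeval_simps)

lemma Idl_subset_kernel:
  assumes "\<And>f. f \<in> S \<Longrightarrow> qeval v f = 0" "f \<in> Idl\<^bsub>qpoly_ring\<^esub> S"
  shows "qeval v f = 0"
  using ring.genideal_minimal[OF ring_from_type_algebra kernel_ideal[of v], of S] assms by auto

section \<open>Function fields as fields of values\<close>

lemma Union_constant:
  assumes "p \<in> A" "q \<in> B"
    and G: "\<And>x y x' y'. (x, y) \<in> A \<Longrightarrow> (x', y') \<in> B \<Longrightarrow> G x y x' y' = C"
  shows "(\<Union>(x, y) \<in> A. \<Union>(x', y') \<in> B. G x y x' y') = C"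
proof -
  have "(\<Union>(x, y) \<in> A. \<Union>(x', y') \<in> B. G x y x' y') = (\<Union>a \<in> A. \<Union>b \<in> B. C)"
    by (intro SUP_cong refl) (auto simp: G split: prod.splits)
  then show ?thesis using assms(1,2) by auto
qed

text \<open>
  A homomorphism \<open>h\<close> into a field identifies the ring of fractions with a subfield as soon as \<open>I\<close>
  and the kernel of \<open>h\<close> agree on the cross products of admissible fractions. Agreement on all of the
  ring would be too much to ask in the projective case: there \<open>h\<close> evaluates at one representative of
  the generic point, and an inhomogeneous polynomial may vanish at it without lying in \<open>I\<close>.
\<close>

locale evaluable_fractions =
  fixes I :: "'a::comm_ring_1 set" and D :: "('a \<times> 'a) set" and h :: "'a \<Rightarrow> 'k::field"
  assumes h_1: "h 1 = 1" and h_add: "h (f + g) = h f + h g" and h_mult: "h (f * g) = h f * h g"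
    and D_1: "(1, 1) \<in> D"
    and D_0: "(0, 1) \<in> D"
    and D_mult: "(f, g) \<in> D \<Longrightarrow> (f', g') \<in> D \<Longrightarrow> (f * f', g * g') \<in> D"
    and D_add: "(f, g) \<in> D \<Longrightarrow> (f', g') \<in> D \<Longrightarrow> (f * g' + f' * g, g * g') \<in> D"
    and D_uminus: "(f, g) \<in> D \<Longrightarrow> (- f, g) \<in> D"
    and D_inverse: "(f, g) \<in> D \<Longrightarrow> h f \<noteq> 0 \<Longrightarrow> (g, f) \<in> D"
    and h_denom: "(f, g) \<in> D \<Longrightarrow> h g \<noteq> 0"
    and h_rel: "(f, g) \<in> D \<Longrightarrow> (f', g') \<in> D \<Longrightarrow> f * g' - f' * g \<in> I \<longleftrightarrow> h (f * g' - f' * g) = 0"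
begin

lemma h_0: "h 0 = 0"
  by (metis add_cancel_right_left h_add add_0)

lemma h_uminus: "h (- f) = - h f"
  by (metis h_0 h_add add.right_inverse add_eq_0_iff)

lemma h_diff: "h (f - g) = h f - h g"
  using h_add[of f "- g"] by (simp add: h_uminus)

lemma rel_iff:
  "(f, g) \<in> D \<Longrightarrow> (f', g') \<in> D \<Longrightarrow> ((f, g), (f', g')) \<in> frac_rel I D \<longleftrightarrow> h f / h g = h f' / h g'"
  using h_denom[of f g] h_denom[of f' g']
  by (auto simp: frac_rel_def h_rel h_diff h_mult frac_eq_eq)

lemma rel_D: "((f, g), (f', g')) \<in> frac_rel I D \<Longrightarrow> (f, g) \<in> D \<and> (f', g') \<in> D"
  by (auto simp: frac_rel_def)

lemma frac_eq: "(f, g) \<in> D \<Longrightarrow> frac I D f g = {(f', g') \<in> D. h f' / h g' = h f / h g}"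
proof -
  assume *: "(f, g) \<in> D"
  have "((f, g), y) \<in> frac_rel I D \<longleftrightarrow> y \<in> {(f', g') \<in> D. h f' / h g' = h f / h g}" for y
    using rel_D[of f g "fst y" "snd y"] rel_iff[OF *, of "fst y" "snd y"] by (cases y) auto
  then show ?thesis by (auto simp: frac_def)
qed

lemma frac_eq_iff:
  "(f, g) \<in> D \<Longrightarrow> (f', g') \<in> D \<Longrightarrow> frac I D f g = frac I D f' g' \<longleftrightarrow> h f / h g = h f' / h g'"
proof -
  assume *: "(f, g) \<in> D" "(f', g') \<in> D"
  have "(f, g) \<in> frac I D f' g'" if "frac I D f g = frac I D f' g'"
    unfolding that[symmetric] using * by (simp add: frac_eq)
  then show ?thesis using * by (auto simp: frac_eq)
qed

lemma carrier_frac: "carrier (frac_ring I D) = {frac I D f g | f g. (f, g) \<in> D}"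
  by (auto simp: frac_ring_def quotient_def frac_def)

definition val :: "('a \<times> 'a) set \<Rightarrow> 'k" where
  "val a = (THE z. \<exists>(f, g) \<in> a. z = h f / h g)"

lemma val_frac: "(f, g) \<in> D \<Longrightarrow> val (frac I D f g) = h f / h g"
  unfolding val_def by (rule the_equality) (auto simp: frac_eq)

lemma frac_mult:
  assumes "(f, g) \<in> D" "(f', g') \<in> D"
  shows "frac I D f g \<otimes>\<^bsub>frac_ring I D\<^esub> frac I D f' g' = frac I D (f * f') (g * g')"
proof -
  have rep: "frac I D (x * x') (y * y') = frac I D (f * f') (g * g')"
    if "(x, y) \<in> frac I D f g" "(x', y') \<in> frac I D f' g'" for x y x' y'
  proof -
    have xy: "(x, y) \<in> D" "(x', y') \<in> D" "h x / h y = h f / h g" "h x' / h y' = h f' / h g'"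
      using that assms by (auto simp: frac_eq)
    have "(h x / h y) * (h x' / h y') = (h f / h g) * (h f' / h g')"
      by (simp only: xy)
    then show ?thesis
      using assms xy(1,2) by (simp add: frac_eq_iff D_mult h_mult)
  qed
  have "(f, g) \<in> frac I D f g" "(f', g') \<in> frac I D f' g'"
    using assms by (auto simp: frac_eq)
  then show ?thesis
    unfolding frac_ring_def by (simp, intro Union_constant[OF _ _ rep]) auto
qed

lemma frac_add:
  assumes "(f, g) \<in> D" "(f', g') \<in> D"
  shows "frac I D f g \<oplus>\<^bsub>frac_ring I D\<^esub> frac I D f' g' = frac I D (f * g' + f' * g) (g * g')"
proof -
  have eq: "h (x * y' + x' * y) / h (y * y') = h x / h y + h x' / h y'"
    if "(x, y) \<in> D" "(x', y') \<in> D" for x y x' y'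
    using h_denom[OF that(1)] h_denom[OF that(2)] by (simp add: h_add h_mult field_simps)
  have rep: "frac I D (x * y' + x' * y) (y * y') = frac I D (f * g' + f' * g) (g * g')"
    if "(x, y) \<in> frac I D f g" "(x', y') \<in> frac I D f' g'" for x y x' y'
  proof -
    have xy: "(x, y) \<in> D" "(x', y') \<in> D" "h x / h y = h f / h g" "h x' / h y' = h f' / h g'"
      using that assms by (auto simp: frac_eq)
    then show ?thesis
      using assms by (simp add: frac_eq_iff D_mult D_add eq)
  qed
  have "(f, g) \<in> frac I D f g" "(f', g') \<in> frac I D f' g'"
    using assms by (auto simp: frac_eq)
  then show ?thesis
    unfolding frac_ring_def by (simp, intro Union_constant[OF _ _ rep]) auto
qed

lemma frac_one: "\<one>\<^bsub>frac_ring I D\<^esub> = frac I D 1 1"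
  and frac_zero: "\<zero>\<^bsub>frac_ring I D\<^esub> = frac I D 0 1"
  by (simp_all add: frac_ring_def)

definition values_field :: "'k ring" where
  "values_field = ring_of_type_algebra\<lparr>carrier := {h f / h g | f g. (f, g) \<in> D}\<rparr>"

lemma carrier_values: "carrier values_field = {h f / h g | f g. (f, g) \<in> D}"
  by (simp add: values_field_def)

lemma values_simps:
  "x \<otimes>\<^bsub>values_field\<^esub> y = x * y" "x \<oplus>\<^bsub>values_field\<^esub> y = x + y"
  "\<one>\<^bsub>values_field\<^esub> = 1" "\<zero>\<^bsub>values_field\<^esub> = 0"
  by (simp_all add: values_field_def ring_of_type_algebra_def)

lemma values_closed:
  defines "V \<equiv> carrier values_field"
  shows "0 \<in> V" "1 \<in> V" "x \<in> V \<Longrightarrow> y \<in> V \<Longrightarrow> x + y \<in> V" "x \<in> V \<Longrightarrow> y \<in> V \<Longrightarrow> x * y \<in> V"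
    "x \<in> V \<Longrightarrow> - x \<in> V" "x \<in> V \<Longrightarrow> inverse x \<in> V"
proof -
  have *: "h f / h g \<in> V" if "(f, g) \<in> D" for f g
    using that unfolding V_def carrier_values by blast
  show "0 \<in> V" using *[OF D_0] by (simp add: h_0 h_1)
  show "1 \<in> V" using *[OF D_1] by (simp add: h_1)
  show "x + y \<in> V" if xy: "x \<in> V" "y \<in> V"
  proof -
    obtain f g f' g' where fg: "(f, g) \<in> D" "(f', g') \<in> D" "x = h f / h g" "y = h f' / h g'"
      using xy unfolding V_def carrier_values by blast
    then show ?thesis
      using *[OF D_add[OF fg(1,2)]] h_denom[OF fg(1)] h_denom[OF fg(2)]
      by (simp add: h_add h_mult add_frac_eq)
  qed
  show "x * y \<in> V" if xy: "x \<in> V" "y \<in> V"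
  proof -
    obtain f g f' g' where fg: "(f, g) \<in> D" "(f', g') \<in> D" "x = h f / h g" "y = h f' / h g'"
      using xy unfolding V_def carrier_values by blast
    then show ?thesis
      using *[OF D_mult[OF fg(1,2)]] by (simp add: h_mult)
  qed
  show "- x \<in> V" if xy: "x \<in> V"
  proof -
    obtain f g where fg: "(f, g) \<in> D" "x = h f / h g"
      using xy unfolding V_def carrier_values by blast
    then show ?thesis using *[OF D_uminus[OF fg(1)]] by (simp add: h_uminus)
  qed
  show "inverse x \<in> V" if xy: "x \<in> V"
  proof -
    obtain f g where fg: "(f, g) \<in> D" "x = h f / h g"
      using xy unfolding V_def carrier_values by blast
    then show ?thesis
      using *[OF D_inverse[OF fg(1)]] \<open>0 \<in> V\<close> by (cases "h f = 0") simp_all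
  qed
qed

lemma values_field: "field values_field"
proof (rule cring.cring_fieldI2)
  note vc = values_closed
  show "cring values_field"
  proof (rule cringI)
    show "abelian_group values_field"
      by (rule abelian_groupI)
        (auto simp: values_simps vc algebra_simps intro!: bexI[of _ "- _"])
    show "comm_monoid values_field"
      by (rule comm_monoidI) (auto simp: values_simps vc algebra_simps)
  qed (auto simp: values_simps algebra_simps)
  show "\<zero>\<^bsub>values_field\<^esub> \<noteq> \<one>\<^bsub>values_field\<^esub>" by (simp add: values_simps)
  show "\<exists>b \<in> carrier values_field. a \<otimes>\<^bsub>values_field\<^esub> b = \<one>\<^bsub>values_field\<^esub>"
    if "a \<in> carrier values_field" "a \<noteq> \<zero>\<^bsub>values_field\<^esub>" for a
    using that vc(6)[of a] by (intro bexI[of _ "inverse a"]) (auto simp: values_simps)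
qed

lemma val_bij: "bij_betw val (carrier (frac_ring I D)) (carrier values_field)"
proof -
  have "inj_on val (carrier (frac_ring I D))"
    by (clarsimp simp: inj_on_def carrier_frac val_frac frac_eq_iff)
  moreover have "val ` carrier (frac_ring I D) = carrier values_field"
    unfolding carrier_frac carrier_values image_Collect
    by (rule Collect_cong) (metis val_frac)
  ultimately show ?thesis by (simp add: bij_betw_def)
qed

lemma inverse_val_frac:
  "(f, g) \<in> D \<Longrightarrow> inv_into (carrier (frac_ring I D)) val (h f / h g) = frac I D f g"
  using bij_betw_inv_into_left[OF val_bij, of "frac I D f g"] by (auto simp: val_frac carrier_frac)

lemma inverse_val_iso:
  "inv_into (carrier (frac_ring I D)) val \<in> ring_iso values_field (frac_ring I D)"
proof (rule ring_iso_memI)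
  let ?w = "inv_into (carrier (frac_ring I D)) val"
  show bij: "bij_betw ?w (carrier values_field) (carrier (frac_ring I D))"
    by (rule bij_betw_inv_into[OF val_bij])
  show "?w x \<in> carrier (frac_ring I D)" if "x \<in> carrier values_field" for x
    using bij that by (auto simp: bij_betw_def)
  fix x y assume "x \<in> carrier values_field" "y \<in> carrier values_field"
  then obtain f g f' g' where fg: "(f, g) \<in> D" "(f', g') \<in> D" "x = h f / h g" "y = h f' / h g'"
    unfolding carrier_values by blast
  show "?w (x \<otimes>\<^bsub>values_field\<^esub> y) = ?w x \<otimes>\<^bsub>frac_ring I D\<^esub> ?w y"
    using inverse_val_frac[OF D_mult[OF fg(1,2)]] fg
    by (simp add: inverse_val_frac frac_mult values_simps h_mult)
  show "?w (x \<oplus>\<^bsub>values_field\<^esub> y) = ?w x \<oplus>\<^bsub>frac_ring I D\<^esub> ?w y"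
    using inverse_val_frac[OF D_add[OF fg(1,2)]] fg h_denom[OF fg(1)] h_denom[OF fg(2)]
    by (simp add: inverse_val_frac frac_add values_simps h_mult h_add add_frac_eq)
next
  show "inv_into (carrier (frac_ring I D)) val \<one>\<^bsub>values_field\<^esub> = \<one>\<^bsub>frac_ring I D\<^esub>"
    using inverse_val_frac[OF D_1] by (simp add: values_simps frac_one h_1)
qed

text \<open>
  The axioms need not be checked on classes of fractions: they are transported from the subfield of
  values.
\<close>

lemma frac_field: "field (frac_ring I D)"
proof -
  let ?w = "inv_into (carrier (frac_ring I D)) val"
  have "field (frac_ring I D \<lparr> zero := ?w \<zero>\<^bsub>values_field\<^esub> \<rparr>)"
    using field.ring_iso_imp_img_field[OF values_field inverse_val_iso] .
  moreover have "?w \<zero>\<^bsub>values_field\<^esub> = \<zero>\<^bsub>frac_ring I D\<^esub>"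
    using inverse_val_frac[OF D_0] by (simp add: values_simps frac_zero h_1 h_0)
  ultimately show ?thesis by simp
qed

lemma val_iso: "val \<in> ring_iso (frac_ring I D) values_field"
proof -
  show ?thesis
  proof (rule ring_iso_memI)
    show "val x \<in> carrier values_field" if "x \<in> carrier (frac_ring I D)" for x
      using val_bij that by (auto simp: bij_betw_def)
    fix x y assume "x \<in> carrier (frac_ring I D)" "y \<in> carrier (frac_ring I D)"
    then obtain f g f' g' where fg: "(f, g) \<in> D" "(f', g') \<in> D" "x = frac I D f g" "y = frac I D f' g'"
      unfolding carrier_frac by blast
    show "val (x \<otimes>\<^bsub>frac_ring I D\<^esub> y) = val x \<otimes>\<^bsub>values_field\<^esub> val y"
      using fg D_mult[OF fg(1,2)] by (simp add: val_frac frac_mult values_simps h_mult)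
    show "val (x \<oplus>\<^bsub>frac_ring I D\<^esub> y) = val x \<oplus>\<^bsub>values_field\<^esub> val y"
      using fg D_add[OF fg(1,2)] h_denom[OF fg(1)] h_denom[OF fg(2)]
      by (simp add: val_frac frac_add values_simps h_mult h_add add_frac_eq)
  next
    show "val \<one>\<^bsub>frac_ring I D\<^esub> = \<one>\<^bsub>values_field\<^esub>"
      using val_frac[OF D_1] by (simp add: values_simps frac_one h_1)
  qed (rule val_bij)
qed

end

section \<open>The plane quartic\<close>

text \<open>
  Bivariate polynomials are evaluated at numbers and are also substituted into the polynomial ring
  in three variables; the coefficient map \<open>e\<close> covers both cases.
\<close>

definition rat_embedding :: "(rat \<Rightarrow> 'a::comm_ring_1) \<Rightarrow> bool" where
  "rat_embedding e \<longleftrightarrow> e 1 = 1 \<and> (\<forall>a b. e (a + b) = e a + e b) \<and> (\<forall>a b. e (a * b) = e a * e b)"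

lemma rat_embedding_simps:
  assumes "rat_embedding e"
  shows "e 0 = 0" "e 1 = 1" "e (a + b) = e a + e b" "e (a * b) = e a * e b" "e (- a) = - e a"
    "e (numeral n) = numeral n"
proof -
  show 0: "e 0 = 0" using assms by (metis add_cancel_right_left rat_embedding_def add_0)
  show "e 1 = 1" "e (a * b) = e a * e b" using assms by (auto simp: rat_embedding_def)
  have add: "e (a + b) = e a + e b" for a b using assms by (auto simp: rat_embedding_def)
  show "e (a + b) = e a + e b" by (rule add)
  show "e (- a) = - e a" using add[of a "- a"] 0 by (simp add: eq_neg_iff_add_eq_0 add.commute)
  have "e (of_nat k) = of_nat k" for k
    by (induction k) (use assms in \<open>auto simp: 0 add rat_embedding_def\<close>)
  from this[of "numeral n"] show "e (numeral n) = numeral n" by simp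
qed

lemma rat_embedding_of_rat: "rat_embedding (of_rat :: rat \<Rightarrow> 'a::field_char_0)"
  by (simp add: rat_embedding_def of_rat_add of_rat_mult)

lemma rat_embedding_const: "rat_embedding const"
  by (simp add: rat_embedding_def const_1 const_mult) (simp add: const_def single_add)

text \<open>
  Polynomials in \<open>x\<close> with coefficients in \<open>\<rat>[y]\<close>, so that pseudo-division with respect to \<open>x\<close> makes
  sense.
\<close>

definition biv_eval :: "(rat \<Rightarrow> 'a::comm_ring_1) \<Rightarrow> rat poly poly \<Rightarrow> 'a \<Rightarrow> 'a \<Rightarrow> 'a" where
  "biv_eval e A x y = poly (map_poly (\<lambda>c. poly (map_poly e c) y) A) x"

context
  fixes e :: "rat \<Rightarrow> 'a::comm_ring_1"
  assumes e: "rat_embedding e"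
begin

lemmas e_simps = rat_embedding_simps[OF e]

lemma e_sum: "e (sum f A) = (\<Sum>i \<in> A. e (f i))"
  by (induction A rule: infinite_finite_induct) (simp_all add: e_simps)

lemma map_poly_embedding:
  "map_poly e (p + q) = map_poly e p + map_poly e q"
  "map_poly e (p * q) = map_poly e p * map_poly e q"
  "map_poly e 0 = 0" "map_poly e (pCons c p) = pCons (e c) (map_poly e p)"
  by (auto intro!: poly_eqI simp: coeff_map_poly coeff_mult e_simps e_sum map_poly_pCons)

lemma biv_eval_pCons: "biv_eval e (pCons c A) x y = poly (map_poly e c) y + x * biv_eval e A x y"
  by (simp add: biv_eval_def map_poly_pCons map_poly_embedding)

lemma biv_eval_0: "biv_eval e 0 x y = 0"
  by (simp add: biv_eval_def)

lemma biv_eval_add: "biv_eval e (A + B) x y = biv_eval e A x y + biv_eval e B x y"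
  by (induction A B rule: poly_induct2) (simp_all add: biv_eval_pCons biv_eval_0 map_poly_embedding
    algebra_simps)

lemma biv_eval_smult: "biv_eval e (smult c A) x y = poly (map_poly e c) y * biv_eval e A x y"
  by (induction A) (simp_all add: biv_eval_pCons biv_eval_0 map_poly_embedding algebra_simps)

lemma biv_eval_mult: "biv_eval e (A * B) x y = biv_eval e A x y * biv_eval e B x y"
  by (induction A) (simp_all add: biv_eval_pCons biv_eval_0 biv_eval_add biv_eval_smult
    map_poly_embedding algebra_simps)

lemmas biv_eval_simps = biv_eval_pCons biv_eval_0 biv_eval_add biv_eval_smult biv_eval_mult
  map_poly_embedding e_simps

end

definition p_poly :: "rat poly poly" where
  "p_poly = [: [:0, -3, 2:], [:1, -2, 1, -1:], [:0, 1, 2:], [:-1, -1:] :]"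

lemma biv_eval_p_poly: "rat_embedding e \<Longrightarrow> biv_eval e p_poly x y = p_ns x y 1"
  by (simp add: p_poly_def p_ns_def biv_eval_simps algebra_simps power2_eq_square power3_eq_cube)

lemma degree_p_poly: "degree p_poly = 3" "p_poly \<noteq> 0"
  by (simp_all add: p_poly_def)

text \<open>
  Modulo 3 the cubic becomes \<open>r\<^sup>3 - r - 1\<close>, which is \<open>-1\<close> for every residue \<open>r\<close>.
\<close>

lemma cubic_no_rational_root:
  fixes r :: rat
  shows "p_ns r 1 1 \<noteq> 0"
proof
  assume r: "p_ns r 1 1 = 0"
  obtain m n :: int where mn: "r = of_int m / of_int n" "n > 0" "coprime m n"
    by (metis Rat_cases Fract_of_int_quotient)
  have "of_int (-2 * m ^ 3 + 3 * m ^ 2 * n - m * n ^ 2 - n ^ 3) = of_int n ^ 3 * p_ns r 1 1"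
    using mn(2) unfolding mn(1) by (simp add: p_ns_def field_simps power2_eq_square power3_eq_cube)
  then have "(of_int (-2 * m ^ 3 + 3 * m ^ 2 * n - m * n ^ 2 - n ^ 3) :: rat) = 0"
    unfolding r by simp
  then have "-2 * m ^ 3 + 3 * m ^ 2 * n - m * n ^ 2 - n ^ 3 = 0"
    by (simp only: of_int_eq_0_iff)
  then have "m ^ 3 - m * n ^ 2 - n ^ 3 = 3 * (m ^ 3 - m ^ 2 * n)"
    by (simp add: algebra_simps)
  then have "(m ^ 3 - m * n ^ 2 - n ^ 3) mod 3 = 0"
    by (simp only: mod_mult_self1_is_0)
  moreover have "(m ^ 3 - m * n ^ 2 - n ^ 3) mod 3 =
      ((m mod 3) ^ 3 - (m mod 3) * (n mod 3) ^ 2 - (n mod 3) ^ 3) mod 3"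
    unfolding cong_def[symmetric]
    by (intro cong_diff cong_mult cong_pow) (simp_all add: cong_def)
  moreover have "m mod 3 = 0 \<or> m mod 3 = 1 \<or> m mod 3 = 2" "n mod 3 = 0 \<or> n mod 3 = 1 \<or> n mod 3 = 2"
    by presburger+
  ultimately have "m mod 3 = 0" "n mod 3 = 0"
    by auto
  then have "3 dvd gcd m n" by auto
  then show False using mn(3) by auto
qed

text \<open>
  The leading coefficient \<open>-(y + 1)\<close> does not vanish at \<open>y = 1\<close>, so a factor that is linear in \<open>x\<close>
  would specialise to a linear factor over \<open>\<rat>\<close>. A factor without \<open>x\<close> divides the coefficients
  \<open>-(y + 1)\<close> and \<open>2y\<^sup>2 + y\<close>, which generate the unit ideal.
\<close>

lemma irreducible_p_poly: "irreducible p_poly"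
proof (rule irreducibleI)
  show "p_poly \<noteq> 0" by (rule degree_p_poly)
  show "\<not> p_poly dvd 1"
    using degree_p_poly dvd_imp_degree_le[of p_poly 1] by auto
  fix B C assume BC: "p_poly = B * C"
  have nz: "B \<noteq> 0" "C \<noteq> 0" using BC degree_p_poly by auto
  have unit: "B dvd 1" if deg: "degree B = 0" and BC': "p_poly = B * C" for B C :: "rat poly poly"
  proof -
    obtain b where b: "B = [:b:]" using deg by (auto elim: degree_eq_zeroE)
    have "b dvd coeff p_poly i" for i
      unfolding BC' b by simp
    from this[of 3] this[of 2] have "b dvd [:-1, -1:]" "b dvd [:0, 1, 2:]"
      by (simp_all add: p_poly_def numeral_3_eq_3 numeral_2_eq_2)
    moreover have "1 = [:0, 1, 2 :: rat:] + [:-1, -1:] * [:-1, 2:]"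
      by simp
    ultimately have "b dvd 1" by (metis dvd_add dvd_mult2)
    then show ?thesis unfolding b by (simp add: is_unit_const_poly_iff)
  qed
  have no_linear: "degree B \<noteq> 1" if "p_poly = B * C" for B C :: "rat poly poly"
  proof
    assume deg: "degree B = 1"
    define b0 b1 where "b0 = coeff B 0" and "b1 = coeff B 1"
    have "B = [:b0, b1:]"
      by (rule poly_eqI) (use deg in \<open>auto simp: b0_def b1_def coeff_pCons coeff_eq_0 split:
        nat.splits\<close>)
    moreover have "b1 \<noteq> 0"
      using deg leading_coeff_0_iff[of B] unfolding b1_def by auto
    ultimately have b: "B = [:b0, b1:]" "b1 \<noteq> 0" by auto
    have "lead_coeff p_poly = b1 * lead_coeff C"
      unfolding that lead_coeff_mult using b deg b1_def by simp
    then have "poly [:-1, -1:] 1 = poly b1 1 * poly (lead_coeff C) 1"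
      by (simp add: p_poly_def)
    then have b1: "poly b1 1 \<noteq> 0" by auto
    have id: "rat_embedding (\<lambda>a :: rat. a)" by (simp add: rat_embedding_def)
    have map_id: "map_poly (\<lambda>a. a) c = c" for c :: "rat poly"
      by (rule poly_eqI) (simp add: coeff_map_poly)
    define r where "r = - poly b0 1 / poly b1 1"
    have "biv_eval (\<lambda>a. a) B r 1 = 0"
      using b1 unfolding b by (simp add: biv_eval_pCons[OF id] biv_eval_0[OF id] r_def map_id)
    then have "biv_eval (\<lambda>a. a) p_poly r 1 = 0"
      unfolding that by (simp add: biv_eval_mult[OF id])
    then show False using cubic_no_rational_root[of r] by (simp add: biv_eval_p_poly[OF id])
  qed
  have "degree B + degree C = 3"
    using degree_mult_eq[OF nz] BC degree_p_poly by simp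
  moreover have "degree B \<noteq> 1" "degree C \<noteq> 1"
    using no_linear[of B C] no_linear[of C B] BC by (auto simp: mult.commute)
  ultimately have "degree B = 0 \<or> degree C = 0" by linarith
  then show "B dvd 1 \<or> C dvd 1"
    using unit[of B C] unit[of C B] BC by (auto simp: mult.commute)
qed

definition transcendental :: "'a::field_char_0 \<Rightarrow> bool" where
  "transcendental y \<longleftrightarrow> (\<forall>c :: rat poly. poly (map_poly of_rat c) y = 0 \<longrightarrow> c = 0)"

text \<open>
  Pseudo-dividing \<open>p\<close> by a relation of least degree in \<open>x\<close> leaves no remainder, and since \<open>p\<close> is prime
  that least degree is 3. So pseudo-division of an arbitrary relation by \<open>p\<close> leaves no remainder either.
\<close>

lemma vanishing_imp_p_dvd:
  assumes y: "transcendental y" and p: "p_ns x y 1 = 0" and A: "biv_eval of_rat A x y = 0"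
  shows "p_poly dvd A"
proof -
  note rb = rat_embedding_of_rat
  have prime: "prime_elem p_poly"
    using irreducible_p_poly by (rule irreducible_imp_prime_elem)
  define Q where "Q n \<longleftrightarrow> (\<exists>B. B \<noteq> 0 \<and> degree B = n \<and> biv_eval of_rat B x y = 0)" for n
  have Q3: "Q 3"
    unfolding Q_def using degree_p_poly p biv_eval_p_poly[OF rb, of x y] by auto
  define n where "n = (LEAST n. Q n)"
  have "Q n" unfolding n_def by (rule LeastI[of Q, OF Q3])
  then obtain B where B: "B \<noteq> 0" "degree B = n" "biv_eval of_rat B x y = 0"
    by (auto simp: Q_def)
  have small: "C = 0" if "degree C < n" "biv_eval of_rat C x y = 0" for C
  proof (rule ccontr)
    assume "C \<noteq> 0"
    then have "Q (degree C)" using that by (auto simp: Q_def)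
    then show False using that(1) not_less_Least[of "degree C" Q] by (simp add: n_def)
  qed
  have divides: "\<exists>a q. a \<noteq> 0 \<and> smult a C = D * q"
    if C: "biv_eval of_rat C x y = 0" and D: "biv_eval of_rat D x y = 0" "D \<noteq> 0" "degree D = n" for C D
  proof -
    obtain a q where aq: "a \<noteq> 0" "smult a C = D * q + pseudo_mod C D"
      using pseudo_mod(1)[OF D(2)] by blast
    then have "biv_eval of_rat (pseudo_mod C D) x y = 0"
      using C D biv_eval_smult[OF rb, of a C x y] by (simp add: biv_eval_add[OF rb] biv_eval_mult[OF
        rb])
    then have "pseudo_mod C D = 0"
      using pseudo_mod(2)[OF D(2), of C] small[of "pseudo_mod C D"] D(3) by auto
    then show ?thesis using aq by auto
  qed
  have n3: "n = 3"
  proof (rule ccontr)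
    assume "n \<noteq> 3"
    then have "n < 3"
      using Q3 Least_le[of Q 3] by (simp add: n_def)
    obtain a q where aq: "a \<noteq> 0" "smult a p_poly = B * q"
      using divides[of p_poly B] p biv_eval_p_poly[OF rb, of x y] B by auto
    then have "q \<noteq> 0" using degree_p_poly by auto
    have "p_poly dvd B * q" unfolding aq(2)[symmetric] by (rule dvd_smult) simp
    moreover have "\<not> p_poly dvd B"
      using dvd_imp_degree_le[of p_poly B] B \<open>n < 3\<close> degree_p_poly by auto
    ultimately have "p_poly dvd q"
      using prime by (auto simp: prime_elem_dvd_mult_iff)
    then have "3 \<le> degree q"
      using dvd_imp_degree_le[of p_poly q] \<open>q \<noteq> 0\<close> degree_p_poly by auto
    moreover have "3 = degree B + degree q"
      using arg_cong[OF aq(2), of degree] aq(1) B(1) \<open>q \<noteq> 0\<close> degree_p_poly by (simp add: degree_mult_eq)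
    ultimately have "degree B = 0" by simp
    then obtain b where b: "B = [:b:]" by (auto elim: degree_eq_zeroE)
    then have "poly (map_poly of_rat b) y = 0"
      using B(3) by (simp add: biv_eval_simps[OF rb])
    then show False using y B(1) b by (auto simp: transcendental_def)
  qed
  obtain a q where aq: "a \<noteq> 0" "smult a A = p_poly * q"
    using divides[of A p_poly] p biv_eval_p_poly[OF rb, of x y] A n3 degree_p_poly by auto
  have "p_poly dvd [:a:] * A" using aq(2) by simp
  moreover have "\<not> p_poly dvd [:a:]"
    using dvd_imp_degree_le[of p_poly "[:a:]"] aq(1) degree_p_poly by auto
  ultimately show ?thesis
    using prime prime_elem_dvd_multD by blast
qed

section \<open>Generic points of double covers of the quartic\<close>

lemma countable_rat_poly: "countable (UNIV :: rat poly set)"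
  by (rule countableI'[of coeffs]) (simp add: inj_on_def coeffs_eq_iff)

lemma exists_transcendental: "\<exists>y::real. 1000 < y \<and> y < 1001 \<and> transcendental y"
proof -
  let ?A = "\<Union>c \<in> UNIV - {0 :: rat poly}. {y :: real. poly (map_poly of_rat c) y = 0}"
  have "countable ?A"
  proof (rule countable_UN)
    show "countable (UNIV - {0 :: rat poly})"
      using countable_rat_poly by (rule countable_subset[rotated]) simp
    fix c :: "rat poly" assume "c \<in> UNIV - {0}"
    then have "map_poly of_rat c \<noteq> (0 :: real poly)"
      by (simp add: map_poly_eq_0_iff)
    then show "countable {y :: real. poly (map_poly of_rat c) y = 0}"
      by (intro countable_finite poly_roots_finite)
  qed
  moreover have "uncountable {1000<..<1001 :: real}"
    by (simp add: uncountable_open_interval)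
  ultimately have "\<not> {1000<..<1001} \<subseteq> ?A"
    using countable_subset by blast
  then obtain y where "y \<in> {1000<..<1001}" "y \<notin> ?A" by blast
  then show ?thesis unfolding transcendental_def by (intro exI[of _ y]) auto
qed

text \<open>
  The curve is also the double cover \<open>T\<^sup>2 = K(x, y)\<close> of the quartic. This \<open>K\<close> is obtained by inserting
  the cubics \<open>sec_a, \<dots>\<close> below into the quadric that expresses \<open>Z\<^sup>2\<close> and reducing modulo \<open>p\<close>.
\<close>

definition K_ns :: "'a::comm_ring_1 \<Rightarrow> 'a \<Rightarrow> 'a" where
  "K_ns x y = - 8 * x ^ 4 - 20 * x ^ 3 + 60 * x ^ 2 * y ^ 2 - 24 * x ^ 2 * y + x ^ 2
    - 60 * x * y ^ 3 + 134 * x * y ^ 2 - 92 * x * y + 20 * x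
    - 11 * y ^ 4 - 64 * y ^ 3 + 120 * y ^ 2 - 60 * y"

text \<open>
  For large \<open>y\<close> the cubic changes sign between \<open>x = 0\<close> and \<open>x = 1\<close>, and on that range the term
  \<open>-11 y\<^sup>4\<close> dominates \<open>K(x, y)\<close>.
\<close>

lemma exists_generic_point:
  "\<exists>x y :: real. transcendental y \<and> p_ns x y 1 = 0 \<and> K_ns x y < 0"
proof -
  obtain y :: real where y: "1000 < y" "y < 1001" "transcendental y"
    using exists_transcendental by blast
  have y2: "1000 * y < y ^ 2" "1000 * y ^ 2 < y ^ 3" "1000 * y ^ 3 < y ^ 4"
    using y by (simp_all add: power2_eq_square power3_eq_cube power4_eq_xxxx)
  have "p_ns 1 y 1 \<le> 0" "0 \<le> p_ns 0 y 1"
    using y y2 by (simp_all add: p_ns_def)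
  moreover have "continuous_on {0..1} (\<lambda>x. p_ns x y 1)"
    unfolding p_ns_def by (intro continuous_intros)
  ultimately obtain x where x: "0 \<le> x" "x \<le> 1" "p_ns x y 1 = 0"
    using IVT2'[of "\<lambda>x. p_ns x y 1" 1 0 0] by auto
  have "K_ns x y < 0"
  proof -
    have b: "x * y \<le> y" "x * y ^ 2 \<le> y ^ 2" "0 \<le> x * y ^ 3" "0 \<le> x * y" "0 \<le> x ^ 4" "0 \<le> x ^ 3"
      using x y by (simp_all add: mult_left_le_one_le)
    have x2: "x ^ 2 \<le> 1" "0 \<le> x ^ 2"
      using x by (simp_all add: power_le_one)
    then have c: "x ^ 2 * y ^ 2 \<le> y ^ 2" "0 \<le> x ^ 2 * y"
      using y by (simp_all add: mult_left_le_one_le)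
    have "K_ns x y \<le> 60 * y ^ 2 + 1 + 134 * y ^ 2 + 20 - 11 * y ^ 4 - 64 * y ^ 3 + 120 * y ^ 2 - 60 * y"
    proof -
      have "K_ns x y = - 8 * x ^ 4 - 20 * x ^ 3 + 60 * (x ^ 2 * y ^ 2) - 24 * (x ^ 2 * y) + x ^ 2
          - 60 * (x * y ^ 3) + 134 * (x * y ^ 2) - 92 * (x * y) + 20 * x
          - 11 * y ^ 4 - 64 * y ^ 3 + 120 * y ^ 2 - 60 * y"
        by (simp add: K_ns_def)
      then show ?thesis using b c x x2 by linarith
    qed
    also have "\<dots> < 0"
      using y y2 by simp
    finally show ?thesis .
  qed
  with x y show ?thesis by blast
qed

lemma exhaust_3: "i = 1 \<or> i = 2 \<or> i = (3 :: 3)"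
proof (cases i)
  case (of_int z)
  then have "z = 0 \<or> z = 1 \<or> z = 2" by auto
  moreover have "(3 :: 3) = 0" by simp
  ultimately show ?thesis using of_int by auto
qed

lemma of_real_of_rat: "of_real (of_rat c) = (of_rat c :: 'a::real_field)"
  by (cases c) (simp add: of_rat_rat)

lemma qeval_biv_eval: "qeval v (biv_eval const A f g) = biv_eval of_rat A (qeval v f) (qeval v g)"
proof -
  have *: "qeval v (poly (map_poly const c) g) = poly (map_poly of_rat c) (qeval v g)" for c
    by (induction c) (simp_all add: map_poly_pCons const_def[of 0] qeval_simps)
  show ?thesis
    by (induction A)
      (simp_all add: biv_eval_pCons[OF rat_embedding_const] biv_eval_pCons[OF rat_embedding_of_rat]
        biv_eval_0[OF rat_embedding_const] biv_eval_0[OF rat_embedding_of_rat] qeval_simps *)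
qed

definition double_cover :: "rat poly poly \<Rightarrow> 3 qpoly set" where
  "double_cover k = Idl\<^bsub>qpoly_ring\<^esub>
    {p_ns (var 1) (var 2) 1, (var 3) ^ 2 - biv_eval const k (var 1) (var 2)}"

lemma double_cover_closed:
  "0 \<in> double_cover k" "f \<in> double_cover k \<Longrightarrow> g \<in> double_cover k \<Longrightarrow> f + g \<in> double_cover k"
  "f \<in> double_cover k \<Longrightarrow> h * f \<in> double_cover k"
  "p_ns (var 1) (var 2) 1 \<in> double_cover k"
  "(var 3) ^ 2 - biv_eval const k (var 1) (var 2) \<in> double_cover k"
  unfolding double_cover_def by (auto intro: qpoly_Idl_closed)

lemma double_cover_normal_form:
  "\<exists>A B. f - (biv_eval const A (var 1) (var 2) + var 3 * biv_eval const B (var 1) (var 2)) \<in>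
    double_cover k"
proof (induction f rule: qpoly_induct)
  note bs = biv_eval_simps[OF rat_embedding_const]
  note I = double_cover_closed[where k = k]
  {
    case (const c)
    have "const c - (biv_eval const [:[:c:]:] (var 1) (var 2) + var 3 * biv_eval const 0 (var 1)
      (var 2)) = 0"
      by (simp add: bs)
    then show ?case using I(1) by metis
  next
    case (add f g)
    then obtain A B A' B' where
      "f - (biv_eval const A (var 1) (var 2) + var 3 * biv_eval const B (var 1) (var 2)) \<in>
        double_cover k"
      "g - (biv_eval const A' (var 1) (var 2) + var 3 * biv_eval const B' (var 1) (var 2)) \<in>
        double_cover k"
      by blast
    from I(2)[OF this] show ?case
      by (intro exI[of _ "A + A'"] exI[of _ "B + B'"]) (simp add: bs algebra_simps)
  next
    case (mult i f)
    then obtain A B where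
      f: "f - (biv_eval const A (var 1) (var 2) + var 3 * biv_eval const B (var 1) (var 2)) \<in>
        double_cover k"
      by blast
    note vf = I(3)[OF f, of "var i"]
    consider "i = 1" | "i = 2" | "i = 3" using exhaust_3[of i] by blast
    then show ?case
    proof cases
      case 1
      with vf show ?thesis
        by (intro exI[of _ "pCons 0 A"] exI[of _ "pCons 0 B"]) (simp add: bs algebra_simps)
    next
      case 2
      with vf show ?thesis
        by (intro exI[of _ "smult [:0, 1:] A"] exI[of _ "smult [:0, 1:] B"]) (simp add: bs
          algebra_simps)
    next
      case 3
      from I(2)[OF vf I(3)[OF I(5), of "biv_eval const B (var 1) (var 2)"]] 3
      show ?thesis
        by (intro exI[of _ "k * B"] exI[of _ A]) (simp add: bs algebra_simps power2_eq_square)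
    qed
  }
qed

definition coords3 :: "'a \<Rightarrow> 'a \<Rightarrow> 'a \<Rightarrow> 3 \<Rightarrow> 'a" where
  "coords3 x y t i = (if i = 1 then x else if i = 2 then y else t)"

lemma coords3_simps: "coords3 x y t 1 = x" "coords3 x y t 2 = y" "coords3 x y t 3 = t"
  by (simp_all add: coords3_def)

lemma qeval_p_ns: "qeval v (p_ns f g 1) = p_ns (qeval v f) (qeval v g) 1"
  by (simp add: p_ns_def qeval_simps)

locale generic_point =
  fixes x y :: real
  assumes y: "transcendental y" and p: "p_ns x y 1 = 0" and K: "K_ns x y < 0"
begin

text \<open>
  A negative value of \<open>k\<close> makes its square root \<open>\<i> r\<close> imaginary. Hence a relation \<open>A + \<i> r B = 0\<close> with
  real \<open>A\<close>, \<open>B\<close> splits: the sign of \<open>k\<close> shows that it is not a square in the function field of the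
  quartic.
\<close>

lemma double_cover_kernel:
  fixes r :: real
  assumes r: "r \<noteq> 0" "- (r ^ 2) = biv_eval of_rat k x y"
  shows "f \<in> double_cover k \<longleftrightarrow> qeval (coords3 (complex_of_real x) (complex_of_real y) (\<i> * of_real
    r)) f = 0"
proof -
  let ?v = "coords3 (complex_of_real x) (complex_of_real y) (\<i> * of_real r)"
  have real: "biv_eval of_rat A (complex_of_real x) (complex_of_real y) = of_real (biv_eval of_rat A
    x y)" for A
  proof -
    have "poly (map_poly of_rat c) (complex_of_real y) = of_real (poly (map_poly of_rat c) y)" for c
      by (induction c) (simp_all add: map_poly_pCons of_real_of_rat)
    then show ?thesis
      by (induction A) (simp_all add: biv_eval_simps[OF rat_embedding_of_rat])
  qed
  have p_complex: "p_ns (complex_of_real x) (complex_of_real y) 1 = 0"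
    using real[of p_poly] p by (simp add: biv_eval_p_poly rat_embedding_of_rat)
  have sound: "qeval ?v g = 0" if "g \<in> double_cover k" for g
  proof (rule Idl_subset_kernel[OF _ that[unfolded double_cover_def]])
    fix g :: "3 qpoly" assume "g \<in> {p_ns (var 1) (var 2) 1, (var 3) ^ 2 - biv_eval const k (var 1)
      (var 2)}"
    then show "qeval ?v g = 0"
      using r(2) p_complex
      by (auto simp: qeval_p_ns qeval_simps qeval_biv_eval coords3_simps real power_mult_distrib
          simp flip: of_real_power of_real_minus)
  qed
  have "f \<in> double_cover k" if f: "qeval ?v f = 0"
  proof -
    note I = double_cover_closed[where k = k]
    obtain A B where
      AB: "f - (biv_eval const A (var 1) (var 2) + var 3 * biv_eval const B (var 1) (var 2)) \<in>
        double_cover k"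
      using double_cover_normal_form by blast
    have "of_real (biv_eval of_rat A x y) + \<i> * of_real r * of_real (biv_eval of_rat B x y) = (0 ::
      complex)"
      using sound[OF AB] f by (simp add: qeval_simps qeval_biv_eval coords3_simps real add_eq_0_iff)
    then have "biv_eval of_rat A x y = 0" "biv_eval of_rat B x y = 0"
      using r(1) by (auto simp: complex_eq_iff)
    then have "p_poly dvd A" "p_poly dvd B"
      using vanishing_imp_p_dvd[OF y p] by auto
    then obtain A' B' where A': "A = p_poly * A'" and B': "B = p_poly * B'" by (auto elim!: dvdE)
    have "f = (f - (biv_eval const A (var 1) (var 2) + var 3 * biv_eval const B (var 1) (var 2)))
        + (biv_eval const A' (var 1) (var 2) + var 3 * biv_eval const B' (var 1) (var 2)) * p_ns
          (var 1) (var 2) 1"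
      unfolding A' B' by (simp add: biv_eval_mult biv_eval_p_poly rat_embedding_const algebra_simps)
    with I(2)[OF AB I(3)[OF I(4)]] show ?thesis by metis
  qed
  with sound show ?thesis by blast
qed

end

section \<open>The quadrics in eigenform coordinates\<close>

definition odd_a :: "(8 \<Rightarrow> 'a::idom) \<Rightarrow> 'a" where "odd_a x = x 1 - 2 * x 8"
definition odd_b :: "(8 \<Rightarrow> 'a::idom) \<Rightarrow> 'a" where "odd_b x = x 2 - 2 * x 7"
definition odd_c :: "(8 \<Rightarrow> 'a::idom) \<Rightarrow> 'a" where "odd_c x = x 3 + x 7 - x 8"
definition odd_e :: "(8 \<Rightarrow> 'a::idom) \<Rightarrow> 'a" where "odd_e x = x 6 - x 8"
text \<open>
  This is \<open>a - b - c + d - e\<close> with \<open>d = x\<^sub>4 + x\<^sub>5\<close>. It takes the place of \<open>d\<close> as a coordinate because it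
  cuts the curve in points over particularly small number fields.
\<close>

definition odd_l :: "(8 \<Rightarrow> 'a::idom) \<Rightarrow> 'a" where
  "odd_l x = x 1 - x 2 - x 3 + x 4 + x 5 - x 6 + x 7"

text \<open>
  An echelon basis, in the coordinates \<open>u = X\<close>, \<open>v = Y\<close>, \<open>w = Z\<close> and \<open>l, b, a, c, e\<close>, of the space
  spanned by the fifteen quadrics. Its leading monomials are those that normal forms modulo \<open>l\<close> avoid.
\<close>

definition relations :: "'a::idom \<Rightarrow> 'a \<Rightarrow> 'a \<Rightarrow> 'a \<Rightarrow> 'a \<Rightarrow> 'a \<Rightarrow> 'a \<Rightarrow> 'a \<Rightarrow> 'a list" where
  "relations u v w l b a c e = [
    2 * a ^ 2 - 4 * a * c - 5 * a * e + 6 * c * e - 3 * b * a + 3 * b * c + b * e + 2 * b ^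
      2 + 3 * l ^ 2 + 3 * l * b - 7 * l * a + 5 * l * c + 3 * l * e,
    2 * c ^ 2 + 3 * a * e - 4 * c * e + b * a - b * e - b ^ 2 - 3 * l ^ 2 - 2 * l * b + 6 *
      l * a - 3 * l * c - 3 * l * e,
    e ^ 2 + a * c - a * e - c * e + 2 * b * a - 2 * b * c - b ^ 2 - l ^ 2 - l * b + 2 * l *
      a - l * c,
    2 * u * a - 3 * u * e + 2 * w * a - u * b + 2 * v * b - w * b - 3 * u * l + 2 * v * l -
      w * l,
    u * c + w * a + u * b + w * b + w * l,
    2 * v * a - u * e + 2 * w * e + u * b + w * b - u * l - w * l,
    v * c + w * e + u * b + w * b,
    2 * v * e - u * e - w * a + 3 * w * e + 2 * u * b - v * b + w * b - u * l + v * l - 2 *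
      w * l,
    4 * w * c - 3 * u * e - 3 * w * a + w * e - 2 * u * b + 3 * v * b - w * b - 3 * u * l +
      3 * v * l,
    2 * u ^ 2 + 12 * a * c + 15 * a * e - 18 * c * e - 7 * b * a + 7 * b * c - 3 * b * e + 2
      * b ^ 2 + 7 * l ^ 2 + 15 * l * b + 5 * l * a + l * c - 9 * l * e,
    2 * u * v - 5 * a * e + 14 * c * e - b * a - b * c + 9 * b * e - 2 * b ^ 2 + 15 * l ^ 2
      + 7 * l * b - 11 * l * a + 9 * l * c + 15 * l * e,
    u * w - 5 * a * c - 2 * a * e + 6 * c * e + 3 * b * a - b * c - 3 * b * e - l ^ 2 - 3 *
      l * b + 2 * l * a + l * c - l * e,
    2 * v ^ 2 - 4 * a * c - 5 * a * e + 22 * c * e - 7 * b * a - b * c + 17 * b * e - 4 * b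
      ^ 2 + 11 * l ^ 2 - 9 * l * b - 3 * l * a - 3 * l * c + 11 * l * e,
    v * w + a * c + a * e - 4 * c * e + 4 * b * a - 4 * b * c - 3 * b * e - b ^ 2 - 4 * l ^
      2 - 4 * l * b + 8 * l * a - 4 * l * c - 4 * l * e,
    2 * w ^ 2 + 2 * a * c + 9 * a * e - 10 * c * e - 19 * b * a + 16 * b * c - b * e + 9 * b
      ^ 2 + 9 * l ^ 2 + 8 * l * b - 18 * l * a - l * c + 9 * l * e]"

text \<open>
  The inverse of the change of coordinates, multiplied by 26 to clear denominators.
\<close>

definition of_eigenforms :: "'a::idom \<Rightarrow> 'a \<Rightarrow> 'a \<Rightarrow> 'a \<Rightarrow> 'a \<Rightarrow> 'a \<Rightarrow> 'a \<Rightarrow> 'a \<Rightarrow> 8 \<Rightarrow> 'a" where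
  "of_eigenforms u v w l b a c e i =
    (if i = 1 then - (2 * u) - 4 * v + 8 * w
     else (if i = 2 then 10 * u - 6 * v + 12 * w
     else (if i = 3 then - (6 * u) + v - 2 * w + 13 * b - 13 * a + 26 * c
     else (if i = 4 then - (4 * u) + 5 * v + 3 * w + 13 * l + 13 * b - 13 * a + 13 * c + 13 * e
     else (if i = 5 then 4 * u - 5 * v - 3 * w + 13 * l + 13 * b - 13 * a + 13 * c + 13 * e
     else (if i = 6 then - u - 2 * v + 4 * w - 13 * a + 26 * e
     else (if i = 7 then 5 * u - 3 * v + 6 * w - 13 * b
     else - u - 2 * v + 4 * w - 13 * a)))))))"

text \<open>
  The set of quadrics as a list, so that linear combinations can be given by integer matrices.
\<close>

definition quadrics :: "(8 \<Rightarrow> 'a::idom) \<Rightarrow> 'a list" where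
  "quadrics x = [
    x 1 ^ 2 - x 1 * x 3 - x 1 * x 4 - x 1 * x 7 + x 1 * x 8 + x 2 * x 4 + x 2 * x 5
      + 2 * x 3 * x 4 - 2 * x 3 * x 5 - x 3 * x 8 + 2 * x 4 * x 5 + x 4 * x 7 + x 5 * x 8
      - x 7 ^ 2 + x 7 * x 8,
    - x 1 * x 3 + 2 * x 1 * x 5 + x 1 * x 8 - 2 * x 3 * x 4 - x 3 * x 5 + x 3 * x 6
      - x 3 * x 7 - x 4 * x 5 - x 4 * x 6 + x 4 * x 7 + x 4 * x 8 - x 5 ^ 2 + x 5 * x 6
      - 3 * x 5 * x 8 - x 6 * x 7 - 3 * x 6 * x 8 + x 7 ^ 2 - x 8 ^ 2,
    - x 1 * x 3 + 2 * x 1 * x 4 + x 1 * x 5 - 2 * x 1 * x 6 + 4 * x 1 * x 8 + x 2 * x 4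
      + x 2 * x 5 - x 3 * x 4 + x 3 * x 6 - x 3 * x 7 - x 4 ^ 2 + x 4 * x 5 - 2 * x 4 * x 8
      + 2 * x 5 * x 7 + x 5 * x 8 - 2 * x 6 * x 8 + x 7 * x 8 - x 8 ^ 2,
    x 1 * x 3 + x 1 * x 4 + x 1 * x 5 - 3 * x 1 * x 6 + x 1 * x 7 + 2 * x 1 * x 8
      - x 2 * x 3 - x 2 * x 4 + x 2 * x 5 + x 2 * x 6 - x 3 ^ 2 - x 3 * x 4 - x 3 * x 5
      + x 3 * x 6 - x 3 * x 8 - 2 * x 4 * x 5 - x 4 * x 8 + x 5 * x 6 + x 5 * x 7
      + 2 * x 6 ^ 2 - 2 * x 6 * x 7 + x 7 ^ 2 + x 7 * x 8 - x 8 ^ 2,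
    x 1 * x 2 - x 1 * x 3 + x 1 * x 5 + x 1 * x 6 - x 1 * x 7 + x 1 * x 8 + x 2 ^ 2
      + x 2 * x 3 - x 2 * x 4 - x 2 * x 5 - x 2 * x 6 + x 3 ^ 2 - x 3 * x 4 - x 3 * x 5
      - x 3 * x 6 + x 3 * x 8 - x 4 ^ 2 + x 4 * x 5 + 2 * x 4 * x 6 + x 4 * x 7
      - 2 * x 4 * x 8 - x 5 ^ 2 + 2 * x 5 * x 6 + x 5 * x 7 - 2 * x 5 * x 8 + x 6 * x 7
      - x 6 * x 8 + x 7 * x 8 - x 8 ^ 2,
    2 * x 1 * x 2 + x 1 * x 3 - x 1 * x 4 + x 1 * x 6 - x 1 * x 7 - x 1 * x 8 + x 2 * x 3
      - 2 * x 2 * x 4 - x 2 * x 5 - x 2 * x 6 + x 2 * x 7 + x 3 ^ 2 - 2 * x 3 * x 4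
      - x 3 * x 6 - x 3 * x 7 + x 4 * x 5 + x 4 * x 6 + x 4 * x 7 + 2 * x 4 * x 8
      + x 5 * x 6 - 2 * x 5 * x 8 + x 6 * x 7 - x 6 * x 8,
    - (x 1 ^ 2) + x 1 * x 2 + 2 * x 1 * x 3 + x 1 * x 5 - x 1 * x 6 - x 1 * x 7
      + 2 * x 1 * x 8 - x 2 ^ 2 - x 2 * x 3 + x 2 * x 6 + x 2 * x 7 + x 2 * x 8 - x 3 * x 4
      - x 3 * x 5 - x 3 * x 8 - x 4 ^ 2 + x 4 * x 6 + x 5 ^ 2 - x 5 * x 6 - x 6 * x 7
      - x 6 * x 8,
    - (x 1 ^ 2) - x 1 * x 2 + x 1 * x 5 + 2 * x 1 * x 6 + x 1 * x 7 + x 1 * x 8 + x 2 * x 3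
      - x 2 * x 4 - x 2 * x 5 + x 2 * x 7 + x 2 * x 8 - x 3 * x 5 + x 3 * x 6 - x 3 * x 7
      + x 4 * x 5 - x 4 * x 6 + x 4 * x 7 - x 5 ^ 2 + x 5 * x 6 + x 5 * x 7 - x 5 * x 8
      - 2 * x 6 * x 8 + x 7 * x 8 - x 8 ^ 2,
    - 2 * x 1 * x 2 + 2 * x 1 * x 3 - x 1 * x 4 - x 1 * x 5 + x 1 * x 7 - x 1 * x 8
      - x 2 * x 4 + 2 * x 2 * x 5 + 2 * x 2 * x 6 + x 2 * x 8 - x 3 ^ 2 + x 3 * x 4
      + x 3 * x 5 + x 3 * x 6 + x 3 * x 7 - x 3 * x 8 + x 4 ^ 2 + x 4 * x 5 + x 4 * x 7
      - x 5 ^ 2 - 2 * x 5 * x 6 - x 5 * x 7 + x 5 * x 8 - x 6 * x 7 + x 6 * x 8 - x 7 ^ 2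
      + x 7 * x 8,
    - 2 * x 1 * x 3 - x 1 * x 4 + x 1 * x 5 - x 1 * x 7 + 2 * x 1 * x 8 + x 2 ^ 2
      + x 2 * x 3 - x 2 * x 4 - x 2 * x 7 + x 3 * x 4 + x 3 * x 5 + 2 * x 3 * x 6
      - 2 * x 3 * x 7 + 2 * x 3 * x 8 - x 4 ^ 2 + 2 * x 4 * x 5 + 2 * x 4 * x 7 - x 4 * x 8
      - x 5 ^ 2 + 2 * x 5 * x 7 - x 5 * x 8 + 2 * x 6 * x 7 - 2 * x 6 * x 8 + 2 * x 7 * x 8
      - 2 * x 8 ^ 2,
    - x 1 * x 2 + 2 * x 1 * x 4 - x 1 * x 6 + x 1 * x 7 + x 1 * x 8 - x 2 ^ 2
      + 2 * x 2 * x 4 + x 2 * x 5 - x 2 * x 6 + 2 * x 2 * x 7 + 2 * x 2 * x 8 - x 4 * x 6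
      - x 4 * x 7 - x 4 * x 8 + x 5 * x 6 + x 5 * x 7 + x 5 * x 8,
    x 1 * x 3 + 2 * x 1 * x 4 - x 1 * x 5 - x 1 * x 6 + x 1 * x 7 + x 1 * x 8 - x 2 ^ 2
      - x 2 * x 3 - x 2 * x 4 + x 2 * x 5 + x 2 * x 6 + x 2 * x 7 - 2 * x 2 * x 8 - x 3 ^ 2
      + 2 * x 3 * x 5 + x 3 * x 6 + x 3 * x 7 - x 3 * x 8 + x 4 * x 5 - x 4 * x 6
      - x 4 * x 7 - x 4 * x 8 - x 5 * x 6 + x 5 * x 7 + 2 * x 5 * x 8 - x 6 * x 7
      + x 6 * x 8 - x 7 ^ 2 + x 7 * x 8,
    - (x 1 ^ 2) + x 1 * x 2 + 2 * x 1 * x 3 - x 1 * x 4 + x 1 * x 6 - x 1 * x 7 - x 2 * x 3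
      - 2 * x 2 * x 4 - 2 * x 2 * x 5 - x 2 * x 7 - x 2 * x 8 - x 3 ^ 2 - x 3 * x 5
      + x 3 * x 7 - x 3 * x 8 + x 4 ^ 2 + x 4 * x 5 + 2 * x 4 * x 7 + x 4 * x 8 + x 5 * x 6
      + x 5 * x 7 - x 5 * x 8 + 2 * x 6 * x 8 + 2 * x 7 ^ 2 + 2 * x 7 * x 8 - 2 * x 8 ^ 2,
    x 1 ^ 2 + 2 * x 1 * x 2 - x 1 * x 3 - x 1 * x 4 + x 1 * x 6 - x 1 * x 8 - x 2 ^ 2
      + 2 * x 2 * x 3 - 2 * x 2 * x 5 + x 2 * x 7 + 3 * x 3 ^ 2 - x 3 * x 4 - 2 * x 3 * x 6
      - x 3 * x 7 - x 4 ^ 2 + 3 * x 4 * x 6 + 2 * x 5 ^ 2 + x 5 * x 6 + x 5 * x 7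
      - 2 * x 6 ^ 2 - x 6 * x 7 + x 6 * x 8 - x 7 ^ 2 - 2 * x 7 * x 8 + 2 * x 8 ^ 2,
    2 * x 1 ^ 2 - 2 * x 1 * x 2 + x 1 * x 4 + 3 * x 1 * x 5 - 2 * x 1 * x 6 - 2 * x 1 * x 7
      - 2 * x 1 * x 8 + x 2 ^ 2 - x 2 * x 3 - 3 * x 2 * x 5 - x 2 * x 7 - 3 * x 3 * x 4
      + x 3 * x 6 + x 3 * x 8 + x 4 ^ 2 + 3 * x 4 * x 5 - 2 * x 4 * x 6 + x 4 * x 7
      + x 4 * x 8 + 2 * x 5 ^ 2 - 4 * x 5 * x 6 - 2 * x 5 * x 8 + 2 * x 6 * x 7 + x 7 ^ 2
      - 2 * x 7 * x 8 + x 8 ^ 2]"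

lemma canonical_quadrics_eq: "canonical_quadrics x = set (quadrics x)"
  by (simp add: canonical_quadrics_def quadrics_def)

definition combination :: "int list \<Rightarrow> 'a::idom list \<Rightarrow> 'a" where
  "combination cs xs = sum_list (map2 (\<lambda>c x. of_int c * x) cs xs)"

lemma of_eigenforms_nth:
  "of_eigenforms u v w l b a c e 1 = - (2 * u) - 4 * v + 8 * w"
  "of_eigenforms u v w l b a c e 2 = 10 * u - 6 * v + 12 * w"
  "of_eigenforms u v w l b a c e 3 = - (6 * u) + v - 2 * w + 13 * b - 13 * a + 26 * c"
  "of_eigenforms u v w l b a c e 4 = - (4 * u) + 5 * v + 3 * w + 13 * l + 13 * b - 13 * a + 13 * c +
    13 * e"
  "of_eigenforms u v w l b a c e 5 = 4 * u - 5 * v - 3 * w + 13 * l + 13 * b - 13 * a + 13 * c + 13 * e"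
  "of_eigenforms u v w l b a c e 6 = - u - 2 * v + 4 * w - 13 * a + 26 * e"
  "of_eigenforms u v w l b a c e 7 = 5 * u - 3 * v + 6 * w - 13 * b"
  "of_eigenforms u v w l b a c e 8 = - u - 2 * v + 4 * w - 13 * a"
  by (simp_all add: of_eigenforms_def)

definition quadric_matrix :: "int list list" where
  "quadric_matrix = [[338, 338, 676, -338, 0, 0, 1014, -169, 169, 0, 0, 0, 0, -338, 0],
   [-1690, -1352, -676, 0, 338, -338, 0, 0, 0, 0, 0, 338, 0, 0, 0],
   [-676, -338, 0, -676, 1014, 676, -1014, -169, 169, 0, 0, 338, 0, -338, 0],
   [-676, -1690, 2704, -338, 338, 338, -338, -169, 169, 169, -338, 338, 169, -338, 0],
   [-676, -169, 2366, 0, 0, 0, 0, 0, 0, 0, 0, 676, 0, -676, 169],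
   [0, 169, 1690, 338, -338, -338, -338, 169, -169, 0, 0, 338, 0, -338, 169],
   [-676, -676, 0, -338, 0, 338, -676, 0, 0, 0, 0, 0, 0, 0, 0],
   [-676, -338, 0, 0, -338, 0, 338, -169, 169, 0, 0, 338, 0, -338, 0],
   [338, 169, -1014, -338, 338, 0, 0, 338, 338, 0, 0, -338, 0, 0, -169],
   [0, 676, 0, 0, 0, 0, 0, 0, 0, 0, 0, 676, 0, -676, 0],
   [0, 0, 0, -676, 676, 676, -676, -338, 338, 0, 0, 0, 0, 0, 0],
   [338, 169, -1014, 0, 338, 338, -676, 0, 0, 0, 0, -338, 0, 0, -169],
   [0, -676, 1352, 338, -676, -338, 676, 0, 0, 0, 0, 0, 0, 0, 0],
   [1014, 1859, 338, 169, -338, 169, -676, 0, -338, -169, 169, -338, 0, 0, 169],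
   [-169, 0, -2028, 338, 0, -338, -676, 338, -338, 0, 338, 0, -169, 676, 0]]"

definition relation_matrix :: "int list list" where
  "relation_matrix = [[0, -2, 6, 0, -4, 2, -2, 2, 0, -1, -3, -2, 2, 0, 0],
   [0, 2, -7, 0, 4, -2, 2, -3, 0, 2, 4, 2, -2, 0, 0],
   [0, 1, -3, 0, 2, -1, 1, -2, 0, 1, 2, 1, 0, 0, 0],
   [-2, -2, 4, 0, 0, 0, -4, 4, 0, -3, -3, 0, 0, 0, 0],
   [0, 0, 2, 0, 0, 0, -2, 0, 0, -1, -1, 0, 0, 0, 0],
   [-2, -4, 6, 0, 0, -2, -2, 4, 0, -3, -5, -2, 0, 0, 0],
   [0, -1, 2, 0, 0, -1, -1, 1, 0, -1, -2, -1, 0, 0, 0],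
   [-2, -3, 5, 0, 0, -1, -1, 2, 2, -2, -5, -3, 0, 0, 0],
   [-2, -1, 1, 0, 0, 1, -3, 4, 2, -2, 1, -1, 0, 0, 0],
   [8, -2, -10, 8, 4, 2, -2, 10, 0, -5, 1, 6, -14, 0, 8],
   [4, -2, 10, 8, -4, -2, -10, 14, 4, -5, -7, -2, 2, 8, 8],
   [-2, 0, 0, 0, 0, -2, 0, -2, 0, 3, 1, -2, 2, 0, 0],
   [0, -2, 18, 16, -12, -6, -18, 22, 8, -5, -15, -10, 2, 16, 8],
   [-2, 2, -7, 0, 4, -4, 2, -5, 0, 3, 5, 0, 0, 0, 0],
   [0, -12, 31, 0, -16, 12, -12, 21, 0, -16, -20, -12, -2, 0, 0]]"

lemma quadrics_of_eigenforms:
  "map ((*) 2) (quadrics (of_eigenforms u v w l b a c e)) =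
    map (\<lambda>cs. combination cs (relations u v w l b a c e)) quadric_matrix"
  unfolding quadrics_def relations_def quadric_matrix_def combination_def of_eigenforms_nth
  by (simp only: list.map zip_Cons_Cons zip_Nil prod.case sum_list.Cons sum_list.Nil of_int_numeral
    of_int_neg_numeral
      of_int_0 of_int_1 of_int_minus mult_zero_left mult_1_left add_0_left add_0_right list.inject,
        intro conjI refl; Groebner_Basis.algebra)

lemma relations_forms:
  "relations (form_X x) (form_Y x) (form_Z x) (odd_l x) (odd_b x) (odd_a x) (odd_c x) (odd_e x) =
    map (\<lambda>cs. combination cs (quadrics x)) relation_matrix"
  unfolding quadrics_def relations_def relation_matrix_def combination_def
    form_X_def form_Y_def form_Z_def odd_a_def odd_b_def odd_c_def odd_e_def odd_l_def
  by (simp only: list.map zip_Cons_Cons zip_Nil prod.case sum_list.Cons sum_list.Nil of_int_numeral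
    of_int_neg_numeral
      of_int_0 of_int_1 of_int_minus mult_zero_left mult_1_left add_0_left add_0_right list.inject,
        intro conjI refl; Groebner_Basis.algebra)

lemma p_ns_affine:
  "p_ns x y 1 = (- y - 1) * x ^ 3 + (2 * y ^ 2 + y) * x ^ 2 + (- (y ^ 3) + y ^ 2 - 2 * y + 1) * x
    + (2 * y ^ 2 - 3 * y)"
  by (simp add: p_ns_def)

text \<open>
  For \<open>(u, v, w) = (x, y, 1)\<close> the six bilinear relations form a linear system for the remaining
  coordinates; on the quartic it has rank 4, and the following cubics solve it. The solutions in cubics
  form a space of dimension 3, from which one with small coefficients is taken.
\<close>

definition sec_a :: "'a::comm_ring_1 \<Rightarrow> 'a \<Rightarrow> 'a" where
  "sec_a x y = - (2 * x ^ 2 * y) + 3 * x * y ^ 2 - x ^ 2 - 2 * x * y + 2 * y ^ 2"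

definition sec_b :: "'a::comm_ring_1 \<Rightarrow> 'a \<Rightarrow> 'a" where
  "sec_b x y = 2 * x ^ 2 * y - x * y ^ 2 - y ^ 3 + x ^ 2 + x * y - 4 * y ^ 2 + 2 * y"

definition sec_c :: "'a::comm_ring_1 \<Rightarrow> 'a \<Rightarrow> 'a" where
  "sec_c x y = - (3 * x ^ 2 * y) + 3 * x * y ^ 2 - x ^ 2 - x * y + 2 * y ^ 2 + y"

definition sec_e :: "'a::comm_ring_1 \<Rightarrow> 'a \<Rightarrow> 'a" where
  "sec_e x y = x ^ 3 - 4 * x ^ 2 * y + 4 * x * y ^ 2 - y ^ 3 - x ^ 2 + x * y - y ^ 2 - 2 * x + 4 * y"

definition sec_l :: "'a::comm_ring_1 \<Rightarrow> 'a \<Rightarrow> 'a" where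
  "sec_l x y = - (x ^ 3) + x ^ 2 * y + x * y ^ 2 + y ^ 3 - 4 * x * y + 4 * y ^ 2 + x - 5 * y"

text \<open>
  The right-hand side is zero on the double cover \<open>t\<^sup>2 = K(x, y)\<close>: the lists contain the cofactors
  of \<open>p\<close> and of \<open>t\<^sup>2 - K\<close>.
\<close>

lemma relations_parametrised:
  fixes x y t :: "'a::idom"
  shows "relations (x * t) (y * t) t (sec_l x y) (sec_b x y) (sec_a x y) (sec_c x y) (sec_e x y) =
    map2 (\<lambda>g k. g * p_ns x y 1 + k * (t ^ 2 - K_ns x y))
     [2 * x ^ 2 + 2 * x * y - y ^ 2 - 3 * x - 2 * y,
      - (2 * x ^ 2) - 2 * x * y + y ^ 2 + 3 * x + 2 * y,
      - (2 * x ^ 2) - 2 * x * y + y ^ 2 + 3 * x + 2 * y,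
      t * (- 1),
      t * (1),
      t * (- 5),
      t * (- 2),
      t * (- 8),
      t * (- 2),
      58 * x ^ 2 - 62 * x * y + 3 * y ^ 2 + 25 * x - 42 * y,
      - (6 * x ^ 2) + 10 * x * y + 19 * y ^ 2 - 15 * x - 26 * y,
      10 * x ^ 2 - 22 * x * y - y ^ 2 + 21 * x - 6 * y,
      - (14 * x ^ 2) - 46 * x * y + 151 * y ^ 2 - 11 * x - 122 * y,
      - (4 * x ^ 2) - 16 * y ^ 2 + 4 * x + 24 * y,
      18 * x ^ 2 + 2 * x * y - 5 * y ^ 2 - 7 * x - 50 * y + 40]
     [0,
      0,
      0,
      0,
      0,
      0,
      0,
      0,
      0,
      2 * x ^ 2,
      2 * x * y,
      x,
      2 * y ^ 2,
      y,
      2]"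
  unfolding relations_def sec_a_def sec_b_def sec_c_def sec_e_def sec_l_def p_ns_affine K_ns_def
  by (simp only: list.map zip_Cons_Cons zip_Nil prod.case list.inject, intro conjI refl;
    Groebner_Basis.algebra)

text \<open>
  On the quartic \<open>q = (scale_num / scale_den)\<^sup>2 K\<close>. The quotient is \<open>y\<^sup>2\<close> times the ratio of
  the part of \<open>A\<close> that is linear in \<open>T\<close> to the part of \<open>B\<close> that is even in \<open>T\<close>, in lowest terms modulo \<open>p\<close>.
\<close>

definition scale_num :: "'a::comm_ring_1 \<Rightarrow> 'a \<Rightarrow> 'a" where
  "scale_num x y = 2 * x ^ 2 * y - 3 * x * y ^ 2 + y ^ 3 + 2 * x ^ 2 - 3 * x * y - y ^ 2 - 2 * x + 6
    * y"

definition scale_den :: "'a::comm_ring_1 \<Rightarrow> 'a \<Rightarrow> 'a" where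
  "scale_den x y = x ^ 2 - x - 1"

lemma q_ns_eq_scaled_K_ns:
  fixes x y :: "'a::idom"
  shows "q_ns x y * scale_den x y ^ 2 - K_ns x y * scale_num x y ^ 2 =
    (11 * x ^ 3 * y ^ 7 + 9 * x ^ 3 * y ^ 6 - 22 * x ^ 2 * y ^ 7 + 32 * x ^ 3 * y ^ 5 + 4 * x ^ 2 *
      y ^ 6 - 11 * x * y ^ 7 + 53 * x ^ 3 * y ^ 4 - 57 * x ^ 2 * y ^ 5 - 53 * x * y ^ 6 + 22 * y ^ 7
      - 32 * x ^ 5 * y + 32 * x ^ 4 * y ^ 2 + 439 * x ^ 3 * y ^ 3 - 498 * x ^ 2 * y ^ 4 + 254 * x *
      y ^ 5 - 20 * y ^ 6 - 32 * x ^ 5 - 16 * x ^ 4 * y + 627 * x ^ 3 * y ^ 2 - 503 * x ^ 2 * y ^ 3 -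
      901 * x * y ^ 4 + 474 * y ^ 5 - 16 * x ^ 4 + 196 * x ^ 3 * y - 1162 * x ^ 2 * y ^ 2 + 618 * x
      * y ^ 3 - 350 * y ^ 4 + 156 * x ^ 3 - 1068 * x ^ 2 * y + 61 * x * y ^ 2 + 1703 * y ^ 3 - 192 *
      x ^ 2 + 736 * x * y - 192 * y ^ 2 + 56 * x + 284 * y + 56) * p_ns x y 1"
  unfolding q_ns_def K_ns_def scale_den_def scale_num_def p_ns_affine
  by Groebner_Basis.algebra

text \<open>
  Dividing by \<open>form_B U * scale_den x y\<close> on the curve, this says that \<open>s y\<^sup>2\<close> is
  \<open>scale_num / scale_den * T\<close>, which is a square root of \<open>q\<close>.
\<close>

lemma s_relation:
  fixes x y t :: "'a::idom"
  defines "U \<equiv> of_eigenforms (x * t) (y * t) t (sec_l x y) (sec_b x y) (sec_a x y) (sec_c x y)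
    (sec_e x y)"
  shows "form_A U * y ^ 2 * scale_den x y - scale_num x y * t * form_B U =
    (- (228023546980320 * x ^ 7) - 729898876726864 * x ^ 6 * y + 3021045164745296 * x ^ 5 * y ^ 2 +
      3319608354456888 * x ^ 4 * y ^ 3 - 15619288170496140 * x ^ 3 * y ^ 4 + 12161327902263722 * x ^
      2 * y ^ 5 - 1530980366526208 * x * y ^ 6 - 611127850633014 * y ^ 7 - 1835764506376112 * x ^ 6
      - 1196157523396056 * x ^ 5 * y + 14966597921186184 * x ^ 4 * y ^ 2 - 7847663150136056 * x ^ 3
      * y ^ 3 - 21397499019189748 * x ^ 2 * y ^ 4 + 22201403023144202 * x * y ^ 5 - 3103754939136098
      * y ^ 6 - 995796926284836 * x ^ 5 - 5849752352930590 * x ^ 4 * y + 5596735580664904 * x ^ 3 *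
      y ^ 2 + 31851237217772778 * x ^ 2 * y ^ 3 - 39952282938806732 * x * y ^ 4 + 5441601494139928 *
      y ^ 5 + 6078182641456224 * x ^ 4 - 15193366061071354 * x ^ 3 * y - 20134621173818658 * x ^ 2 *
      y ^ 2 + 62747633624740740 * x * y ^ 3 - 32781644783886388 * y ^ 4 + 2896768568856292 * x ^ 3 +
      12185552150057520 * x ^ 2 * y - 56506508501392144 * x * y ^ 2 + 46421863435719720 * y ^ 3 -
      5349910569139760 * x ^ 2 + 23057863654611760 * x * y - 21155443591967360 * y ^ 2 + t * (-
      (76588667253800 * x ^ 5) + 111432163995308 * x ^ 4 * y - 1013569858062008 * x ^ 3 * y ^ 2 +
      2791589035559142 * x ^ 2 * y ^ 3 - 2475169638183684 * x * y ^ 4 + 661812678061782 * y ^ 5 +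
      207568258950676 * x ^ 4 - 683295901437318 * x ^ 3 * y + 1774271192857020 * x ^ 2 * y ^ 2 -
      470870680891624 * x * y ^ 3 - 964755236841058 * y ^ 4 + 228048435769856 * x ^ 3 -
      734457621047618 * x ^ 2 * y - 3166962352921146 * x * y ^ 2 + 4174794376908688 * y ^ 3 -
      509131374700780 * x ^ 2 + 1900701622040000 * x * y - 1688367622025032 * y ^ 2 + 63835110693120
      * x - 191505332079360 * y)) * p_ns x y 1 +
    ((- (8726837962219 * x ^ 2) + 26007361184857 * x * y - 15316169211434 * y ^ 2 + 18327325387150 *
      x - 21852121788172 * y + 6552387519496) * y ^ 2 * scale_den x y - scale_num x y * t * (-
      (5869877828269 * x ^ 2) + 18161447982574 * x * y - 10727013455938 * y ^ 2 + 6437229435338 * x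
      - 2831292041812 * y + 1595877767328) - scale_num x y * (14251471686270 * x ^ 4 +
      38492943952294 * x ^ 3 * y - 108301492968838 * x ^ 2 * y ^ 2 + 55557077330274 * x * y ^ 3 +
      93358074119102 * x ^ 3 - 75975890756116 * x ^ 2 * y - 41081637272858 * x * y ^ 2 -
      54641161795662 * x ^ 2 + 160035911458930 * x * y - 111114154660548 * y ^ 2 - 133747764228494 *
      x + 175203298679812 * y)) * (t ^ 2 - K_ns x y)"
  unfolding U_def form_A_def form_B_def of_eigenforms_nth scale_den_def scale_num_def p_ns_affine
    K_ns_def
    sec_a_def sec_b_def sec_c_def sec_e_def sec_l_def
  by Groebner_Basis.algebra

section \<open>Homogeneous polynomials\<close>

definition mdeg :: "('v \<Rightarrow>\<^sub>0 nat) \<Rightarrow> nat" where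
  "mdeg m = (\<Sum>i \<in> Poly_Mapping.keys m. Poly_Mapping.lookup m i)"

lemma homogeneous_iff: "homogeneous d f \<longleftrightarrow> (\<forall>m \<in> Poly_Mapping.keys f. mdeg m = d)"
  by (simp add: homogeneous_def mdeg_def)

lemma mdeg_add: "mdeg (m + n) = mdeg m + mdeg n"
proof -
  let ?A = "Poly_Mapping.keys m \<union> Poly_Mapping.keys n"
  have *: "mdeg k = (\<Sum>i \<in> ?A. Poly_Mapping.lookup k i)" if "Poly_Mapping.keys k \<subseteq> ?A" for k
    unfolding mdeg_def by (rule sum.mono_neutral_left) (use that in \<open>auto simp: in_keys_iff\<close>)
  show ?thesis
    unfolding *[OF Poly_Mapping.keys_add] *[OF Un_upper1] *[OF Un_upper2]
    by (simp add: lookup_add sum.distrib)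
qed

lemma mdeg_single: "mdeg (Poly_Mapping.single i n) = n"
  by (simp add: mdeg_def)

lemma homogeneous_0: "homogeneous d 0"
  by (simp add: homogeneous_iff)

lemma homogeneous_add: "homogeneous d f \<Longrightarrow> homogeneous d g \<Longrightarrow> homogeneous d (f + g)"
  using Poly_Mapping.keys_add[of f g] by (auto simp: homogeneous_iff)

lemma homogeneous_mult: "homogeneous d f \<Longrightarrow> homogeneous e g \<Longrightarrow> homogeneous (d + e) (f * g)"
  using Poly_Mapping.keys_mult[of f g] by (fastforce simp: homogeneous_iff mdeg_add)

lemma homogeneous_const: "homogeneous 0 (const c)"
  by (simp add: homogeneous_iff const_def mdeg_def)

lemma homogeneous_1: "homogeneous 0 1"
  using homogeneous_const[of 1] by (simp add: const_1)

lemma homogeneous_var: "homogeneous 1 (var i)"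
  by (simp add: homogeneous_iff var_def mdeg_single)

lemma homogeneous_const_mult: "homogeneous d f \<Longrightarrow> homogeneous d (const c * f)"
  using homogeneous_mult[OF homogeneous_const] by fastforce

lemma homogeneous_numeral_mult: "homogeneous d f \<Longrightarrow> homogeneous d (numeral n * f)"
  using homogeneous_const_mult[of d f "numeral n"] by (simp add: const_numeral)

lemma homogeneous_uminus: "homogeneous d f \<Longrightarrow> homogeneous d (- f)"
  by (simp add: homogeneous_iff)

lemma homogeneous_diff: "homogeneous d f \<Longrightarrow> homogeneous d g \<Longrightarrow> homogeneous d (f - g)"
  using homogeneous_add[of d f "- g"] by (simp add: homogeneous_uminus)

lemma homogeneous_square: "homogeneous 1 f \<Longrightarrow> homogeneous 2 (f ^ 2)"
  using homogeneous_mult[of 1 f 1 f] unfolding one_add_one by (simp add: power2_eq_square)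

lemma homogeneous_product: "homogeneous 1 f \<Longrightarrow> homogeneous 1 g \<Longrightarrow> homogeneous 2 (f * g)"
  using homogeneous_mult[of 1 f 1 g] unfolding one_add_one .

lemmas homogeneous_intros = homogeneous_add homogeneous_diff homogeneous_uminus
  homogeneous_numeral_mult homogeneous_square homogeneous_product homogeneous_var

lemma homogeneous_Suc_mult: "homogeneous 1 v \<Longrightarrow> homogeneous d f \<Longrightarrow> homogeneous (Suc d) (v * f)"
  using homogeneous_mult[of 1 v d f] by simp

lemma qeval_homogeneous:
  assumes "homogeneous d f"
  shows "qeval (\<lambda>i. s * v i) f = s ^ d * qeval v f"
proof -
  have "(\<Prod>i \<in> Poly_Mapping.keys m. (s * v i) ^ Poly_Mapping.lookup m i) =
      s ^ mdeg m * (\<Prod>i \<in> Poly_Mapping.keys m. v i ^ Poly_Mapping.lookup m i)" for m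
    by (simp add: mdeg_def power_mult_distrib prod.distrib power_sum)
  then show ?thesis
    using assms by (simp add: qeval_def homogeneous_iff sum_distrib_left mult_ac)
qed

definition component :: "nat \<Rightarrow> 'v qpoly \<Rightarrow> 'v qpoly" where
  "component d f = (\<Sum>m \<in> {m \<in> Poly_Mapping.keys f. mdeg m = d}. Poly_Mapping.single m
    (Poly_Mapping.lookup f m))"

lemma homogeneous_sum: "(\<And>x. x \<in> A \<Longrightarrow> homogeneous d (f x)) \<Longrightarrow> homogeneous d (sum f A)"
  by (induction A rule: infinite_finite_induct) (auto simp: homogeneous_0 homogeneous_add)

lemma homogeneous_single: "mdeg m = d \<Longrightarrow> homogeneous d (Poly_Mapping.single m c)"
  by (simp add: homogeneous_iff)

lemma homogeneous_component: "homogeneous d (component d f)"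
  unfolding component_def by (rule homogeneous_sum) (simp add: homogeneous_single)

lemma sum_components: "f = (\<Sum>d \<in> mdeg ` Poly_Mapping.keys f. component d f)"
proof -
  have "f = (\<Sum>m \<in> Poly_Mapping.keys f. Poly_Mapping.single m (Poly_Mapping.lookup f m))"
    by (rule qpoly_as_sum)
  also have "\<dots> = (\<Sum>d \<in> mdeg ` Poly_Mapping.keys f. component d f)"
    unfolding component_def by (rule sum.group[symmetric]) auto
  finally show ?thesis .
qed

lemma homogeneous_induct [consumes 1, case_names const add var]:
  assumes f: "homogeneous d f"
    and const: "\<And>c. P 0 (const c)"
    and add: "\<And>d f g. homogeneous d f \<Longrightarrow> homogeneous d g \<Longrightarrow> P d f \<Longrightarrow> P d g \<Longrightarrow> P d (f + g)"
    and var: "\<And>d i f. homogeneous d f \<Longrightarrow> P d f \<Longrightarrow> P (Suc d) (var i * f)"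
  shows "P d f"
proof -
  have single: "P (mdeg m) (Poly_Mapping.single m c)" for m c
  proof (induction m rule: qpoly_term_induct)
    case zero
    then show ?case using const[of c] by (simp add: const_def mdeg_def)
  next
    case (add i k m)
    have step: "Poly_Mapping.single (Poly_Mapping.single i (Suc k) + m) c =
        var i * Poly_Mapping.single (Poly_Mapping.single i k + m) c" for k
      by (simp add: var_def mult_single add.assoc[symmetric] single_add[symmetric])
    show ?case
    proof (induction k)
      case 0
      then show ?case using add by simp
    next
      case (Suc k)
      from var[OF homogeneous_single[OF refl] this, of i] show ?case
        by (simp add: step mdeg_add mdeg_single)
    qed
  qed
  have zero: "P d 0"
  proof -
    have "P d (Poly_Mapping.single (Poly_Mapping.single undefined d) 0)"
      using single[of "Poly_Mapping.single undefined d" 0] by (simp add: mdeg_single)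
    then show ?thesis by simp
  qed
  have "P d (\<Sum>m \<in> A. Poly_Mapping.single m (Poly_Mapping.lookup f m))"
    if "finite A" "A \<subseteq> Poly_Mapping.keys f" for A
    using that
  proof (induction A)
    case empty
    then show ?case by (simp add: zero)
  next
    case (insert m A)
    then have "mdeg m = d" using f by (auto simp: homogeneous_iff)
    moreover have "homogeneous d (\<Sum>m \<in> A. Poly_Mapping.single m (Poly_Mapping.lookup f m))"
      using insert f by (intro homogeneous_sum homogeneous_single) (auto simp: homogeneous_iff)
    ultimately show ?case
      using insert single[of m "Poly_Mapping.lookup f m"] by (auto intro!: add homogeneous_single)
  qed
  from this[OF Poly_Mapping.finite_keys order.refl] show ?thesis
    using qpoly_as_sum[of f] by metis
qed

section \<open>Reduction modulo a hyperplane section\<close>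

definition qu :: "8 qpoly" where "qu = form_X var"
definition qv :: "8 qpoly" where "qv = form_Y var"
definition qw :: "8 qpoly" where "qw = form_Z var"
definition ql :: "8 qpoly" where "ql = odd_l var"
definition qb :: "8 qpoly" where "qb = odd_b var"
definition qa :: "8 qpoly" where "qa = odd_a var"
definition qc :: "8 qpoly" where "qc = odd_c var"
definition qe :: "8 qpoly" where "qe = odd_e var"

lemmas q_defs = qu_def qv_def qw_def ql_def qb_def qa_def qc_def qe_def
lemmas form_defs = form_X_def form_Y_def form_Z_def odd_a_def odd_b_def odd_c_def odd_e_def odd_l_def

lemma q_homogeneous: "homogeneous 1 qu" "homogeneous 1 qv" "homogeneous 1 qw" "homogeneous 1 ql"
  "homogeneous 1 qb" "homogeneous 1 qa" "homogeneous 1 qc" "homogeneous 1 qe"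
  unfolding q_defs form_defs mult_minus_left by (intro homogeneous_intros)+

lemma exhaust_8: "i \<in> {1, 2, 3, 4, 5, 6, 7, 8 :: 8}"
proof (cases i)
  case (of_int z)
  then have "z \<in> {0, 1, 2, 3, 4, 5, 6, 7}" by auto
  moreover have "(8 :: 8) = 0" by simp
  ultimately show ?thesis using of_int by auto
qed

lemma var_eq_of_eigenforms: "26 * var i = of_eigenforms qu qv qw ql qb qa qc qe i"
proof -
  have "i \<in> {1, 2, 3, 4, 5, 6, 7, 8}" by (rule exhaust_8)
  moreover have "26 * var 1 = of_eigenforms qu qv qw ql qb qa qc qe 1" "26 * var 2 = of_eigenforms
    qu qv qw ql qb qa qc qe 2"
    "26 * var 3 = of_eigenforms qu qv qw ql qb qa qc qe 3" "26 * var 4 = of_eigenforms qu qv qw ql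
      qb qa qc qe 4"
    "26 * var 5 = of_eigenforms qu qv qw ql qb qa qc qe 5" "26 * var 6 = of_eigenforms qu qv qw ql
      qb qa qc qe 6"
    "26 * var 7 = of_eigenforms qu qv qw ql qb qa qc qe 7" "26 * var 8 = of_eigenforms qu qv qw ql
      qb qa qc qe 8"
    unfolding of_eigenforms_nth q_defs form_defs by Groebner_Basis.algebra+
  ultimately show ?thesis by (elim insertE emptyE) (simp_all only:)
qed

text \<open>
  With their degrees: monomials that span the homogeneous coordinate ring modulo \<open>l\<close> as a module over
  \<open>\<rat>[b]\<close>. The first seven involve an even number of the forms \<open>X, Y, Z\<close>, the last seven an odd number.
\<close>

definition standard_basis :: "(nat \<times> 8 qpoly) list" where
  "standard_basis = [(0, 1), (1, qa), (1, qc), (1, qe), (2, qa * qc), (2, qa * qe), (2, qc * qe),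
    (1, qu), (1, qv), (1, qw), (2, qu * qe), (2, qw * qa), (2, qw * qe), (3, qw * (qc * qe))]"

text \<open>
  Congruence of a form of degree \<open>d\<close> to a rational combination of the \<open>b ^ n * f\<close> of degree \<open>d\<close>,
  modulo the quadrics and \<open>l\<close>. The cofactor of \<open>l\<close> is kept homogeneous, since it is
  the form to which the descent passes.
\<close>

inductive reducible :: "nat \<Rightarrow> 8 qpoly \<Rightarrow> bool" where
  basis: "(k, f) \<in> set standard_basis \<Longrightarrow> reducible (n + k) (qb ^ n * f)"
| add: "reducible d f \<Longrightarrow> reducible d g \<Longrightarrow> reducible d (f + g)"
| scale: "reducible d f \<Longrightarrow> reducible d (const c * f)"
| ideal: "f \<in> ideal_C \<Longrightarrow> reducible d f"
| line: "homogeneous d g \<Longrightarrow> reducible (Suc d) (ql * g)"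

lemma ideal_C_closed:
  "0 \<in> ideal_C" "f \<in> ideal_C \<Longrightarrow> g \<in> ideal_C \<Longrightarrow> f + g \<in> ideal_C"
  "f \<in> ideal_C \<Longrightarrow> h * f \<in> ideal_C" "f \<in> set (quadrics var) \<Longrightarrow> f \<in> ideal_C"
  unfolding ideal_C_def canonical_quadrics_eq by (auto intro: qpoly_Idl_closed)

lemma reducible_qb: "reducible d f \<Longrightarrow> reducible (Suc d) (qb * f)"
proof (induction rule: reducible.induct)
  case (basis k f n)
  from reducible.basis[OF this, of "Suc n"] show ?case by (simp add: mult.assoc)
next
  case (line d g)
  from reducible.line[OF homogeneous_Suc_mult[OF q_homogeneous(5) line]] show ?case
    by (simp add: mult.left_commute)
next
  case (scale d f c)
  from reducible.scale[OF scale.IH, of c] show ?case by (simp add: mult.left_commute)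
qed (auto simp: distrib_left intro: reducible.intros ideal_C_closed)

lemma reducible_low: "reducible 0 1" "reducible 1 qa" "reducible 1 qc" "reducible 1 qe" "reducible 1
  qu" "reducible 1 qv" "reducible 1 qw"
  "reducible 2 (qa * qc)" "reducible 2 (qa * qe)" "reducible 2 (qc * qe)"
  "reducible 2 (qu * qe)" "reducible 2 (qw * qa)" "reducible 2 (qw * qe)" "reducible 3 (qw * (qc * qe))"
  using reducible.basis[where n = 0] by (auto simp: standard_basis_def)

lemma reducible_times_qb: "reducible 1 qb" "reducible 1 f \<Longrightarrow> reducible 2 (qb * f)" "reducible 2 f \<Longrightarrow>
  reducible 3 (qb * f)"
  "reducible 3 f \<Longrightarrow> reducible 4 (qb * f)"
  using reducible_qb[of 0 1] reducible_qb[of 1 f] reducible_qb[of 2 f] reducible_qb[of 3 f]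
    reducible_low(1)
  by (simp_all add: eval_nat_numeral)

lemma combination_in_ideal_C:
  "set xs \<subseteq> ideal_C \<Longrightarrow> combination cs xs \<in> ideal_C"
  unfolding combination_def
  by (induction cs xs rule: list_induct2') (auto intro: ideal_C_closed)

lemma relations_in_ideal_C: "set (relations qu qv qw ql qb qa qc qe) \<subseteq> ideal_C"
  unfolding q_defs relations_forms using ideal_C_closed(4) combination_in_ideal_C[of "quadrics var"]
  by auto

definition rels_mod_l :: "8 qpoly list" where
  "rels_mod_l = relations qu qv qw 0 qb qa qc qe"

lemma rels_mod_l_eq:
  "rels_mod_l = [
    2 * qa ^ 2 - 4 * qa * qc - 5 * qa * qe + 6 * qc * qe - 3 * qb * qa + 3 * qb * qc + qb *
      qe + 2 * qb ^ 2,
    2 * qc ^ 2 + 3 * qa * qe - 4 * qc * qe + qb * qa - qb * qe - qb ^ 2,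
    qe ^ 2 + qa * qc - qa * qe - qc * qe + 2 * qb * qa - 2 * qb * qc - qb ^ 2,
    2 * qu * qa - 3 * qu * qe + 2 * qw * qa - qu * qb + 2 * qv * qb - qw * qb,
    qu * qc + qw * qa + qu * qb + qw * qb,
    2 * qv * qa - qu * qe + 2 * qw * qe + qu * qb + qw * qb,
    qv * qc + qw * qe + qu * qb + qw * qb,
    2 * qv * qe - qu * qe - qw * qa + 3 * qw * qe + 2 * qu * qb - qv * qb + qw * qb,
    4 * qw * qc - 3 * qu * qe - 3 * qw * qa + qw * qe - 2 * qu * qb + 3 * qv * qb - qw * qb,
    2 * qu ^ 2 + 12 * qa * qc + 15 * qa * qe - 18 * qc * qe - 7 * qb * qa + 7 * qb * qc - 3
      * qb * qe + 2 * qb ^ 2,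
    2 * qu * qv - 5 * qa * qe + 14 * qc * qe - qb * qa - qb * qc + 9 * qb * qe - 2 * qb ^ 2,
    qu * qw - 5 * qa * qc - 2 * qa * qe + 6 * qc * qe + 3 * qb * qa - qb * qc - 3 * qb * qe,
    2 * qv ^ 2 - 4 * qa * qc - 5 * qa * qe + 22 * qc * qe - 7 * qb * qa - qb * qc + 17 * qb
      * qe - 4 * qb ^ 2,
    qv * qw + qa * qc + qa * qe - 4 * qc * qe + 4 * qb * qa - 4 * qb * qc - 3 * qb * qe - qb
      ^ 2,
    2 * qw ^ 2 + 2 * qa * qc + 9 * qa * qe - 10 * qc * qe - 19 * qb * qa + 16 * qb * qc - qb
      * qe + 9 * qb ^ 2]"
  by (simp add: rels_mod_l_def relations_def)

text \<open>
  What \<open>l\<close> is multiplied with in each of the fifteen relations.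
\<close>

definition line_cofactors :: "8 qpoly list" where
  "line_cofactors = [3 * ql + 3 * qb - 7 * qa + 5 * qc + 3 * qe,
     - (3 * ql) - 2 * qb + 6 * qa - 3 * qc - 3 * qe,
     - ql - qb + 2 * qa - qc,
     - (3 * qu) + 2 * qv - qw,
     qw,
     - qu - qw,
     0,
     - qu + qv - 2 * qw,
     - (3 * qu) + 3 * qv,
     7 * ql + 15 * qb + 5 * qa + qc - 9 * qe,
     15 * ql + 7 * qb - 11 * qa + 9 * qc + 15 * qe,
     - ql - 3 * qb + 2 * qa + qc - qe,
     11 * ql - 9 * qb - 3 * qa - 3 * qc + 11 * qe,
     - (4 * ql) - 4 * qb + 8 * qa - 4 * qc - 4 * qe,
     9 * ql + 8 * qb - 18 * qa - qc + 9 * qe]"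

lemma relations_split:
  "relations qu qv qw ql qb qa qc qe = map2 (\<lambda>r g. r + ql * g) rels_mod_l line_cofactors"
  unfolding rels_mod_l_eq relations_def line_cofactors_def
  by (simp only: list.map zip_Cons_Cons zip_Nil prod.case list.inject, intro conjI refl;
    Groebner_Basis.algebra)

lemma line_cofactors_homogeneous: "g \<in> set line_cofactors \<Longrightarrow> homogeneous 1 g"
  unfolding line_cofactors_def list.set insert_iff empty_iff
  by (elim disjE FalseE; hypsubst; intro homogeneous_intros homogeneous_0 q_homogeneous)

lemma reducible_relation:
  assumes "homogeneous d g" "k < 15"
  shows "reducible (d + 2) (g * (rels_mod_l ! k))"
proof -
  have len: "length rels_mod_l = 15" "length line_cofactors = 15" "length (relations qu qv qw ql qb
    qa qc qe) = 15"
    by (simp_all add: rels_mod_l_def relations_def line_cofactors_def)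
  define h where "h = line_cofactors ! k"
  have h: "homogeneous 1 h"
    unfolding h_def using assms(2) len by (intro line_cofactors_homogeneous nth_mem) simp
  have "rels_mod_l ! k + ql * h = relations qu qv qw ql qb qa qc qe ! k"
    unfolding relations_split h_def using assms(2) len by simp
  also have "\<dots> \<in> ideal_C"
    using relations_in_ideal_C assms(2) len by (metis nth_mem subsetD)
  finally have "g * (rels_mod_l ! k + ql * h) \<in> ideal_C"
    by (rule ideal_C_closed)
  then have "reducible (d + 2) (g * (rels_mod_l ! k + ql * h))"
    by (rule reducible.ideal)
  moreover have "reducible (d + 2) (ql * (const (-1) * (g * h)))"
    using reducible.line[OF homogeneous_const_mult[OF homogeneous_mult[OF assms(1) h]]] by simp
  ultimately have "reducible (d + 2) (g * (rels_mod_l ! k + ql * h) + ql * (const (-1) * (g * h)))"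
    by (rule reducible.add)
  moreover have "const (-1) = (- 1 :: 8 qpoly)"
    by (simp add: const_def flip: single_one single_uminus)
  ultimately show ?thesis by (simp add: algebra_simps)
qed

lemma const_of_int: "const (of_int n) = of_int n"
  by (simp add: const_def)

lemma reducible_of_int_mult: "reducible d f \<Longrightarrow> reducible d (of_int n * f)"
  using reducible.scale[of d f "of_int n"] by (simp add: const_of_int)

lemma reducible_0: "reducible d 0"
  by (rule reducible.ideal[OF ideal_C_closed(1)])

text \<open>
  A certificate expresses a multiple of \<open>m\<close> by reducible terms \<open>ns\<close> and multiples \<open>rs\<close> of the
  relations modulo \<open>l\<close>. The certificates below come from solving linear systems over \<open>\<rat>\<close>.
\<close>

lemma reducible_by_certificate:
  assumes valid: "n = d + 2 \<and> D \<noteq> 0 \<and> list_all (\<lambda>(c, t). reducible n t) ns \<and>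
      list_all (\<lambda>(c, g, k). homogeneous d g \<and> k < 15) rs"
    and eq: "of_int D * m = sum_list (map (\<lambda>(c, t). of_int c * t) ns) +
      sum_list (map (\<lambda>(c, g, k). of_int c * (g * (rels_mod_l ! k))) rs)"
  shows "reducible n m"
proof -
  have n: "n = d + 2" and D: "D \<noteq> 0" and ns: "list_all (\<lambda>(c, t). reducible n t) ns"
    and rs: "list_all (\<lambda>(c, g, k). homogeneous d g \<and> k < 15) rs"
    using valid by blast+
  have "reducible (d + 2) (sum_list (map (\<lambda>(c, t). of_int c * t) ns))"
    using ns unfolding n by (induction ns) (auto intro: reducible.add reducible_of_int_mult reducible_0)
  moreover have "reducible (d + 2) (sum_list (map (\<lambda>(c, g, k). of_int c * (g * (rels_mod_l ! k))) rs))"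
    using rs by (induction rs) (auto intro: reducible.add reducible_of_int_mult reducible_0
      reducible_relation[unfolded add_2_eq_Suc'])
  ultimately have "reducible (d + 2) (of_int D * m)"
    unfolding eq by (rule reducible.add)
  from reducible.scale[OF this, of "inverse (of_int D)"] show ?thesis
    using D by (simp add: n const_mult const_1 flip: const_of_int mult.assoc)
qed

lemma homogeneous_certificate: "homogeneous 0 1" "homogeneous 1 f \<Longrightarrow> homogeneous 1 g \<Longrightarrow> homogeneous 2
  (f * g)"
  by (auto intro: homogeneous_1 homogeneous_product)

lemmas rels_mod_l_nth =
  arg_cong[OF rels_mod_l_eq, of "\<lambda>xs. xs ! 0", simplified]
  arg_cong[OF rels_mod_l_eq, of "\<lambda>xs. xs ! 1", simplified, folded One_nat_def]
  arg_cong[OF rels_mod_l_eq, of "\<lambda>xs. xs ! 2", simplified]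
  arg_cong[OF rels_mod_l_eq, of "\<lambda>xs. xs ! 3", simplified]
  arg_cong[OF rels_mod_l_eq, of "\<lambda>xs. xs ! 4", simplified]
  arg_cong[OF rels_mod_l_eq, of "\<lambda>xs. xs ! 5", simplified]
  arg_cong[OF rels_mod_l_eq, of "\<lambda>xs. xs ! 6", simplified]
  arg_cong[OF rels_mod_l_eq, of "\<lambda>xs. xs ! 7", simplified]
  arg_cong[OF rels_mod_l_eq, of "\<lambda>xs. xs ! 8", simplified]
  arg_cong[OF rels_mod_l_eq, of "\<lambda>xs. xs ! 9", simplified]
  arg_cong[OF rels_mod_l_eq, of "\<lambda>xs. xs ! 10", simplified]
  arg_cong[OF rels_mod_l_eq, of "\<lambda>xs. xs ! 11", simplified]
  arg_cong[OF rels_mod_l_eq, of "\<lambda>xs. xs ! 12", simplified]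
  arg_cong[OF rels_mod_l_eq, of "\<lambda>xs. xs ! 13", simplified]
  arg_cong[OF rels_mod_l_eq, of "\<lambda>xs. xs ! 14", simplified]

lemmas certificate_simps = rels_mod_l_nth list.map prod.case sum_list.Cons sum_list.Nil of_int_numeral
  of_int_neg_numeral of_int_minus of_int_1

lemma reducible_quadratic:
  "reducible 2 (qa * qa)"
  "reducible 2 (qc * qc)"
  "reducible 2 (qe * qe)"
  "reducible 2 (qu * qa)"
  "reducible 2 (qu * qc)"
  "reducible 2 (qv * qa)"
  "reducible 2 (qv * qc)"
  "reducible 2 (qv * qe)"
  "reducible 2 (qw * qc)"
  "reducible 2 (qu * qu)"
  "reducible 2 (qu * qv)"
  "reducible 2 (qu * qw)"
  "reducible 2 (qv * qv)"
  "reducible 2 (qv * qw)"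
  "reducible 2 (qw * qw)"
proof -
  note [simp] = reducible_times_qb q_homogeneous homogeneous_certificate reducible_low
  note [simp del] = One_nat_def
  show "reducible 2 (qa * qa)"
    by (rule reducible_by_certificate[where d = 0 and D = 2 and
      ns = "[(4, qa * qc), (5, qa * qe), (-6, qc * qe), (3, qb * qa), (-3, qb * qc), (-1, qb
        * qe), (-2, qb * qb)]" and
      rs = "[(1, 1, 0)]"],
      simp, simp only: certificate_simps, Groebner_Basis.algebra)
  show "reducible 2 (qc * qc)"
    by (rule reducible_by_certificate[where d = 0 and D = 2 and
      ns = "[(-3, qa * qe), (4, qc * qe), (-1, qb * qa), (1, qb * qe), (1, qb * qb)]" and
      rs = "[(1, 1, 1)]"],
      simp, simp only: certificate_simps, Groebner_Basis.algebra)
  show "reducible 2 (qe * qe)"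
    by (rule reducible_by_certificate[where d = 0 and D = 1 and
      ns = "[(-1, qa * qc), (1, qa * qe), (1, qc * qe), (-2, qb * qa), (2, qb * qc), (1, qb
        * qb)]" and
      rs = "[(1, 1, 2)]"],
      simp, simp only: certificate_simps, Groebner_Basis.algebra)
  show "reducible 2 (qu * qa)"
    by (rule reducible_by_certificate[where d = 0 and D = 2 and
      ns = "[(3, qu * qe), (-2, qw * qa), (1, qb * qu), (-2, qb * qv), (1, qb * qw)]" and
      rs = "[(1, 1, 3)]"],
      simp, simp only: certificate_simps, Groebner_Basis.algebra)
  show "reducible 2 (qu * qc)"
    by (rule reducible_by_certificate[where d = 0 and D = 1 and
      ns = "[(-1, qw * qa), (-1, qb * qu), (-1, qb * qw)]" and
      rs = "[(1, 1, 4)]"],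
      simp, simp only: certificate_simps, Groebner_Basis.algebra)
  show "reducible 2 (qv * qa)"
    by (rule reducible_by_certificate[where d = 0 and D = 2 and
      ns = "[(1, qu * qe), (-2, qw * qe), (-1, qb * qu), (-1, qb * qw)]" and
      rs = "[(1, 1, 5)]"],
      simp, simp only: certificate_simps, Groebner_Basis.algebra)
  show "reducible 2 (qv * qc)"
    by (rule reducible_by_certificate[where d = 0 and D = 1 and
      ns = "[(-1, qw * qe), (-1, qb * qu), (-1, qb * qw)]" and
      rs = "[(1, 1, 6)]"],
      simp, simp only: certificate_simps, Groebner_Basis.algebra)
  show "reducible 2 (qv * qe)"
    by (rule reducible_by_certificate[where d = 0 and D = 2 and
      ns = "[(1, qu * qe), (1, qw * qa), (-3, qw * qe), (-2, qb * qu), (1, qb * qv), (-1, qb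
        * qw)]" and
      rs = "[(1, 1, 7)]"],
      simp, simp only: certificate_simps, Groebner_Basis.algebra)
  show "reducible 2 (qw * qc)"
    by (rule reducible_by_certificate[where d = 0 and D = 4 and
      ns = "[(3, qu * qe), (3, qw * qa), (-1, qw * qe), (2, qb * qu), (-3, qb * qv), (1, qb
        * qw)]" and
      rs = "[(1, 1, 8)]"],
      simp, simp only: certificate_simps, Groebner_Basis.algebra)
  show "reducible 2 (qu * qu)"
    by (rule reducible_by_certificate[where d = 0 and D = 2 and
      ns = "[(-12, qa * qc), (-15, qa * qe), (18, qc * qe), (7, qb * qa), (-7, qb * qc), (3,
        qb * qe), (-2, qb * qb)]" and
      rs = "[(1, 1, 9)]"],
      simp, simp only: certificate_simps, Groebner_Basis.algebra)
  show "reducible 2 (qu * qv)"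
    by (rule reducible_by_certificate[where d = 0 and D = 2 and
      ns = "[(5, qa * qe), (-14, qc * qe), (1, qb * qa), (1, qb * qc), (-9, qb * qe), (2, qb
        * qb)]" and
      rs = "[(1, 1, 10)]"],
      simp, simp only: certificate_simps, Groebner_Basis.algebra)
  show "reducible 2 (qu * qw)"
    by (rule reducible_by_certificate[where d = 0 and D = 1 and
      ns = "[(5, qa * qc), (2, qa * qe), (-6, qc * qe), (-3, qb * qa), (1, qb * qc), (3, qb
        * qe)]" and
      rs = "[(1, 1, 11)]"],
      simp, simp only: certificate_simps, Groebner_Basis.algebra)
  show "reducible 2 (qv * qv)"
    by (rule reducible_by_certificate[where d = 0 and D = 2 and
      ns = "[(4, qa * qc), (5, qa * qe), (-22, qc * qe), (7, qb * qa), (1, qb * qc), (-17,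
        qb * qe), (4, qb * qb)]" and
      rs = "[(1, 1, 12)]"],
      simp, simp only: certificate_simps, Groebner_Basis.algebra)
  show "reducible 2 (qv * qw)"
    by (rule reducible_by_certificate[where d = 0 and D = 1 and
      ns = "[(-1, qa * qc), (-1, qa * qe), (4, qc * qe), (-4, qb * qa), (4, qb * qc), (3, qb
        * qe), (1, qb * qb)]" and
      rs = "[(1, 1, 13)]"],
      simp, simp only: certificate_simps, Groebner_Basis.algebra)
  show "reducible 2 (qw * qw)"
    by (rule reducible_by_certificate[where d = 0 and D = 2 and
      ns = "[(-2, qa * qc), (-9, qa * qe), (10, qc * qe), (19, qb * qa), (-16, qb * qc), (1,
        qb * qe), (-9, qb * qb)]" and
      rs = "[(1, 1, 14)]"],
      simp, simp only: certificate_simps, Groebner_Basis.algebra)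
qed

text \<open>
  The three quadrics in \<open>a, b, c, e\<close> alone do not define the image of the curve in the space of odd
  coordinates; one more cubic is needed. It comes from multiplying bilinear relations by \<open>X, Y, Z\<close>
  and replacing the products of \<open>X, Y, Z\<close>.
\<close>

lemma reducible_ace:
  "reducible 3 (qa * (qc * qe))"
proof -
  note [simp] = reducible_times_qb q_homogeneous homogeneous_certificate reducible_low
    reducible_quadratic
  note [simp del] = One_nat_def
  show "reducible 3 (qa * (qc * qe))"
    by (rule reducible_by_certificate[where d = 1 and D = 8 and
      ns = "[(8, qb * (qa * qc)), (-16, qb * (qa * qe)), (-8, qb * (qc * qc)), (16, qb * (qc
        * qe)), (8, qb * (qb * qe))]" and
      rs = "[(-2, qc, 13), (-10, qc, 2), (1, qa, 14), (-2, qw, 4), (3, qe, 1), (2, qe, 0),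
        (-6, qc, 0), (-1, qe, 14), (2, qc, 11), (10, qa, 2), (2, qw, 6), (-1, qa, 1)]"],
      simp, simp only: certificate_simps, Groebner_Basis.algebra)
qed

lemma reducible_odd_cubic:
  "reducible 3 (qa * (qa * qa))"
  "reducible 3 (qa * (qa * qc))"
  "reducible 3 (qa * (qa * qe))"
  "reducible 3 (qa * (qc * qc))"
  "reducible 3 (qa * (qe * qe))"
  "reducible 3 (qc * (qc * qc))"
  "reducible 3 (qc * (qc * qe))"
  "reducible 3 (qc * (qe * qe))"
  "reducible 3 (qe * (qe * qe))"
proof -
  note [simp] = reducible_times_qb q_homogeneous homogeneous_certificate reducible_low
    reducible_quadratic reducible_ace
  note [simp del] = One_nat_def
  show "reducible 3 (qa * (qa * qa))"
    by (rule reducible_by_certificate[where d = 1 and D = 18 and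
      ns = "[(-50, qb * (qa * qa)), (121, qb * (qa * qc)), (4, qb * (qa * qe)), (-108, qb *
        (qc * qc)), (61, qb * (qc * qe)), (-22, qb * (qe * qe)), (39, qb * (qb * qa)), (-58,
        qb * (qb * qc)), (1, qb * (qb * qe)), (20, qa * (qc * qe))]" and
      rs = "[(9, qa, 0), (8, qc, 0), (-23, qe, 0), (37, qa, 1), (-45, qe, 1), (20, qa, 2),
        (-42, qc, 2)]"],
      simp, simp only: certificate_simps, Groebner_Basis.algebra)
  show "reducible 3 (qa * (qa * qc))"
    by (rule reducible_by_certificate[where d = 1 and D = 3 and
      ns = "[(-11, qb * (qa * qa)), (19, qb * (qa * qc)), (4, qb * (qa * qe)), (-9, qb * (qc
        * qc)), (-2, qb * (qc * qe)), (-1, qb * (qe * qe)), (6, qb * (qb * qa)), (-4, qb *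
        (qb * qc)), (-2, qb * (qb * qe)), (2, qa * (qc * qe))]" and
      rs = "[(-1, qc, 0), (1, qe, 0), (1, qa, 1), (5, qa, 2), (-6, qc, 2)]"],
      simp, simp only: certificate_simps, Groebner_Basis.algebra)
  show "reducible 3 (qa * (qa * qe))"
    by (rule reducible_by_certificate[where d = 1 and D = 9 and
      ns = "[(11, qb * (qa * qa)), (-16, qb * (qa * qc)), (-7, qb * (qa * qe)), (17, qb *
        (qc * qe)), (-2, qb * (qe * qe)), (-3, qb * (qb * qa)), (-2, qb * (qb * qc)), (5, qb
        * (qb * qe)), (10, qa * (qc * qe))]" and
      rs = "[(4, qc, 0), (-7, qe, 0), (5, qa, 1), (-9, qe, 1), (-8, qa, 2), (6, qc, 2)]"],
      simp, simp only: certificate_simps, Groebner_Basis.algebra)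
  show "reducible 3 (qa * (qc * qc))"
    by (rule reducible_by_certificate[where d = 1 and D = 6 and
      ns = "[(-14, qb * (qa * qa)), (16, qb * (qa * qc)), (10, qb * (qa * qe)), (-17, qb *
        (qc * qe)), (2, qb * (qe * qe)), (6, qb * (qb * qa)), (2, qb * (qb * qc)), (-5, qb *
        (qb * qe)), (2, qa * (qc * qe))]" and
      rs = "[(-4, qc, 0), (7, qe, 0), (-2, qa, 1), (9, qe, 1), (8, qa, 2), (-6, qc, 2)]"],
      simp, simp only: certificate_simps, Groebner_Basis.algebra)
  show "reducible 3 (qa * (qe * qe))"
    by (rule reducible_by_certificate[where d = 1 and D = 9 and
      ns = "[(26, qb * (qa * qa)), (-55, qb * (qa * qc)), (-19, qb * (qa * qe)), (27, qb *
        (qc * qc)), (23, qb * (qc * qe)), (1, qb * (qe * qe)), (-12, qb * (qb * qa)), (10,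
        qb * (qb * qc)), (11, qb * (qb * qe)), (13, qa * (qc * qe))]" and
      rs = "[(7, qc, 0), (-10, qe, 0), (2, qa, 1), (-9, qe, 1), (-14, qa, 2), (24, qc, 2)]"],
      simp, simp only: certificate_simps, Groebner_Basis.algebra)
  show "reducible 3 (qc * (qc * qc))"
    by (rule reducible_by_certificate[where d = 1 and D = 6 and
      ns = "[(-4, qb * (qa * qa)), (-1, qb * (qa * qc)), (8, qb * (qa * qe)), (6, qb * (qc *
        qc)), (-19, qb * (qc * qe)), (4, qb * (qe * qe)), (7, qb * (qb * qc)), (-4, qb * (qb
        * qe)), (1, qa * (qc * qe))]" and
      rs = "[(-2, qc, 0), (8, qe, 0), (-4, qa, 1), (3, qc, 1), (12, qe, 1), (4, qa, 2)]"],
      simp, simp only: certificate_simps, Groebner_Basis.algebra)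
  show "reducible 3 (qc * (qc * qe))"
    by (rule reducible_by_certificate[where d = 1 and D = 6 and
      ns = "[(-2, qb * (qa * qa)), (1, qb * (qa * qc)), (4, qb * (qa * qe)), (3, qb * (qc *
        qc)), (-11, qb * (qc * qe)), (2, qb * (qe * qe)), (2, qb * (qb * qc)), (-2, qb * (qb
        * qe)), (5, qa * (qc * qe))]" and
      rs = "[(-1, qc, 0), (4, qe, 0), (-2, qa, 1), (6, qe, 1), (2, qa, 2)]"],
      simp, simp only: certificate_simps, Groebner_Basis.algebra)
  show "reducible 3 (qc * (qe * qe))"
    by (rule reducible_by_certificate[where d = 1 and D = 2 and
      ns = "[(4, qb * (qa * qa)), (-9, qb * (qa * qc)), (-2, qb * (qa * qe)), (5, qb * (qc *
        qc)), (2, qb * (qc * qe)), (-2, qb * (qb * qa)), (2, qb * (qb * qc)), (1, qb * (qb *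
        qe)), (3, qa * (qc * qe))]" and
      rs = "[(1, qc, 0), (-1, qe, 0), (-1, qe, 1), (-2, qa, 2), (4, qc, 2)]"],
      simp, simp only: certificate_simps, Groebner_Basis.algebra)
  show "reducible 3 (qe * (qe * qe))"
    by (rule reducible_by_certificate[where d = 1 and D = 18 and
      ns = "[(88, qb * (qa * qa)), (-191, qb * (qa * qc)), (-92, qb * (qa * qe)), (99, qb *
        (qc * qc)), (100, qb * (qc * qe)), (2, qb * (qe * qe)), (-42, qb * (qb * qa)), (38,
        qb * (qb * qc)), (49, qb * (qb * qe)), (35, qa * (qc * qe))]" and
      rs = "[(23, qc, 0), (-29, qe, 0), (4, qa, 1), (-27, qe, 1), (-46, qa, 2), (84, qc, 2),
        (18, qe, 2)]"],
      simp, simp only: certificate_simps, Groebner_Basis.algebra)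
qed

text \<open>
  The eighteen monomials with one factor among \<open>X, Y, Z\<close> and two among \<open>a, c, e\<close> satisfy only
  seventeen independent relations; \<open>Z c e\<close> is the basis element of degree 3.
\<close>

lemma reducible_even_odd_odd:
  "reducible 3 (qu * (qa * qa))"
  "reducible 3 (qu * (qa * qc))"
  "reducible 3 (qu * (qa * qe))"
  "reducible 3 (qu * (qc * qc))"
  "reducible 3 (qu * (qc * qe))"
  "reducible 3 (qu * (qe * qe))"
  "reducible 3 (qv * (qa * qa))"
  "reducible 3 (qv * (qa * qc))"
  "reducible 3 (qv * (qa * qe))"
  "reducible 3 (qv * (qc * qc))"
  "reducible 3 (qv * (qc * qe))"
  "reducible 3 (qv * (qe * qe))"
  "reducible 3 (qw * (qa * qa))"
  "reducible 3 (qw * (qa * qc))"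
  "reducible 3 (qw * (qa * qe))"
  "reducible 3 (qw * (qc * qc))"
  "reducible 3 (qw * (qe * qe))"
proof -
  note [simp] = reducible_times_qb q_homogeneous homogeneous_certificate reducible_low
    reducible_quadratic
  note [simp del] = One_nat_def
  show "reducible 3 (qu * (qa * qa))"
    by (rule reducible_by_certificate[where d = 1 and D = 4 and
      ns = "[(20, qb * (qu * qa)), (2, qb * (qv * qa)), (15, qb * (qw * qa)), (-3, qb * (qu
        * qc)), (-12, qb * (qv * qc)), (8, qb * (qw * qc)), (-23, qb * (qu * qe)), (-26, qb
        * (qw * qe)), (2, qb * (qb * qw)), (-28, qw * (qc * qe))]" and
      rs = "[(-8, qw, 1), (-2, qa, 8), (2, qa, 3), (-5, qw, 0), (4, qc, 8), (-22, qa, 6),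
        (23, qe, 4), (11, qc, 5)]"],
      simp, simp only: certificate_simps, Groebner_Basis.algebra)
  show "reducible 3 (qu * (qa * qc))"
    by (rule reducible_by_certificate[where d = 1 and D = 2 and
      ns = "[(4, qb * (qu * qa)), (7, qb * (qw * qa)), (1, qb * (qu * qc)), (-4, qb * (qv *
        qc)), (-2, qb * (qw * qc)), (-7, qb * (qu * qe)), (-8, qb * (qw * qe)), (-2, qb *
        (qb * qw)), (-8, qw * (qc * qe))]" and
      rs = "[(-2, qa, 6), (2, qc, 3), (7, qe, 4), (1, qc, 5), (-2, qa, 4), (1, qw, 0)]"],
      simp, simp only: certificate_simps, Groebner_Basis.algebra)
  show "reducible 3 (qu * (qa * qe))"
    by (rule reducible_by_certificate[where d = 1 and D = 6 and
      ns = "[(18, qb * (qu * qa)), (6, qb * (qv * qa)), (17, qb * (qw * qa)), (-7, qb * (qu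
        * qc)), (-4, qb * (qv * qc)), (-4, qb * (qw * qc)), (-15, qb * (qu * qe)), (-14, qb
        * (qw * qe)), (2, qb * (qb * qw)), (-12, qw * (qc * qe))]" and
      rs = "[(-18, qa, 6), (2, qc, 3), (-2, qa, 8), (15, qe, 4), (9, qc, 5), (-4, qa, 4),
        (-1, qw, 0)]"],
      simp, simp only: certificate_simps, Groebner_Basis.algebra)
  show "reducible 3 (qu * (qc * qc))"
    by (rule reducible_by_certificate[where d = 1 and D = 3 and
      ns = "[(-6, qb * (qu * qa)), (-4, qb * (qw * qa)), (2, qb * (qu * qc)), (-3, qb * (qv
        * qc)), (1, qb * (qw * qc)), (-2, qb * (qw * qe)), (-2, qb * (qb * qw)), (-3, qw *
        (qc * qe))]" and
      rs = "[(-3, qc, 5), (1, qc, 8), (3, qc, 4), (-2, qw, 1), (6, qa, 6)]"],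
      simp, simp only: certificate_simps, Groebner_Basis.algebra)
  show "reducible 3 (qu * (qc * qe))"
    by (rule reducible_by_certificate[where d = 1 and D = 1 and
      ns = "[(2, qb * (qu * qa)), (2, qb * (qw * qa)), (-1, qb * (qu * qc)), (-1, qb * (qw *
        qc)), (-2, qb * (qu * qe)), (-2, qb * (qw * qe)), (-2, qw * (qc * qe))]" and
      rs = "[(2, qe, 4), (1, qc, 5), (-2, qa, 6)]"],
      simp, simp only: certificate_simps, Groebner_Basis.algebra)
  show "reducible 3 (qu * (qe * qe))"
    by (rule reducible_by_certificate[where d = 1 and D = 6 and
      ns = "[(-6, qb * (qw * qa)), (-2, qb * (qv * qc)), (8, qb * (qw * qc)), (-6, qb * (qu
        * qe)), (6, qb * (qv * qe)), (-6, qb * (qw * qe)), (2, qb * (qb * qw))]" and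
      rs = "[(-2, qw, 1), (-2, qe, 6), (4, qe, 4), (4, qw, 2), (1, qc, 7), (-2, qe, 8), (1,
        qc, 8)]"],
      simp, simp only: certificate_simps, Groebner_Basis.algebra)
  show "reducible 3 (qv * (qa * qa))"
    by (rule reducible_by_certificate[where d = 1 and D = 4 and
      ns = "[(10, qb * (qu * qa)), (-6, qb * (qv * qa)), (4, qb * (qw * qa)), (-6, qb * (qu
        * qc)), (-8, qb * (qu * qe)), (4, qb * (qv * qe)), (-8, qb * (qw * qe)), (-12, qw *
        (qc * qe))]" and
      rs = "[(3, qc, 3), (-2, qe, 3), (-6, qa, 4), (12, qe, 4), (2, qa, 5), (-3, qc, 5), (6,
        qe, 5), (6, qa, 6), (-12, qe, 6), (-6, qa, 7), (6, qc, 7)]"],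
      simp, simp only: certificate_simps, Groebner_Basis.algebra)
  show "reducible 3 (qv * (qa * qc))"
    by (rule reducible_by_certificate[where d = 1 and D = 1 and
      ns = "[(1, qb * (qu * qa)), (1, qb * (qw * qa)), (-1, qb * (qu * qc)), (-1, qb * (qw *
        qc)), (-1, qb * (qu * qe)), (-1, qb * (qw * qe)), (-2, qw * (qc * qe))]" and
      rs = "[(1, qe, 4), (1, qc, 5), (-1, qa, 6)]"],
      simp, simp only: certificate_simps, Groebner_Basis.algebra)
  show "reducible 3 (qv * (qa * qe))"
    by (rule reducible_by_certificate[where d = 1 and D = 3 and
      ns = "[(-1, qb * (qv * qa)), (-8, qb * (qw * qa)), (-6, qb * (qu * qc)), (4, qb * (qv
        * qc)), (6, qb * (qw * qc)), (1, qb * (qv * qe)), (1, qb * (qb * qv)), (4, qb * (qb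
        * qw)), (-6, qw * (qc * qe))]" and
      rs = "[(-4, qe, 6), (-2, qc, 6), (1, qv, 1), (4, qe, 4), (4, qw, 2), (4, qc, 7)]"],
      simp, simp only: certificate_simps, Groebner_Basis.algebra)
  show "reducible 3 (qv * (qc * qc))"
    by (rule reducible_by_certificate[where d = 1 and D = 1 and
      ns = "[(-1, qb * (qu * qc)), (-1, qb * (qw * qc)), (-1, qw * (qc * qe))]" and
      rs = "[(1, qc, 6)]"],
      simp, simp only: certificate_simps, Groebner_Basis.algebra)
  show "reducible 3 (qv * (qc * qe))"
    by (rule reducible_by_certificate[where d = 1 and D = 1 and
      ns = "[(-2, qb * (qw * qa)), (-2, qb * (qu * qc)), (1, qb * (qv * qc)), (1, qb * (qw *
        qc)), (1, qb * (qb * qw)), (-2, qw * (qc * qe))]" and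
      rs = "[(-1, qe, 6), (1, qe, 4), (1, qw, 2), (1, qc, 7)]"],
      simp, simp only: certificate_simps, Groebner_Basis.algebra)
  show "reducible 3 (qv * (qe * qe))"
    by (rule reducible_by_certificate[where d = 1 and D = 1 and
      ns = "[(7, qb * (qu * qa)), (-5, qb * (qv * qa)), (7, qb * (qw * qa)), (-6, qb * (qu *
        qc)), (8, qb * (qv * qc)), (-6, qb * (qw * qc)), (-2, qb * (qu * qe)), (-1, qb * (qw
        * qe)), (2, qb * (qb * qv)), (-2, qw * (qc * qe))]" and
      rs = "[(2, qa, 5), (1, qe, 6), (-1, qe, 8), (-3, qv, 1), (-9, qa, 6), (-2, qv, 0), (6,
        qc, 6), (1, qe, 3), (1, qv, 2)]"],
      simp, simp only: certificate_simps, Groebner_Basis.algebra)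
  show "reducible 3 (qw * (qa * qa))"
    by (rule reducible_by_certificate[where d = 1 and D = 2 and
      ns = "[(-6, qb * (qu * qa)), (-9, qb * (qw * qa)), (-1, qb * (qu * qc)), (4, qb * (qv
        * qc)), (2, qb * (qw * qc)), (7, qb * (qu * qe)), (8, qb * (qw * qe)), (2, qb * (qb
        * qw)), (8, qw * (qc * qe))]" and
      rs = "[(2, qa, 6), (-2, qc, 3), (-7, qe, 4), (-1, qc, 5), (4, qa, 4), (-1, qw, 0)]"],
      simp, simp only: certificate_simps, Groebner_Basis.algebra)
  show "reducible 3 (qw * (qa * qc))"
    by (rule reducible_by_certificate[where d = 1 and D = 3 and
      ns = "[(6, qb * (qu * qa)), (4, qb * (qw * qa)), (-5, qb * (qu * qc)), (3, qb * (qv *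
        qc)), (-4, qb * (qw * qc)), (2, qb * (qw * qe)), (2, qb * (qb * qw)), (3, qw * (qc *
        qe))]" and
      rs = "[(2, qw, 1), (-1, qc, 8), (-6, qa, 6), (3, qc, 5)]"],
      simp, simp only: certificate_simps, Groebner_Basis.algebra)
  show "reducible 3 (qw * (qa * qe))"
    by (rule reducible_by_certificate[where d = 1 and D = 1 and
      ns = "[(-2, qb * (qu * qa)), (-2, qb * (qw * qa)), (1, qb * (qu * qc)), (1, qb * (qw *
        qc)), (1, qb * (qu * qe)), (1, qb * (qw * qe)), (2, qw * (qc * qe))]" and
      rs = "[(-1, qe, 4), (-1, qc, 5), (2, qa, 6)]"],
      simp, simp only: certificate_simps, Groebner_Basis.algebra)
  show "reducible 3 (qw * (qc * qc))"
    by (rule reducible_by_certificate[where d = 1 and D = 4 and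
      ns = "[(-12, qb * (qw * qa)), (-4, qb * (qu * qc)), (10, qb * (qw * qc)), (6, qb * (qb
        * qw)), (-4, qw * (qc * qe))]" and
      rs = "[(-6, qe, 6), (6, qe, 4), (6, qw, 2), (3, qc, 7), (1, qc, 8)]"],
      simp, simp only: certificate_simps, Groebner_Basis.algebra)
  show "reducible 3 (qw * (qe * qe))"
    by (rule reducible_by_certificate[where d = 1 and D = 1 and
      ns = "[(2, qb * (qw * qa)), (2, qb * (qu * qc)), (-1, qb * (qv * qc)), (-1, qb * (qw *
        qc)), (-1, qb * (qu * qe)), (-1, qb * (qw * qe)), (-1, qb * (qb * qw)), (2, qw * (qc
        * qe))]" and
      rs = "[(2, qe, 6), (-1, qe, 4), (-1, qw, 2), (-1, qc, 7)]"],
      simp, simp only: certificate_simps, Groebner_Basis.algebra)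
qed

lemma reducible_even_even_odd:
  "reducible 3 (qu * (qu * qe))"
  "reducible 3 (qu * (qv * qe))"
  "reducible 3 (qu * (qw * qa))"
  "reducible 3 (qu * (qw * qe))"
  "reducible 3 (qv * (qw * qa))"
  "reducible 3 (qv * (qw * qe))"
  "reducible 3 (qw * (qw * qa))"
  "reducible 3 (qw * (qw * qe))"
proof -
  note [simp] = reducible_times_qb q_homogeneous homogeneous_certificate reducible_low
    reducible_quadratic reducible_ace reducible_odd_cubic
  note [simp del] = One_nat_def
  show "reducible 3 (qu * (qu * qe))"
    by (rule reducible_by_certificate[where d = 1 and D = 2 and
      ns = "[(-12, qa * (qc * qe)), (-15, qa * (qe * qe)), (18, qc * (qe * qe)), (7, qb *
        (qa * qe)), (-7, qb * (qc * qe)), (3, qb * (qe * qe)), (-2, qb * (qb * qe))]" and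
      rs = "[(1, qe, 9)]"],
      simp, simp only: certificate_simps, Groebner_Basis.algebra)
  show "reducible 3 (qu * (qv * qe))"
    by (rule reducible_by_certificate[where d = 1 and D = 2 and
      ns = "[(5, qa * (qe * qe)), (-14, qc * (qe * qe)), (1, qb * (qa * qe)), (1, qb * (qc *
        qe)), (-9, qb * (qe * qe)), (2, qb * (qb * qe))]" and
      rs = "[(1, qe, 10)]"],
      simp, simp only: certificate_simps, Groebner_Basis.algebra)
  show "reducible 3 (qu * (qw * qa))"
    by (rule reducible_by_certificate[where d = 1 and D = 1 and
      ns = "[(5, qa * (qa * qc)), (2, qa * (qa * qe)), (-6, qa * (qc * qe)), (-3, qb * (qa *
        qa)), (1, qb * (qa * qc)), (3, qb * (qa * qe))]" and
      rs = "[(1, qa, 11)]"],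
      simp, simp only: certificate_simps, Groebner_Basis.algebra)
  show "reducible 3 (qu * (qw * qe))"
    by (rule reducible_by_certificate[where d = 1 and D = 1 and
      ns = "[(5, qa * (qc * qe)), (2, qa * (qe * qe)), (-6, qc * (qe * qe)), (-3, qb * (qa *
        qe)), (1, qb * (qc * qe)), (3, qb * (qe * qe))]" and
      rs = "[(1, qe, 11)]"],
      simp, simp only: certificate_simps, Groebner_Basis.algebra)
  show "reducible 3 (qv * (qw * qa))"
    by (rule reducible_by_certificate[where d = 1 and D = 1 and
      ns = "[(-1, qa * (qa * qc)), (-1, qa * (qa * qe)), (4, qa * (qc * qe)), (-4, qb * (qa
        * qa)), (4, qb * (qa * qc)), (3, qb * (qa * qe)), (1, qb * (qb * qa))]" and
      rs = "[(1, qa, 13)]"],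
      simp, simp only: certificate_simps, Groebner_Basis.algebra)
  show "reducible 3 (qv * (qw * qe))"
    by (rule reducible_by_certificate[where d = 1 and D = 1 and
      ns = "[(-1, qa * (qc * qe)), (-1, qa * (qe * qe)), (4, qc * (qe * qe)), (-4, qb * (qa
        * qe)), (4, qb * (qc * qe)), (3, qb * (qe * qe)), (1, qb * (qb * qe))]" and
      rs = "[(1, qe, 13)]"],
      simp, simp only: certificate_simps, Groebner_Basis.algebra)
  show "reducible 3 (qw * (qw * qa))"
    by (rule reducible_by_certificate[where d = 1 and D = 2 and
      ns = "[(-2, qa * (qa * qc)), (-9, qa * (qa * qe)), (10, qa * (qc * qe)), (19, qb * (qa
        * qa)), (-16, qb * (qa * qc)), (1, qb * (qa * qe)), (-9, qb * (qb * qa))]" and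
      rs = "[(1, qa, 14)]"],
      simp, simp only: certificate_simps, Groebner_Basis.algebra)
  show "reducible 3 (qw * (qw * qe))"
    by (rule reducible_by_certificate[where d = 1 and D = 2 and
      ns = "[(-2, qa * (qc * qe)), (-9, qa * (qe * qe)), (10, qc * (qe * qe)), (19, qb * (qa
        * qe)), (-16, qb * (qc * qe)), (1, qb * (qe * qe)), (-9, qb * (qb * qe))]" and
      rs = "[(1, qe, 14)]"],
      simp, simp only: certificate_simps, Groebner_Basis.algebra)
qed

lemma reducible_odd_times_generator1:
  "reducible 4 (qw * (qa * (qc * qe)))"
proof -
  note [simp] = reducible_times_qb q_homogeneous homogeneous_certificate reducible_low
    reducible_quadratic reducible_even_odd_odd
  note [simp del] = One_nat_def
  show "reducible 4 (qw * (qa * (qc * qe)))"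
    by (rule reducible_by_certificate[where d = 2 and D = 8 and
      ns = "[(8, qb * (qw * (qa * qc))), (-16, qb * (qw * (qa * qe))), (-8, qb * (qw * (qc *
        qc))), (16, qb * (qw * (qc * qe))), (8, qb * (qb * (qw * qe)))]" and
      rs = "[(-2, qw * qc, 13), (-10, qw * qc, 2), (1, qw * qa, 14), (-2, qw * qw, 4), (3,
        qw * qe, 1), (2, qw * qe, 0), (-6, qw * qc, 0), (-1, qw * qe, 14), (2, qw * qc, 11),
        (10, qw * qa, 2), (2, qw * qw, 6), (-1, qw * qa, 1)]"],
      simp, simp only: certificate_simps, Groebner_Basis.algebra)
qed

lemma reducible_odd_times_generator2:
  "reducible 4 (qw * (qc * (qc * qe)))"
  "reducible 4 (qw * (qc * (qe * qe)))"
proof -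
  note [simp] = reducible_times_qb q_homogeneous homogeneous_certificate reducible_low
    reducible_quadratic reducible_even_odd_odd reducible_odd_times_generator1
  note [simp del] = One_nat_def
  show "reducible 4 (qw * (qc * (qc * qe)))"
    by (rule reducible_by_certificate[where d = 2 and D = 6 and
      ns = "[(-2, qb * (qw * (qa * qa))), (1, qb * (qw * (qa * qc))), (4, qb * (qw * (qa *
        qe))), (3, qb * (qw * (qc * qc))), (-11, qb * (qw * (qc * qe))), (2, qb * (qw * (qe
        * qe))), (2, qb * (qb * (qw * qc))), (-2, qb * (qb * (qw * qe))), (5, qw * (qa * (qc
        * qe)))]" and
      rs = "[(-1, qw * qc, 0), (4, qw * qe, 0), (-2, qw * qa, 1), (6, qw * qe, 1), (2, qw *
        qa, 2)]"],
      simp, simp only: certificate_simps, Groebner_Basis.algebra)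
  show "reducible 4 (qw * (qc * (qe * qe)))"
    by (rule reducible_by_certificate[where d = 2 and D = 2 and
      ns = "[(4, qb * (qw * (qa * qa))), (-9, qb * (qw * (qa * qc))), (-2, qb * (qw * (qa *
        qe))), (5, qb * (qw * (qc * qc))), (2, qb * (qw * (qc * qe))), (-2, qb * (qb * (qw *
        qa))), (2, qb * (qb * (qw * qc))), (1, qb * (qb * (qw * qe))), (3, qw * (qa * (qc *
        qe)))]" and
      rs = "[(1, qw * qc, 0), (-1, qw * qe, 0), (-1, qw * qe, 1), (-2, qw * qa, 2), (4, qw *
        qc, 2)]"],
      simp, simp only: certificate_simps, Groebner_Basis.algebra)
qed

lemma reducible_quartic1:
  "reducible 4 (qa * (qa * (qc * qe)))"
proof -
  note [simp] = reducible_times_qb q_homogeneous homogeneous_certificate reducible_low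
    reducible_quadratic reducible_ace reducible_odd_cubic
  note [simp del] = One_nat_def
  show "reducible 4 (qa * (qa * (qc * qe)))"
    by (rule reducible_by_certificate[where d = 2 and D = 8 and
      ns = "[(8, qb * (qa * (qa * qc))), (-16, qb * (qa * (qa * qe))), (-8, qb * (qa * (qc *
        qc))), (16, qb * (qa * (qc * qe))), (8, qb * (qb * (qa * qe)))]" and
      rs = "[(-2, qa * qc, 13), (-10, qa * qc, 2), (1, qa * qa, 14), (-2, qw * qa, 4), (3,
        qa * qe, 1), (2, qa * qe, 0), (-6, qa * qc, 0), (-1, qa * qe, 14), (2, qa * qc, 11),
        (10, qa * qa, 2), (2, qw * qa, 6), (-1, qa * qa, 1)]"],
      simp, simp only: certificate_simps, Groebner_Basis.algebra)
qed

lemma reducible_quartic2: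
  "reducible 4 (qa * (qc * (qc * qe)))"
  "reducible 4 (qa * (qc * (qe * qe)))"
proof -
  note [simp] = reducible_times_qb q_homogeneous homogeneous_certificate reducible_low
    reducible_quadratic reducible_ace reducible_odd_cubic reducible_quartic1
  note [simp del] = One_nat_def
  show "reducible 4 (qa * (qc * (qc * qe)))"
    by (rule reducible_by_certificate[where d = 2 and D = 6 and
      ns = "[(-2, qb * (qa * (qa * qa))), (1, qb * (qa * (qa * qc))), (4, qb * (qa * (qa *
        qe))), (3, qb * (qa * (qc * qc))), (-11, qb * (qa * (qc * qe))), (2, qb * (qa * (qe
        * qe))), (2, qb * (qb * (qa * qc))), (-2, qb * (qb * (qa * qe))), (5, qa * (qa * (qc
        * qe)))]" and
      rs = "[(-1, qa * qc, 0), (4, qa * qe, 0), (-2, qa * qa, 1), (6, qa * qe, 1), (2, qa *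
        qa, 2)]"],
      simp, simp only: certificate_simps, Groebner_Basis.algebra)
  show "reducible 4 (qa * (qc * (qe * qe)))"
    by (rule reducible_by_certificate[where d = 2 and D = 2 and
      ns = "[(4, qb * (qa * (qa * qa))), (-9, qb * (qa * (qa * qc))), (-2, qb * (qa * (qa *
        qe))), (5, qb * (qa * (qc * qc))), (2, qb * (qa * (qc * qe))), (-2, qb * (qb * (qa *
        qa))), (2, qb * (qb * (qa * qc))), (1, qb * (qb * (qa * qe))), (3, qa * (qa * (qc *
        qe)))]" and
      rs = "[(1, qa * qc, 0), (-1, qa * qe, 0), (-1, qa * qe, 1), (-2, qa * qa, 2), (4, qa *
        qc, 2)]"],
      simp, simp only: certificate_simps, Groebner_Basis.algebra)
qed

lemma reducible_quartic3:
  "reducible 4 (qc * (qc * (qe * qe)))"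
proof -
  note [simp] = reducible_times_qb q_homogeneous homogeneous_certificate reducible_low
    reducible_quadratic reducible_ace reducible_odd_cubic reducible_quartic2
  note [simp del] = One_nat_def
  show "reducible 4 (qc * (qc * (qe * qe)))"
    by (rule reducible_by_certificate[where d = 2 and D = 2 and
      ns = "[(4, qb * (qa * (qa * qc))), (-9, qb * (qa * (qc * qc))), (-2, qb * (qa * (qc *
        qe))), (5, qb * (qc * (qc * qc))), (2, qb * (qc * (qc * qe))), (-2, qb * (qb * (qa *
        qc))), (2, qb * (qb * (qc * qc))), (1, qb * (qb * (qc * qe))), (3, qa * (qc * (qc *
        qe)))]" and
      rs = "[(1, qc * qc, 0), (-1, qc * qe, 0), (-1, qc * qe, 1), (-2, qa * qc, 2), (4, qc *
        qc, 2)]"],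
      simp, simp only: certificate_simps, Groebner_Basis.algebra)
qed

lemma reducible_even_times_generator:
  "reducible 4 (qu * (qw * (qc * qe)))"
  "reducible 4 (qv * (qw * (qc * qe)))"
  "reducible 4 (qw * (qw * (qc * qe)))"
proof -
  note [simp] = reducible_times_qb q_homogeneous homogeneous_certificate reducible_low
    reducible_quadratic reducible_ace reducible_odd_cubic reducible_quartic2 reducible_quartic3
  note [simp del] = One_nat_def
  show "reducible 4 (qu * (qw * (qc * qe)))"
    by (rule reducible_by_certificate[where d = 2 and D = 1 and
      ns = "[(5, qa * (qc * (qc * qe))), (2, qa * (qc * (qe * qe))), (-6, qc * (qc * (qe *
        qe))), (-3, qb * (qa * (qc * qe))), (1, qb * (qc * (qc * qe))), (3, qb * (qc * (qe *
        qe)))]" and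
      rs = "[(1, qc * qe, 11)]"],
      simp, simp only: certificate_simps, Groebner_Basis.algebra)
  show "reducible 4 (qv * (qw * (qc * qe)))"
    by (rule reducible_by_certificate[where d = 2 and D = 1 and
      ns = "[(-1, qa * (qc * (qc * qe))), (-1, qa * (qc * (qe * qe))), (4, qc * (qc * (qe *
        qe))), (-4, qb * (qa * (qc * qe))), (4, qb * (qc * (qc * qe))), (3, qb * (qc * (qe *
        qe))), (1, qb * (qb * (qc * qe)))]" and
      rs = "[(1, qc * qe, 13)]"],
      simp, simp only: certificate_simps, Groebner_Basis.algebra)
  show "reducible 4 (qw * (qw * (qc * qe)))"
    by (rule reducible_by_certificate[where d = 2 and D = 2 and
      ns = "[(-2, qa * (qc * (qc * qe))), (-9, qa * (qc * (qe * qe))), (10, qc * (qc * (qe *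
        qe))), (19, qb * (qa * (qc * qe))), (-16, qb * (qc * (qc * qe))), (1, qb * (qc * (qe
        * qe))), (-9, qb * (qb * (qc * qe)))]" and
      rs = "[(1, qc * qe, 14)]"],
      simp, simp only: certificate_simps, Groebner_Basis.algebra)
qed

lemmas reducible_products = reducible_quadratic reducible_ace reducible_odd_cubic
  reducible_even_odd_odd reducible_even_even_odd
  reducible_odd_times_generator1 reducible_odd_times_generator2 reducible_even_times_generator

lemma reducible_times_standard_basis:
  assumes "v \<in> {qu, qv, qw, qa, qc, qe}" "(k, f) \<in> set standard_basis"
  shows "reducible (Suc k) (v * f)"
proof -
  have *: "reducible 1 (v * 1)" if "v \<in> {qu, qv, qw, qa, qc, qe}" for v
    using that reducible_low by auto
  note facts = reducible_low reducible_products
  show ?thesis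
    using assms
    unfolding standard_basis_def list.set insert_iff empty_iff prod.inject
    by (elim disjE conjE FalseE; hypsubst; use facts in \<open>simp add: mult_ac eval_nat_numeral\<close>)
qed

lemma standard_basis_homogeneous: "(k, f) \<in> set standard_basis \<Longrightarrow> homogeneous k f"
proof -
  have "homogeneous 3 (qw * (qc * qe))"
    using homogeneous_Suc_mult[OF q_homogeneous(3) homogeneous_product[OF q_homogeneous(7,8)]]
    by (simp add: eval_nat_numeral)
  then show "(k, f) \<in> set standard_basis \<Longrightarrow> homogeneous k f"
    by (auto simp: standard_basis_def intro!: homogeneous_product q_homogeneous
        q_homogeneous[unfolded One_nat_def] homogeneous_1)
qed

lemma homogeneous_power: "homogeneous 1 f \<Longrightarrow> homogeneous n (f ^ n)"
  by (induction n) (auto intro: homogeneous_1 homogeneous_Suc_mult)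

lemma reducible_qb_power: "reducible d f \<Longrightarrow> reducible (n + d) (qb ^ n * f)"
  by (induction n) (auto dest: reducible_qb simp: mult.assoc)

lemma reducible_times:
  assumes "v \<in> {qu, qv, qw, qb, qa, qc, qe, ql}" and f: "reducible d f"
  shows "reducible (Suc d) (v * f)"
proof -
  have v: "homogeneous 1 v" using assms(1) q_homogeneous by auto
  show ?thesis
    using f
  proof (induction rule: reducible.induct)
    case (basis k f n)
    consider "v = qb" | "v = ql" | "v \<in> {qu, qv, qw, qa, qc, qe}" using assms(1) by auto
    then show ?case
    proof cases
      case 1
      then show ?thesis using reducible_qb[OF reducible.basis[OF basis]] by simp
    next
      case 2
      then show ?thesis
        using reducible.line[OF homogeneous_mult[OF homogeneous_power[OF q_homogeneous(5)]
              standard_basis_homogeneous[OF basis]]] by simp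
    next
      case 3
      from reducible_qb_power[OF reducible_times_standard_basis[OF 3 basis], of n] show ?thesis
        by (simp add: mult.left_commute)
    qed
  next
    case (line d g)
    from reducible.line[OF homogeneous_Suc_mult[OF v line]] show ?case
      by (simp add: mult.left_commute)
  next
    case (scale d f c)
    from reducible.scale[OF scale.IH, of c] show ?case by (simp add: mult.left_commute)
  qed (auto simp: distrib_left intro: reducible.intros ideal_C_closed)
qed

lemma reducible_uminus: "reducible d f \<Longrightarrow> reducible d (- f)"
  using reducible_of_int_mult[of d f "-1"] by simp

lemma reducible_diff: "reducible d f \<Longrightarrow> reducible d g \<Longrightarrow> reducible d (f - g)"
  using reducible.add[of d f "- g"] by (simp add: reducible_uminus)

lemma reducible_numeral_mult: "reducible d f \<Longrightarrow> reducible d (numeral n * f)"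
  using reducible_of_int_mult[of d f "numeral n"] by simp

lemma homogeneous_imp_reducible:
  assumes "homogeneous d f"
  shows "reducible d f"
  using assms
proof (induction rule: homogeneous_induct)
  case (const c)
  show ?case using reducible.scale[OF reducible_low(1), of c] by simp
next
  case (add d f g)
  then show ?case by (intro reducible.add)
next
  case (var d i f)
  note times = reducible_times[OF _ var.IH]
  have t: "reducible (Suc d) (qu * f)" "reducible (Suc d) (qv * f)" "reducible (Suc d) (qw * f)"
    "reducible (Suc d) (ql * f)"
    "reducible (Suc d) (qb * f)" "reducible (Suc d) (qa * f)" "reducible (Suc d) (qc * f)"
      "reducible (Suc d) (qe * f)"
    by (simp_all add: times)
  have "\<forall>j \<in> {1, 2, 3, 4, 5, 6, 7, 8}. reducible (Suc d) (of_eigenforms qu qv qw ql qb qa qc qe j * f)"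
    unfolding ball_simps of_eigenforms_nth left_diff_distrib distrib_right mult_minus_left mult.assoc
    by (intro conjI TrueI reducible.add reducible_diff reducible_uminus reducible_numeral_mult t)
  then have "reducible (Suc d) (26 * (var i * f))"
    using exhaust_8[of i] var_eq_of_eigenforms[of i] by (simp only: mult.assoc[symmetric])
  from reducible.scale[OF this, of "1 / 26"] show ?case
    by (simp add: const_mult const_1 flip: const_numeral mult.assoc)
qed

lemma length_standard_basis: "length standard_basis = 14"
  by (simp add: standard_basis_def)

text \<open>
  Only one rational coefficient per basis element occurs, as the exponent of \<open>b\<close> is fixed by the degree.
  If the degree \<open>d\<close> is too small for a basis element, the truncated exponent is meaningless and the
  coefficient has to be zero, which \<open>bounded_coeffs\<close> records.
\<close>

definition normal_form :: "nat \<Rightarrow> (nat \<Rightarrow> rat) \<Rightarrow> 8 qpoly" where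
  "normal_form d k = (\<Sum>j<14. const (k j) * (qb ^ (d - fst (standard_basis ! j)) * snd
    (standard_basis ! j)))"

definition bounded_coeffs :: "nat \<Rightarrow> (nat \<Rightarrow> rat) \<Rightarrow> bool" where
  "bounded_coeffs d k \<longleftrightarrow> (\<forall>j<14. d < fst (standard_basis ! j) \<longrightarrow> k j = 0)"

definition lower_form :: "nat \<Rightarrow> 8 qpoly \<Rightarrow> bool" where
  "lower_form d g \<longleftrightarrow> g = 0 \<or> (\<exists>d'. d = Suc d' \<and> homogeneous d' g)"

lemma const_add: "const (a + b) = const a + const b"
  by (simp add: const_def single_add)

lemma reducible_imp_normal_form:
  assumes "reducible d f"
  shows "\<exists>k g. bounded_coeffs d k \<and> lower_form d g \<and> f - normal_form d k - ql * g \<in> ideal_C"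
  using assms
proof (induction rule: reducible.induct)
  case (basis k f n)
  then obtain j where j: "j < 14" "standard_basis ! j = (k, f)"
    by (metis in_set_conv_nth length_standard_basis)
  define c where "c i = (if i = j then 1 else 0 :: rat)" for i
  have "normal_form (n + k) c = (\<Sum>i<14. if i = j then qb ^ n * f else 0)"
    unfolding normal_form_def c_def
    by (rule sum.cong) (auto simp: j const_1 const_def)
  then have "normal_form (n + k) c = qb ^ n * f" using j(1) by simp
  moreover have "bounded_coeffs (n + k) c" using j by (simp add: bounded_coeffs_def c_def)
  ultimately show ?case
    by (intro exI[of _ c] exI[of _ 0]) (simp add: lower_form_def ideal_C_closed)
next
  case (add d f f')
  then obtain k g k' g' where *: "bounded_coeffs d k" "lower_form d g" "f - normal_form d k - ql * g
    \<in> ideal_C"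
    "bounded_coeffs d k'" "lower_form d g'" "f' - normal_form d k' - ql * g' \<in> ideal_C" by blast
  have "normal_form d (\<lambda>j. k j + k' j) = normal_form d k + normal_form d k'"
    by (simp add: normal_form_def const_add distrib_right sum.distrib)
  with ideal_C_closed(2)[OF *(3,6)]
  have "f + f' - normal_form d (\<lambda>j. k j + k' j) - ql * (g + g') \<in> ideal_C"
    by (simp add: algebra_simps)
  moreover have "bounded_coeffs d (\<lambda>j. k j + k' j)" using * by (simp add: bounded_coeffs_def)
  moreover have "lower_form d (g + g')" using *(2,5) by (auto simp: lower_form_def intro:
    homogeneous_add)
  ultimately show ?case by blast
next
  case (scale d f c)
  then obtain k g where *: "bounded_coeffs d k" "lower_form d g" "f - normal_form d k - ql * g \<in>
    ideal_C" by blast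
  have "normal_form d (\<lambda>j. c * k j) = const c * normal_form d k"
    by (simp add: normal_form_def sum_distrib_left mult.assoc flip: const_mult)
  with ideal_C_closed(3)[OF *(3), of "const c"]
  have "const c * f - normal_form d (\<lambda>j. c * k j) - ql * (const c * g) \<in> ideal_C"
    by (simp add: algebra_simps)
  moreover have "bounded_coeffs d (\<lambda>j. c * k j)" using * by (simp add: bounded_coeffs_def)
  moreover have "lower_form d (const c * g)" using *(2) by (auto simp: lower_form_def intro:
    homogeneous_const_mult)
  ultimately show ?case by blast
next
  case (ideal f d)
  have "normal_form d (\<lambda>j. 0) = 0" by (simp add: normal_form_def const_def)
  with ideal show ?case
    by (intro exI[of _ "\<lambda>j. 0"] exI[of _ 0]) (simp add: lower_form_def bounded_coeffs_def)
next
  case (line d g)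
  have "normal_form (Suc d) (\<lambda>j. 0) = 0" by (simp add: normal_form_def const_def)
  with line show ?case
    by (intro exI[of _ "\<lambda>j. 0"] exI[of _ g]) (simp add: lower_form_def bounded_coeffs_def
      ideal_C_closed)
qed

section \<open>Points of the curve\<close>

definition section_point :: "'a::idom \<Rightarrow> 'a \<Rightarrow> 'a \<Rightarrow> 8 \<Rightarrow> 'a" where
  "section_point x y t = of_eigenforms (x * t) (y * t) t (sec_l x y) (sec_b x y) (sec_a x y) (sec_c
    x y) (sec_e x y)"

lemma forms_of_eigenforms:
  fixes u :: "'a::idom"
  shows "form_X (of_eigenforms u v w l b a c e) = 26 * u" "form_Y (of_eigenforms u v w l b a c e) =
    26 * v"
    "form_Z (of_eigenforms u v w l b a c e) = 26 * w" "odd_l (of_eigenforms u v w l b a c e) = 26 * l"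
    "odd_b (of_eigenforms u v w l b a c e) = 26 * b" "odd_a (of_eigenforms u v w l b a c e) = 26 * a"
    "odd_c (of_eigenforms u v w l b a c e) = 26 * c" "odd_e (of_eigenforms u v w l b a c e) = 26 * e"
  unfolding form_defs of_eigenforms_nth by Groebner_Basis.algebra+

lemma qeval_q: "qeval v qu = form_X v" "qeval v qv = form_Y v" "qeval v qw = form_Z v" "qeval v ql =
  odd_l v"
  "qeval v qb = odd_b v" "qeval v qa = odd_a v" "qeval v qc = odd_c v" "qeval v qe = odd_e v"
  unfolding q_defs form_defs by (simp_all add: qeval_simps)

lemma qeval_quadrics: "map (qeval v) (quadrics var) = quadrics v"
  by (simp add: quadrics_def qeval_simps)

definition on_cover :: "'a::comm_ring_1 \<Rightarrow> 'a \<Rightarrow> 'a \<Rightarrow> bool" where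
  "on_cover x y t \<longleftrightarrow> p_ns x y 1 = 0 \<and> t ^ 2 = K_ns x y"

lemma combination_zero: "(\<And>r. r \<in> set xs \<Longrightarrow> r = 0) \<Longrightarrow> combination cs xs = 0"
  unfolding combination_def by (induction cs xs rule: list_induct2') auto

lemma quadrics_section_point:
  fixes x y t :: "'a::{idom, ring_char_0}"
  assumes "on_cover x y t"
  shows "q \<in> set (quadrics (section_point x y t)) \<Longrightarrow> q = 0"
proof -
  let ?r = "relations (x * t) (y * t) t (sec_l x y) (sec_b x y) (sec_a x y) (sec_c x y) (sec_e x y)"
  have "r = 0" if "r \<in> set ?r" for r
    using that assms unfolding relations_parametrised on_cover_def by (auto simp: set_zip)
  then have "combination cs ?r = 0" for cs
    by (intro combination_zero) auto
  then have "r = 0" if "r \<in> set (map ((*) 2) (quadrics (section_point x y t)))" for r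
    using that unfolding section_point_def quadrics_of_eigenforms by auto
  then show "q \<in> set (quadrics (section_point x y t)) \<Longrightarrow> q = 0"
    by fastforce
qed

lemma ideal_C_vanishes:
  assumes "on_cover x y t" "f \<in> ideal_C"
  shows "qeval (section_point x y t) f = 0"
proof (rule Idl_subset_kernel)
  show "f \<in> Idl\<^bsub>qpoly_ring\<^esub> (set (quadrics var))"
    using assms(2) by (simp add: ideal_C_def canonical_quadrics_eq)
  fix q :: "8 qpoly" assume "q \<in> set (quadrics var)"
  then have "qeval (section_point x y t) q \<in> set (map (qeval (section_point x y t)) (quadrics var))"
    by simp
  then show "qeval (section_point x y t) q = 0"
    unfolding qeval_quadrics by (rule quadrics_section_point[OF assms(1)])
qed

lemma qeval_section_point:
  "qeval (coords3 x y t) (section_point (var 1) (var 2) (var 3) i) = section_point x y t i"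
proof -
  have "\<forall>i \<in> {1, 2, 3, 4, 5, 6, 7, 8}.
    qeval (coords3 x y t) (section_point (var 1) (var 2) (var 3) i) = section_point x y t i"
    unfolding ball_simps section_point_def of_eigenforms_nth sec_a_def sec_b_def sec_c_def sec_e_def
      sec_l_def
    by (simp only: qeval_simps coords3_simps simp_thms)
  then show ?thesis using exhaust_8[of i] by blast
qed

text \<open>
  Pulling a form back along the parametrisation gives a polynomial in \<open>x, y, t\<close>, to which the
  description of the kernel at the generic point applies.
\<close>

lemma substitution:
  "\<exists>h. \<forall>x y t :: 'a::field_char_0. qeval (coords3 x y t) h = qeval (section_point x y t) f"
proof (induction f rule: qpoly_induct)
  case (const c)
  show ?case by (rule exI[of _ "const c"]) (simp add: qeval_const)
next
  case (add f g)
  then obtain h h' where "\<forall>x y t :: 'a. qeval (coords3 x y t) h = qeval (section_point x y t) f"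
    "\<forall>x y t :: 'a. qeval (coords3 x y t) h' = qeval (section_point x y t) g" by blast
  then show ?case by (intro exI[of _ "h + h'"]) (simp add: qeval_add)
next
  case (mult i f)
  then obtain h where "\<forall>x y t :: 'a. qeval (coords3 x y t) h = qeval (section_point x y t) f" by blast
  then show ?case
    by (intro exI[of _ "section_point (var 1) (var 2) (var 3) i * h"])
      (simp add: qeval_mult qeval_var qeval_section_point)
qed

definition K_poly :: "rat poly poly" where
  "K_poly = [: [:0, -60, 120, -64, -11:], [:20, -92, 134, -60:], [:1, -24, 60:], [:-20:], [:-8:] :]"

lemma biv_eval_K_poly: "rat_embedding e \<Longrightarrow> biv_eval e K_poly x y = K_ns x y"
  by (simp add: K_poly_def K_ns_def biv_eval_simps algebra_simps power2_eq_square power3_eq_cube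
    power4_eq_xxxx)

context generic_point
begin

definition T :: complex where "T = \<i> * of_real (sqrt (- K_ns x y))"

definition xi :: complex where "xi = of_real x"
definition eta :: complex where "eta = of_real y"

definition U :: "8 \<Rightarrow> complex" where "U = section_point xi eta T"

lemma of_real_p_K: "p_ns (complex_of_real x) (of_real y) 1 = of_real (p_ns x y 1)"
  "K_ns (complex_of_real x) (of_real y) = of_real (K_ns x y)"
  by (simp_all add: p_ns_def K_ns_def)

lemma T_nonzero: "T \<noteq> 0"
  using K by (simp add: T_def)

lemma on_cover_generic: "on_cover xi eta T"
proof -
  have "T ^ 2 = - of_real (sqrt (- K_ns x y) ^ 2)"
    by (simp add: T_def power_mult_distrib)
  also have "sqrt (- K_ns x y) ^ 2 = - K_ns x y"
    using K by simp
  finally have "T ^ 2 = of_real (K_ns x y)" by simp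
  then show ?thesis using p by (simp add: on_cover_def xi_def eta_def of_real_p_K)
qed

text \<open>
  A relation that holds at the generic point is a consequence of \<open>p = 0\<close> and \<open>t\<^sup>2 = K\<close>, and so it
  specialises to every complex point.
\<close>

lemma generic_vanishing:
  assumes f: "qeval U f = 0" and P: "on_cover x' y' t'"
  shows "qeval (section_point x' y' t') f = (0 :: complex)"
proof -
  obtain h where h: "\<forall>x y t :: complex. qeval (coords3 x y t) h = qeval (section_point x y t) f"
    using substitution by blast
  have "h \<in> double_cover K_poly"
  proof (subst double_cover_kernel)
    show "sqrt (- K_ns x y) \<noteq> 0" using K by simp
    show "- (sqrt (- K_ns x y) ^ 2) = biv_eval of_rat K_poly x y"
      using K by (simp add: biv_eval_K_poly rat_embedding_of_rat)
    show "qeval (coords3 (complex_of_real x) (complex_of_real y) (\<i> * of_real (sqrt (- K_ns x y))))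
      h = 0"
      using f h by (simp add: U_def xi_def eta_def T_def)
  qed
  then have "qeval (coords3 x' y' t') h = 0"
    unfolding double_cover_def
    by (rule Idl_subset_kernel[rotated])
      (use P in \<open>auto simp: on_cover_def qeval_p_ns qeval_simps qeval_biv_eval coords3_simps
        biv_eval_K_poly rat_embedding_of_rat\<close>)
  then show ?thesis using h by simp
qed

end

section \<open>Independence of the normal forms\<close>

text \<open>
  Each point of the quartic carries two points of the curve, for \<open>t\<close> and \<open>- t\<close>. The sum and the
  difference of the two equations separate the even from the odd basis elements.
\<close>

lemma section_point_equations:
  fixes x y t A C E :: complex
  assumes b: "sec_b x y \<noteq> 0" and l: "sec_l x y = 0" and t: "t \<noteq> 0"
    and A: "sec_a x y = A * sec_b x y" and C: "sec_c x y = C * sec_b x y" and E: "sec_e x y = E *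
      sec_b x y"
    and k: "bounded_coeffs d k"
    and f: "\<And>t'. t' \<in> {t, - t} \<Longrightarrow> qeval (section_point x y t') (normal_form d k) = 0"
  shows "of_rat (k 0) + of_rat (k 1) * A + of_rat (k 2) * C + of_rat (k 3) * E + of_rat (k 4) * (A * C)
      + of_rat (k 5) * (A * E) + of_rat (k 6) * (C * E) = 0"
    and "of_rat (k 7) * x + of_rat (k 8) * y + of_rat (k 9) + of_rat (k 10) * (x * E) + of_rat (k
      11) * A
      + of_rat (k 12) * E + of_rat (k 13) * (C * E) = 0"
proof -
  define b where "b = sec_b x y"
  have "b \<noteq> 0" using assms(1) by (simp add: b_def)
  define p q where
    "p = of_rat (k 0) + of_rat (k 1) * A + of_rat (k 2) * C + of_rat (k 3) * E + of_rat (k 4) * (A * C)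
      + of_rat (k 5) * (A * E) + of_rat (k 6) * (C * E)" and
    "q = of_rat (k 7) * x + of_rat (k 8) * y + of_rat (k 9) + of_rat (k 10) * (x * E) + of_rat (k
      11) * A
      + of_rat (k 12) * E + of_rat (k 13) * (C * E)"
  have *: "p + t' / b * q = 0" if "t' \<in> {t, - t}" for t'
  proof -
    let ?P = "section_point x y t'"
    have vals: "qeval ?P qb = 26 * b" "qeval ?P qa = A * (26 * b)" "qeval ?P qc = C * (26 * b)"
      "qeval ?P qe = E * (26 * b)" "qeval ?P qu = x * (t' / b) * (26 * b)"
      "qeval ?P qv = y * (t' / b) * (26 * b)" "qeval ?P qw = t' / b * (26 * b)"
      using \<open>b \<noteq> 0\<close> by (simp_all add: qeval_q section_point_def forms_of_eigenforms A C E b_def)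
    have "0 = qeval ?P (normal_form d k)" using f[OF that] by simp
    also have "\<dots> = (\<Sum>j<14. (26 * b) ^ d * (of_rat (k j) *
        (qeval ?P (snd (standard_basis ! j)) / (26 * b) ^ fst (standard_basis ! j))))"
      unfolding normal_form_def qeval_sum
    proof (rule sum.cong)
      fix j assume "j \<in> {..<14 :: nat}"
      then have "k j = 0 \<or> fst (standard_basis ! j) \<le> d"
        using k by (auto simp: bounded_coeffs_def not_less)
      then show "qeval ?P (const (k j) * (qb ^ (d - fst (standard_basis ! j)) * snd (standard_basis
        ! j))) =
          (26 * b) ^ d * (of_rat (k j) * (qeval ?P (snd (standard_basis ! j)) / (26 * b) ^ fst
            (standard_basis ! j)))"
        using \<open>b \<noteq> 0\<close> by (auto simp: qeval_simps vals power_diff)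
    qed simp
    also have "\<dots> = (26 * b) ^ d * (\<Sum>j<14. of_rat (k j) *
        (qeval ?P (snd (standard_basis ! j)) / (26 * b) ^ fst (standard_basis ! j)))"
      by (simp only: sum_distrib_left)
    finally have "(\<Sum>j<14. of_rat (k j) *
        (qeval ?P (snd (standard_basis ! j)) / (26 * b) ^ fst (standard_basis ! j))) = 0"
      using \<open>b \<noteq> 0\<close> by simp
    moreover have "(\<Sum>j<14. of_rat (k j) *
        (qeval ?P (snd (standard_basis ! j)) / (26 * b) ^ fst (standard_basis ! j))) = p + t' / b * q"
    proof -
      define h where "h = 26 * b"
      have "h \<noteq> 0" using \<open>b \<noteq> 0\<close> by (simp add: h_def)
      have set14: "{..<14 :: nat} = {0, 1, 2, 3, 4, 5, 6, 7, 8, 9, 10, 11, 12, 13}"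
        unfolding set_eq_iff lessThan_iff insert_iff empty_iff by presburger
      define \<tau> where "\<tau> = t' / b"
      show ?thesis
        using \<open>h \<noteq> 0\<close>
        unfolding set14 standard_basis_def p_def q_def \<tau>_def[symmetric]
        by (simp add: qeval_simps vals \<tau>_def[symmetric] h_def[symmetric] power2_eq_square
          power3_eq_cube)
          (simp add: field_simps)
    qed
    ultimately show ?thesis by simp
  qed
  have "p + t / b * q = 0" "p - t / b * q = 0"
    using *[of t] *[of "- t"] by simp_all
  then have "p + p = 0" "t / b * q = 0" by (simp_all add: algebra_simps)
  then show "p = 0" "q = 0" using t \<open>b \<noteq> 0\<close> by simp_all
qed

lemma no_rational_root:
  fixes r :: rat
  shows "4 * r ^ 3 - 2 * r + 1 \<noteq> 0"
proof
  assume r: "4 * r ^ 3 - 2 * r + 1 = 0"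
  obtain m n :: int where mn: "r = of_int m / of_int n" "n > 0" "coprime m n"
    by (metis Rat_cases Fract_of_int_quotient)
  have "of_int (4 * m ^ 3 - 2 * m * n ^ 2 + n ^ 3) = of_int n ^ 3 * (4 * r ^ 3 - 2 * r + 1)"
    using mn(2) unfolding mn(1) by (simp add: field_simps power2_eq_square power3_eq_cube)
  then have "(of_int (4 * m ^ 3 - 2 * m * n ^ 2 + n ^ 3) :: rat) = 0"
    unfolding r by simp
  then have eq: "4 * m ^ 3 - 2 * m * n ^ 2 + n ^ 3 = 0"
    by (simp only: of_int_eq_0_iff)
  then have "n ^ 3 = 2 * (m * n ^ 2 - 2 * m ^ 3)" by (simp add: algebra_simps)
  then have "even (n ^ 3)" by simp
  then obtain j where j: "n = 2 * j" by auto
  have "m ^ 3 = 2 * (m * j ^ 2 - j ^ 3)"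
    using eq unfolding j by (simp add: power2_eq_square power3_eq_cube)
  then have "even (m ^ 3)" by simp
  with j mn(3) show False by auto
qed

text \<open>
  The cubic has no rational root, so \<open>z\<close> has degree 3 over \<open>\<rat>\<close>. In the proof, a relation of
  degree 2 would turn into the root \<open>- q\<close> of the same cubic.
\<close>

lemma cubic_independence:
  fixes z :: complex and a b c :: rat
  assumes z: "4 * z ^ 3 - 2 * z + 1 = 0" and rel: "of_rat a + of_rat b * z + of_rat c * z ^ 2 = 0"
  shows "a = 0 \<and> b = 0 \<and> c = 0"
proof -
  have irrational: "z \<noteq> of_rat r" for r
  proof
    assume "z = of_rat r"
    then have "of_rat (4 * r ^ 3 - 2 * r + 1) = (0 :: complex)"
      using z by (simp add: of_rat_add of_rat_diff of_rat_power of_rat_mult)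
    then show False using no_rational_root[of r] by simp
  qed
  have linear: "a = 0 \<and> b = 0" if "of_rat a + of_rat b * z = 0" for a b :: rat
  proof (cases "b = 0")
    case False
    have "z = - of_rat a / of_rat b"
      using that False by (simp add: field_simps add_eq_0_iff)
    then have "z = of_rat (- a / b)" by (simp add: of_rat_divide of_rat_minus)
    then show ?thesis using irrational by blast
  qed (use that in simp)
  show ?thesis
  proof (cases "c = 0")
    case True
    then show ?thesis using linear[of a b] rel by simp
  next
    case False
    define p q where "p = - a / c" and "q = - b / c"
    have z2: "z ^ 2 = of_rat p + of_rat q * z"
      using rel False by (simp add: p_def q_def of_rat_divide of_rat_minus field_simps
        eq_neg_iff_add_eq_0)
    have "of_rat (4 * p * q + 1) + of_rat (4 * p + 4 * q ^ 2 - 2) * z =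
        4 * z * (of_rat p + of_rat q * z) - 2 * z + 1 - 4 * of_rat q * (z ^ 2 - (of_rat p + of_rat q
          * z))"
      by (simp add: of_rat_add of_rat_diff of_rat_power of_rat_mult algebra_simps power2_eq_square)
    also have "\<dots> = 4 * z ^ 3 - 2 * z + 1"
      unfolding z2[symmetric] by (simp add: power2_eq_square power3_eq_cube)
    also note z
    finally have pq: "4 * p * q + 1 = 0" "4 * p + 4 * q ^ 2 - 2 = 0"
      using linear by blast+
    then have "4 * p = 2 - 4 * q ^ 2" by simp
    with pq(1) have "(2 - 4 * q ^ 2) * q + 1 = 0" by simp
    then have "4 * (- q) ^ 3 - 2 * (- q) + 1 = 0"
      by (simp add: algebra_simps power2_eq_square power3_eq_cube)
    then show ?thesis using no_rational_root by blast
  qed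
qed

lemma exists_cubic_root: "\<exists>z :: complex. 4 * z ^ 3 - 2 * z + 1 = 0"
proof -
  have "\<exists>z :: real. -1 \<le> z \<and> z \<le> 0 \<and> 4 * z ^ 3 - 2 * z + 1 = 0"
    by (rule IVT') (auto intro!: continuous_intros)
  then obtain z :: real where "4 * z ^ 3 - 2 * z + 1 = 0" by auto
  then have "complex_of_real (4 * z ^ 3 - 2 * z + 1) = 0" by simp
  then have "4 * complex_of_real z ^ 3 - 2 * of_real z + 1 = 0" by simp
  then show ?thesis by blast
qed

context generic_point
begin

text \<open>
  The seven points of the quartic on \<open>l = 0\<close> give seven rational equations for the even coefficients
  and seven for the odd ones; conjugate points are treated at once by comparing coefficients of powers
  of \<open>s\<close> and \<open>z\<close>.
\<close>

lemma normal_form_unique: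
  assumes k: "bounded_coeffs d k" "j < 14"
    and f: "\<And>x y t :: complex. on_cover x y t \<Longrightarrow> sec_l x y = 0 \<Longrightarrow> qeval (section_point x y t)
      (normal_form d k) = 0"
  shows "k j = 0"
proof -
  have eqs: "of_rat (k 0) + of_rat (k 1) * A + of_rat (k 2) * C + of_rat (k 3) * E + of_rat (k 4) *
    (A * C)
      + of_rat (k 5) * (A * E) + of_rat (k 6) * (C * E) = 0 \<and>
    of_rat (k 7) * x + of_rat (k 8) * y + of_rat (k 9) + of_rat (k 10) * (x * E) + of_rat (k 11) * A
      + of_rat (k 12) * E + of_rat (k 13) * (C * E) = 0"
    if p: "p_ns x y 1 = 0" and l: "sec_l x y = 0" and K: "K_ns x y \<noteq> 0" and b: "sec_b x y \<noteq> 0"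
      and AC: "sec_a x y = A * sec_b x y" "sec_c x y = C * sec_b x y" "sec_e x y = E * sec_b x y"
    for x y A C E :: complex
  proof -
    define t where "t = csqrt (K_ns x y)"
    have t: "t ^ 2 = K_ns x y" by (simp add: t_def)
    then have "t \<noteq> 0" using K by auto
    have "qeval (section_point x y t') (normal_form d k) = 0" if "t' \<in> {t, - t}" for t'
      using that t p l by (intro f) (auto simp: on_cover_def)
    from section_point_equations[OF b l \<open>t \<noteq> 0\<close> AC k(1) this] show ?thesis by blast
  qed
  note sec_defs = sec_a_def sec_b_def sec_c_def sec_e_def sec_l_def
  note rats = of_rat_add of_rat_diff of_rat_mult of_rat_divide of_rat_minus
  have P1: "k 0 - k 1 - k 2 + k 4 = 0" "k 9 - k 7 - k 11 = 0"
  proof -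
    note e = eqs[of "-1" 0 "-1" "-1" 0]
    have "of_rat (k 0 - k 1 - k 2 + k 4) = (0 :: complex)" "of_rat (k 9 - k 7 - k 11) = (0 :: complex)"
      using e by (simp_all add: p_ns_def sec_defs K_ns_def rats)
    then show "k 0 - k 1 - k 2 + k 4 = 0" "k 9 - k 7 - k 11 = 0" by (simp_all only: of_rat_eq_0_iff)
  qed
  have P2: "k 0 - k 1 - k 2 - 2 * k 3 + k 4 + 2 * k 5 + 2 * k 6 = 0"
    "k 7 + k 9 - 2 * k 10 - k 11 - 2 * k 12 + 2 * k 13 = 0"
  proof -
    note e = eqs[of 1 0 "-1" "-1" "-2"]
    have "of_rat (k 0 - k 1 - k 2 - 2 * k 3 + k 4 + 2 * k 5 + 2 * k 6) = (0 :: complex)"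
      "of_rat (k 7 + k 9 - 2 * k 10 - k 11 - 2 * k 12 + 2 * k 13) = (0 :: complex)"
      using e by (simp_all add: p_ns_def sec_defs K_ns_def rats mult.commute)
    then show "k 0 - k 1 - k 2 - 2 * k 3 + k 4 + 2 * k 5 + 2 * k 6 = 0"
      "k 7 + k 9 - 2 * k 10 - k 11 - 2 * k 12 + 2 * k 13 = 0" by (simp_all only: of_rat_eq_0_iff)
  qed
  have S: "of_rat (4 * k 0 - 2 * k 2 + 2 * k 4 + 2 * k 5 + 2 * k 6)
        + of_rat (k 4 + k 6 - 2 * k 1 - 2 * k 2 - 2 * k 3) * s = 0"
      "of_rat (4 * k 9 - 4 * k 10 + 2 * k 13) + of_rat (4 * k 7 + 4 * k 8 - 2 * k 11 - 2 * k 12 + k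
        13) * s = 0"
    if s: "s ^ 2 = 2" for s :: complex
  proof -
    have "(2 :: complex) ^ 2 \<noteq> 2" "(3 / 2 :: complex) ^ 2 \<noteq> 2" by (simp_all add: power_divide)
    with s have s': "s \<noteq> 2" "s \<noteq> 3 / 2" by metis+
    have "p_ns s s 1 = s * (s ^ 2 - 2)" "sec_l s s = 2 * s * (s ^ 2 - 2)"
      "K_ns s s = 12 * s - 18 + (26 * s - 19 * s ^ 2 - 9) * (s ^ 2 - 2)"
      "sec_b s s = 2 * s - 4 - 2 * (s ^ 2 - 2)" "2 * sec_a s s = - s * sec_b s s"
      "2 * sec_c s s = - (1 + s) * sec_b s s - 2 * s * (s ^ 2 - 2)"
      "2 * sec_e s s = - s * sec_b s s - 2 * s * (s ^ 2 - 2)"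
      unfolding p_ns_affine sec_defs K_ns_def by Groebner_Basis.algebra+
    then have vals: "p_ns s s 1 = 0" "sec_l s s = 0" "K_ns s s = 12 * (s - 3 / 2)" "sec_b s s = 2 *
      (s - 2)"
      and halves: "2 * sec_a s s = - s * sec_b s s" "2 * sec_c s s = - (1 + s) * sec_b s s"
        "2 * sec_e s s = - s * sec_b s s"
      by (simp_all add: s algebra_simps)
    have "K_ns s s \<noteq> 0" "sec_b s s \<noteq> 0"
      unfolding vals using s' by (simp_all add: mult.commute)
    moreover define A C where "A = - s / 2" and "C = - (1 + s) / 2"
    have AC: "2 * A = - s" "2 * C = - (1 + s)" by (simp_all add: A_def C_def)
    have "sec_a s s = A * sec_b s s" "sec_c s s = C * sec_b s s" "sec_e s s = A * sec_b s s"
      using halves unfolding A_def C_def by (simp_all add: field_simps)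
    ultimately have e: "of_rat (k 0) + of_rat (k 1) * A + of_rat (k 2) * C + of_rat (k 3) * A +
      of_rat (k 4) * (A * C)
        + of_rat (k 5) * (A * A) + of_rat (k 6) * (C * A) = 0"
      "of_rat (k 7) * s + of_rat (k 8) * s + of_rat (k 9) + of_rat (k 10) * (s * A) + of_rat (k 11) * A
        + of_rat (k 12) * A + of_rat (k 13) * (C * A) = 0"
      using eqs[OF vals(1,2)] by blast+
    have prods: "4 * (A * C) = s + 2" "4 * (C * A) = s + 2" "4 * (A * A) = 2" "2 * (s * A) = - 2"
    proof -
      have "4 * (A * C) = (2 * A) * (2 * C)" "4 * (A * A) = (2 * A) * (2 * A)" "2 * (s * A) = s * (2
        * A)"
        by simp_all
      then show "4 * (A * C) = s + 2" "4 * (C * A) = s + 2" "4 * (A * A) = 2" "2 * (s * A) = - 2"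
        unfolding AC using s by (simp_all add: algebra_simps power2_eq_square)
    qed
    have "of_rat (4 * k 0 - 2 * k 2 + 2 * k 4 + 2 * k 5 + 2 * k 6)
        + of_rat (k 4 + k 6 - 2 * k 1 - 2 * k 2 - 2 * k 3) * s =
      4 * of_rat (k 0) + 2 * of_rat (k 1) * (2 * A) + 2 * of_rat (k 2) * (2 * C) + 2 * of_rat (k 3)
        * (2 * A)
        + of_rat (k 4) * (4 * (A * C)) + of_rat (k 5) * (4 * (A * A)) + of_rat (k 6) * (4 * (C * A))"
      unfolding prods AC by (simp add: rats algebra_simps)
    also have "\<dots> = 4 * (of_rat (k 0) + of_rat (k 1) * A + of_rat (k 2) * C + of_rat (k 3) * A
        + of_rat (k 4) * (A * C) + of_rat (k 5) * (A * A) + of_rat (k 6) * (C * A))"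
      by (simp add: algebra_simps)
    finally show "of_rat (4 * k 0 - 2 * k 2 + 2 * k 4 + 2 * k 5 + 2 * k 6)
        + of_rat (k 4 + k 6 - 2 * k 1 - 2 * k 2 - 2 * k 3) * s = 0"
      unfolding e by simp
    have "of_rat (4 * k 9 - 4 * k 10 + 2 * k 13) + of_rat (4 * k 7 + 4 * k 8 - 2 * k 11 - 2 * k 12 +
      k 13) * s =
      4 * of_rat (k 7) * s + 4 * of_rat (k 8) * s + 4 * of_rat (k 9) + 2 * of_rat (k 10) * (2 * (s * A))
        + 2 * of_rat (k 11) * (2 * A) + 2 * of_rat (k 12) * (2 * A) + of_rat (k 13) * (4 * (C * A))"
      unfolding prods AC by (simp add: rats algebra_simps)
    also have "\<dots> = 4 * (of_rat (k 7) * s + of_rat (k 8) * s + of_rat (k 9) + of_rat (k 10) * (s * A)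
        + of_rat (k 11) * A + of_rat (k 12) * A + of_rat (k 13) * (C * A))"
      by (simp add: algebra_simps)
    finally show "of_rat (4 * k 9 - 4 * k 10 + 2 * k 13)
        + of_rat (4 * k 7 + 4 * k 8 - 2 * k 11 - 2 * k 12 + k 13) * s = 0"
      unfolding e by simp
  qed
  have P3: "4 * k 0 - 2 * k 2 + 2 * k 4 + 2 * k 5 + 2 * k 6 = 0"
    "k 4 + k 6 - 2 * k 1 - 2 * k 2 - 2 * k 3 = 0"
    "4 * k 9 - 4 * k 10 + 2 * k 13 = 0" "4 * k 7 + 4 * k 8 - 2 * k 11 - 2 * k 12 + k 13 = 0"
  proof -
    \<comment> \<open>Both square roots of 2 are used, so that the two coefficients can be separated.\<close>
    define s where "s = csqrt 2"
    have s: "s ^ 2 = 2" unfolding s_def by (rule power2_csqrt)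
    then have s': "(- s) ^ 2 = 2" "s \<noteq> 0" by auto
    have two: "a = 0 \<and> b = 0" if "of_rat a + of_rat b * s = 0" "of_rat a + of_rat b * (- s) = 0" for a b
    proof -
      have "2 * of_rat a = (of_rat a + of_rat b * s) + (of_rat a + of_rat b * (- s))" by simp
      then have "a = 0" unfolding that by simp
      then show ?thesis using that(1) s'(2) by simp
    qed
    show "4 * k 0 - 2 * k 2 + 2 * k 4 + 2 * k 5 + 2 * k 6 = 0"
      "k 4 + k 6 - 2 * k 1 - 2 * k 2 - 2 * k 3 = 0"
      "4 * k 9 - 4 * k 10 + 2 * k 13 = 0" "4 * k 7 + 4 * k 8 - 2 * k 11 - 2 * k 12 + k 13 = 0"
      using two[OF S(1)[OF s] S(1)[OF s'(1)]] two[OF S(2)[OF s] S(2)[OF s'(1)]] by blast+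
  qed
  have P4: "k 0 + k 1 - k 2 + k 3 - 4 * k 4 + k 5 - k 6 = 0" "2 * k 1 + 2 * k 2 + 4 * k 4 + 2 * k 5
    + 2 * k 6 = 0"
    "2 * k 1 + 4 * k 2 + 10 * k 4 + 2 * k 5 + 4 * k 6 = 0"
    "k 9 - 2 * k 7 - k 8 - 2 * k 10 + k 11 + k 12 - k 13 = 0" "k 7 + k 8 + k 10 + 2 * k 11 + 2 * k
      13 = 0"
    "2 * k 7 + 2 * k 10 + 2 * k 11 + 4 * k 13 = 0"
  proof -
    obtain z :: complex where z: "4 * z ^ 3 - 2 * z + 1 = 0" using exists_cubic_root by blast
    define x y A C where "x = 2 * z ^ 2 + z - 2" and "y = z - 1" and "A = 1 + 2 * z + 2 * z ^ 2"
      and "C = 2 * z + 4 * z ^ 2 - 1"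
    have "p_ns x y 1 = (2 * z ^ 2 + 2 * z - 2 * z ^ 4 - z ^ 3 - 1) * (4 * z ^ 3 - 2 * z + 1)"
      "sec_l x y = (4 * z - 2 * z ^ 3 - 2 * z ^ 2) * (4 * z ^ 3 - 2 * z + 1)"
      "4 * K_ns x y = 191 * z - 98 - 226 * z ^ 2 +
        (336 * z ^ 3 - 128 * z ^ 5 - 256 * z ^ 4 - 88 * z ^ 2 + 101 * z + 70) * (4 * z ^ 3 - 2 * z + 1)"
      "2 * sec_b x y = 11 * z - 5 - 4 * z ^ 2 + (4 * z ^ 2 + z - 5) * (4 * z ^ 3 - 2 * z + 1)"
      "sec_a x y = A * sec_b x y + (1 + 6 * z - 4 * z ^ 4 - 5 * z ^ 3) * (4 * z ^ 3 - 2 * z + 1)"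
      "sec_c x y = C * sec_b x y +
        (8 * z ^ 2 + 8 * z - 8 * z ^ 4 - 6 * z ^ 3 - 4) * (4 * z ^ 3 - 2 * z + 1)"
      "sec_e x y = 1 * sec_b x y + (2 * z ^ 3 - 3 * z ^ 2 - 3 * z + 3) * (4 * z ^ 3 - 2 * z + 1)"
      "A * C = 10 * z ^ 2 + 4 * z - 4 + (2 * z + 3) * (4 * z ^ 3 - 2 * z + 1)"
      unfolding x_def y_def A_def C_def p_ns_affine sec_defs K_ns_def by Groebner_Basis.algebra+
    then have vals: "p_ns x y 1 = 0" "sec_l x y = 0" "sec_a x y = A * sec_b x y" "sec_c x y = C *
      sec_b x y"
        "sec_e x y = 1 * sec_b x y"
      and Kb: "4 * K_ns x y = 191 * z - 98 - 226 * z ^ 2" "2 * sec_b x y = 11 * z - 5 - 4 * z ^ 2"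
      and AC: "A * C = 10 * z ^ 2 + 4 * z - 4"
      by (simp_all add: z)
    have "K_ns x y \<noteq> 0"
      using Kb(1) cubic_independence[OF z, of "- 98" 191 "- 226"] by (auto simp: rats)
    moreover have "sec_b x y \<noteq> 0"
      using Kb(2) cubic_independence[OF z, of "- 5" 11 "- 4"] by (auto simp: rats)
    ultimately have e: "of_rat (k 0) + of_rat (k 1) * A + of_rat (k 2) * C + of_rat (k 3) * 1 +
      of_rat (k 4) * (A * C)
        + of_rat (k 5) * (A * 1) + of_rat (k 6) * (C * 1) = 0"
      "of_rat (k 7) * x + of_rat (k 8) * y + of_rat (k 9) + of_rat (k 10) * (x * 1) + of_rat (k 11) * A
        + of_rat (k 12) * 1 + of_rat (k 13) * (C * 1) = 0"
      using eqs[OF vals(1,2) _ _ vals(3,4,5)] by blast+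
    have "of_rat (k 0 + k 1 - k 2 + k 3 - 4 * k 4 + k 5 - k 6)
        + of_rat (2 * k 1 + 2 * k 2 + 4 * k 4 + 2 * k 5 + 2 * k 6) * z
        + of_rat (2 * k 1 + 4 * k 2 + 10 * k 4 + 2 * k 5 + 4 * k 6) * z ^ 2 = 0"
      using e(1) unfolding AC unfolding A_def C_def by (simp add: rats algebra_simps)
    from cubic_independence[OF z this]
    show "k 0 + k 1 - k 2 + k 3 - 4 * k 4 + k 5 - k 6 = 0" "2 * k 1 + 2 * k 2 + 4 * k 4 + 2 * k 5 +
      2 * k 6 = 0"
      "2 * k 1 + 4 * k 2 + 10 * k 4 + 2 * k 5 + 4 * k 6 = 0" by blast+
    have "of_rat (k 9 - 2 * k 7 - k 8 - 2 * k 10 + k 11 + k 12 - k 13)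
        + of_rat (k 7 + k 8 + k 10 + 2 * k 11 + 2 * k 13) * z
        + of_rat (2 * k 7 + 2 * k 10 + 2 * k 11 + 4 * k 13) * z ^ 2 = 0"
      using e(2) unfolding x_def y_def A_def C_def by (simp add: rats algebra_simps)
    from cubic_independence[OF z this]
    show "k 9 - 2 * k 7 - k 8 - 2 * k 10 + k 11 + k 12 - k 13 = 0" "k 7 + k 8 + k 10 + 2 * k 11 + 2
      * k 13 = 0"
      "2 * k 7 + 2 * k 10 + 2 * k 11 + 4 * k 13 = 0" by blast+
  qed
  \<comment> \<open>The two systems of seven equations in seven unknowns are nonsingular.\<close>
  have "k 0 = 0" "k 1 = 0" "k 2 = 0" "k 3 = 0" "k 4 = 0" "k 5 = 0" "k 6 = 0"
    using P1 P2 P3 P4 by linarith+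
  moreover have "k 7 = 0" "k 8 = 0" "k 9 = 0" "k 10 = 0" "k 11 = 0" "k 12 = 0" "k 13 = 0"
    using P1 P2 P3 P4 by linarith+
  moreover have "j \<in> {0, 1, 2, 3, 4, 5, 6, 7, 8, 9, 10, 11, 12, 13}" using k(2) unfolding insert_iff
    empty_iff by presburger
  ultimately show ?thesis by auto
qed

end

lemma const_0: "const 0 = 0"
  by (simp add: const_def)

section \<open>The ideal of the canonical model\<close>

lemma qeval_ql_section_point: "qeval (section_point x y t) ql = 26 * sec_l x y"
  by (simp add: qeval_q section_point_def forms_of_eigenforms)

context generic_point
begin

lemma qeval_U_ql: "qeval U ql \<noteq> 0"
proof
  assume "qeval U ql = 0"
  \<comment> \<open>a rational point of the quartic off the line section \<open>l = 0\<close>\<close>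
  moreover have "on_cover 0 (3 / 2) (csqrt (K_ns 0 (3 / 2)))"
    by (simp add: on_cover_def p_ns_def power_divide)
  ultimately have "qeval (section_point 0 (3 / 2) (csqrt (K_ns 0 (3 / 2)))) ql = 0"
    by (rule generic_vanishing)
  then show False
    by (simp add: qeval_ql_section_point sec_l_def power2_eq_square power3_eq_cube)
qed

text \<open>
  Restricting to the hyperplane \<open>l = 0\<close> kills the normal form, so the given form is \<open>l g\<close> modulo the
  quadrics; \<open>g\<close> has smaller degree and again vanishes at \<open>U\<close> because \<open>l\<close> does not.
\<close>

lemma homogeneous_vanishing_imp_ideal_C:
  assumes "homogeneous d f" "qeval U f = 0"
  shows "f \<in> ideal_C"
  using assms
proof (induction d arbitrary: f rule: less_induct)
  case (less d f)
  obtain k g where k: "bounded_coeffs d k" and g: "lower_form d g"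
    and f: "f - normal_form d k - ql * g \<in> ideal_C"
    using reducible_imp_normal_form[OF homogeneous_imp_reducible[OF less.prems(1)]] by blast
  have "k j = 0" if "j < 14" for j
  proof (rule normal_form_unique[OF k that])
    fix x y t :: complex
    assume P: "on_cover x y t" "sec_l x y = 0"
    show "qeval (section_point x y t) (normal_form d k) = 0"
      using ideal_C_vanishes[OF P(1) f] generic_vanishing[OF less.prems(2) P(1)] P(2)
      by (simp add: qeval_simps qeval_ql_section_point)
  qed
  then have "normal_form d k = 0"
    by (simp add: normal_form_def const_0)
  with f have f: "f - ql * g \<in> ideal_C" by simp
  have "qeval U (ql * g) = 0"
    using ideal_C_vanishes[OF on_cover_generic f] less.prems(2)
    by (simp add: U_def[symmetric] qeval_simps)
  then have "qeval U g = 0" using qeval_U_ql by (simp add: qeval_mult)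
  then have "g \<in> ideal_C"
    using g less.IH ideal_C_closed(1) by (auto simp: lower_form_def)
  from ideal_C_closed(2)[OF f ideal_C_closed(3)[OF this, of ql]] show ?case by simp
qed

lemma homogeneous_ideal_C_iff: "homogeneous d f \<Longrightarrow> f \<in> ideal_C \<longleftrightarrow> qeval U f = 0"
  using homogeneous_vanishing_imp_ideal_C ideal_C_vanishes[OF on_cover_generic] by (auto simp: U_def)

text \<open>
  Restriction to the line through the origin and \<open>U\<close>. Its coefficients are the values at \<open>U\<close> of the
  homogeneous components, so the ideal is the kernel of a homomorphism into an integral domain.
\<close>

definition cone_poly :: "8 qpoly \<Rightarrow> complex poly" where
  "cone_poly f = (\<Sum>d \<in> mdeg ` Poly_Mapping.keys f. monom (qeval U (component d f)) d)"

lemma poly_cone_poly: "poly (cone_poly f) s = qeval (\<lambda>i. s * U i) f"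
proof -
  have "qeval (\<lambda>i. s * U i) f = qeval (\<lambda>i. s * U i) (\<Sum>d \<in> mdeg ` Poly_Mapping.keys f. component d f)"
    using sum_components[of f] by simp
  also have "\<dots> = (\<Sum>d \<in> mdeg ` Poly_Mapping.keys f. s ^ d * qeval U (component d f))"
    by (simp add: qeval_sum qeval_homogeneous[OF homogeneous_component])
  finally show ?thesis by (simp add: cone_poly_def poly_sum poly_monom mult.commute)
qed

lemma cone_poly_mult: "cone_poly (f * g) = cone_poly f * cone_poly g"
  by (rule poly_eq_poly_eq_iff[THEN iffD1, OF ext]) (simp add: poly_cone_poly qeval_mult)

lemma quadrics_scale:
  fixes v :: "8 \<Rightarrow> 'a::idom"
  shows "quadrics (\<lambda>i. s * v i) = map ((*) (s ^ 2)) (quadrics v)"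
  unfolding quadrics_def
  by (simp only: list.map list.inject, intro conjI refl; Groebner_Basis.algebra)

lemma ideal_C_iff_cone_poly: "f \<in> ideal_C \<longleftrightarrow> cone_poly f = 0"
proof
  assume "f \<in> ideal_C"
  have "poly (cone_poly f) s = 0" for s
    unfolding poly_cone_poly
  proof (rule Idl_subset_kernel)
    show "f \<in> Idl\<^bsub>qpoly_ring\<^esub> (set (quadrics var))"
      using \<open>f \<in> ideal_C\<close> by (simp add: ideal_C_def canonical_quadrics_eq)
    fix q :: "8 qpoly" assume "q \<in> set (quadrics var)"
    then have "qeval (\<lambda>i. s * U i) q \<in> set (map (qeval (\<lambda>i. s * U i)) (quadrics var))" by simp
    then show "qeval (\<lambda>i. s * U i) q = 0"
      unfolding qeval_quadrics quadrics_scale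
      using quadrics_section_point[OF on_cover_generic] by (auto simp: U_def)
  qed
  then show "cone_poly f = 0" using poly_all_0_iff_0 by blast
next
  assume 0: "cone_poly f = 0"
  have "component d f \<in> ideal_C" if "d \<in> mdeg ` Poly_Mapping.keys f" for d
  proof -
    have "coeff (cone_poly f) d = (\<Sum>e \<in> mdeg ` Poly_Mapping.keys f. if e = d then qeval U (component
      d f) else 0)"
      unfolding cone_poly_def coeff_sum by (rule sum.cong) auto
    then have "qeval U (component d f) = 0" using that 0 by simp
    then show ?thesis by (rule homogeneous_vanishing_imp_ideal_C[OF homogeneous_component])
  qed
  then have "(\<Sum>d \<in> A. component d f) \<in> ideal_C" if "A \<subseteq> mdeg ` Poly_Mapping.keys f" for A
    using that by (induction A rule: infinite_finite_induct) (auto intro: ideal_C_closed)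
  from this[OF order.refl] show "f \<in> ideal_C"
    using sum_components[of f] by simp
qed

lemma primeideal_ideal_C: "primeideal ideal_C qpoly_ring"
proof (rule primeidealI)
  show "ideal ideal_C qpoly_ring" unfolding ideal_C_def by (rule qpoly_Idl_ideal)
  show "cring (qpoly_ring :: 8 qpoly ring)" by (rule cring_from_type_algebra)
  have "(1 :: 8 qpoly) \<notin> ideal_C"
    using homogeneous_ideal_C_iff[OF homogeneous_1] by (simp add: qeval_1)
  then show "carrier qpoly_ring \<noteq> ideal_C" by (auto simp: qpoly_ring_simps)
  show "f \<in> ideal_C \<or> g \<in> ideal_C" if "f \<otimes>\<^bsub>qpoly_ring\<^esub> g \<in> ideal_C" for f g
    using that by (simp add: qpoly_ring_simps ideal_C_iff_cone_poly cone_poly_mult)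
qed

end

section \<open>The ideal of the affine model\<close>

definition q_poly :: "rat poly poly" where
  "q_poly = [: [:0, -168, -740, -1016, -453, -68, -70, 8, -1, 2, -11:],
    [:56, 340, 840, 1124, 866, 372, 109, 51, 29, 22:],
    [:-56, -312, -635, -586, -260, -85, -41, -20, -11:] :]"

lemma biv_eval_q_poly:
  fixes x y :: "'a::idom"
  shows "rat_embedding e \<Longrightarrow> biv_eval e q_poly x y = q_ns x y"
  unfolding q_poly_def q_ns_def
  by (simp only: biv_eval_simps poly_pCons poly_0) Groebner_Basis.algebra

lemma ideal_C'_eq: "ideal_C' = double_cover q_poly"
  by (simp add: ideal_C'_def double_cover_def biv_eval_q_poly rat_embedding_const)

context generic_point
begin

lemma low_degree_nonvanishing:
  assumes "A \<noteq> 0" "degree A < 3"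
  shows "biv_eval of_rat A x y \<noteq> 0"
  using vanishing_imp_p_dvd[OF y p, of A] dvd_imp_degree_le[of p_poly A] assms degree_p_poly by auto

text \<open>
  Both polynomials have degree 2 in \<open>x\<close>, too small for a multiple of \<open>p\<close>.
\<close>

lemma scale_nonzero: "scale_num x y \<noteq> 0" "scale_den x y \<noteq> 0"
proof -
  have "biv_eval of_rat [: [:0, 6, -1, 1:], [:-2, -3, -3:], [:2, 2:] :] x y = scale_num x y"
    by (simp add: biv_eval_simps rat_embedding_of_rat scale_num_def algebra_simps power2_eq_square
      power3_eq_cube)
  then show "scale_num x y \<noteq> 0"
    using low_degree_nonvanishing[of "[: [:0, 6, -1, 1:], [:-2, -3, -3:], [:2, 2:] :]"] by simp
  have "biv_eval of_rat [: [:-1:], [:-1:], [:1:] :] x y = scale_den x y"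
    by (simp add: biv_eval_simps rat_embedding_of_rat scale_den_def algebra_simps power2_eq_square)
  then show "scale_den x y \<noteq> 0"
    using low_degree_nonvanishing[of "[: [:-1:], [:-1:], [:1:] :]"] by simp
qed

definition r :: real where "r = scale_num x y * sqrt (- K_ns x y) / scale_den x y"

definition tau :: complex where "tau = \<i> * of_real r"

lemma r_nonzero: "r \<noteq> 0"
  using scale_nonzero K by (simp add: r_def)

lemma r_square: "- (r ^ 2) = q_ns x y"
proof -
  have "q_ns x y * scale_den x y ^ 2 = K_ns x y * scale_num x y ^ 2"
    using q_ns_eq_scaled_K_ns[of x y] p by simp
  moreover have "r ^ 2 * scale_den x y ^ 2 = scale_num x y ^ 2 * (- K_ns x y)"
    using scale_nonzero K by (simp add: r_def power_divide power_mult_distrib)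
  ultimately have "- (r ^ 2) * scale_den x y ^ 2 = q_ns x y * scale_den x y ^ 2"
    by (simp add: algebra_simps)
  then show ?thesis unfolding mult_right_cancel[OF power_not_zero[OF scale_nonzero(2)]] .
qed

lemma tau_T: "tau * scale_den xi eta = scale_num xi eta * T"
proof -
  have "scale_den xi eta = of_real (scale_den x y)" "scale_num xi eta = of_real (scale_num x y)"
    by (simp_all add: scale_den_def scale_num_def xi_def eta_def)
  then show ?thesis using scale_nonzero by (simp add: tau_def T_def r_def)
qed

definition V :: "3 \<Rightarrow> complex" where "V = coords3 xi eta tau"

lemma ideal_C'_iff: "f \<in> ideal_C' \<longleftrightarrow> qeval V f = 0"
  unfolding ideal_C'_eq V_def xi_def eta_def tau_def
  by (rule double_cover_kernel[OF r_nonzero]) (simp add: r_square biv_eval_q_poly rat_embedding_of_rat)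

lemma primeideal_ideal_C': "primeideal ideal_C' qpoly_ring"
proof (rule primeidealI)
  show "ideal ideal_C' qpoly_ring" unfolding ideal_C'_def by (rule qpoly_Idl_ideal)
  show "cring (qpoly_ring :: 3 qpoly ring)" by (rule cring_from_type_algebra)
  have "(1 :: 3 qpoly) \<notin> ideal_C'" by (simp add: ideal_C'_iff qeval_1)
  then show "carrier qpoly_ring \<noteq> ideal_C'" by (auto simp: qpoly_ring_simps)
  show "f \<in> ideal_C' \<or> g \<in> ideal_C'" if "f \<otimes>\<^bsub>qpoly_ring\<^esub> g \<in> ideal_C'" for f g
    using that by (simp add: qpoly_ring_simps ideal_C'_iff qeval_mult)
qed

section \<open>The isomorphism\<close>

lemma affine_evaluable: "evaluable_fractions ideal_C' (affine_fractions ideal_C') (qeval V)"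
  by unfold_locales (auto simp: affine_fractions_def ideal_C'_iff qeval_simps)

lemma projective_evaluable: "evaluable_fractions ideal_C (projective_fractions ideal_C) (qeval U)"
proof -
  have D: "(f, g) \<in> projective_fractions ideal_C \<longleftrightarrow> qeval U g \<noteq> 0 \<and> (\<exists>d. homogeneous d f \<and>
    homogeneous d g)" for f g
    using homogeneous_ideal_C_iff by (auto simp: projective_fractions_def)
  show ?thesis
  proof
    show "(1, 1) \<in> projective_fractions ideal_C" "(0, 1) \<in> projective_fractions ideal_C"
      unfolding D using homogeneous_1 homogeneous_0 by (auto simp: qeval_1)
    fix f g f' g' :: "8 qpoly"
    assume fg: "(f, g) \<in> projective_fractions ideal_C"
    then obtain d where d: "homogeneous d f" "homogeneous d g" "qeval U g \<noteq> 0" by (auto simp: D)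
    show "(- f, g) \<in> projective_fractions ideal_C" "qeval U g \<noteq> 0"
      unfolding D using d homogeneous_uminus by auto
    show "(g, f) \<in> projective_fractions ideal_C" if "qeval U f \<noteq> 0"
      unfolding D using d that by auto
    assume fg': "(f', g') \<in> projective_fractions ideal_C"
    then obtain d' where d': "homogeneous d' f'" "homogeneous d' g'" "qeval U g' \<noteq> 0" by (auto simp: D)
    note m = homogeneous_mult[OF d(1) d'(1)] homogeneous_mult[OF d(2) d'(2)]
      homogeneous_mult[OF d(1) d'(2)] homogeneous_mult[OF d'(1) d(2), unfolded add.commute[of d' d]]
    show "(f * f', g * g') \<in> projective_fractions ideal_C"
      unfolding D using m d(3) d'(3) by (auto simp: qeval_mult)
    show "(f * g' + f' * g, g * g') \<in> projective_fractions ideal_C"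
      unfolding D using m homogeneous_add[OF m(3,4)] d(3) d'(3) by (auto simp: qeval_mult)
    show "f * g' - f' * g \<in> ideal_C \<longleftrightarrow> qeval U (f * g' - f' * g) = 0"
      by (rule homogeneous_ideal_C_iff[OF homogeneous_diff[OF m(3,4)]])
  qed (simp_all add: qeval_simps)
qed

text \<open>
  If \<open>B\<close> vanished at the generic point, it would vanish on the whole curve; its value at the points over
  \<open>(1, 0)\<close>, where \<open>t\<^sup>2 = -7\<close>, is not zero.
\<close>

lemma qeval_U_form_B: "qeval U (form_B var) \<noteq> 0"
proof
  assume 0: "qeval U (form_B var) = 0"
  define t where "t = csqrt (- 7)"
  have t2: "t * t = - 7" using power2_csqrt[of "- 7"] by (simp add: t_def power2_eq_square)
  have t3: "t * (t * u) = - 7 * u" for u using t2 by (metis mult.assoc)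
  have "on_cover 1 0 t" using t2 by (simp add: on_cover_def p_ns_def K_ns_def power2_eq_square)
  then have "qeval (section_point 1 0 t) (form_B var) = 0" by (rule generic_vanishing[OF 0])
  moreover have "qeval (section_point 1 0 t) (form_B var) = - 86268236540928 - 80779380218784 * t"
    unfolding form_B_def section_point_def qeval_simps of_eigenforms_nth sec_a_def sec_b_def
      sec_c_def sec_e_def sec_l_def
    by (simp add: power2_eq_square algebra_simps t2 t3)
  ultimately have "80779380218784 * t = - 86268236540928" by (simp add: algebra_simps
    eq_neg_iff_add_eq_0)
  then have "(80779380218784 * t) * (80779380218784 * t) = (- 86268236540928) * (- 86268236540928)"
    by (simp only:)
  also have "(80779380218784 * t) * (80779380218784 * t) = 80779380218784 * 80779380218784 * (t * t)"
    by (simp only: mult_ac)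
  finally show False unfolding t2 by simp
qed

lemma qeval_U_coordinates:
  "qeval U (form_X var) = 26 * (xi * T)" "qeval U (form_Y var) = 26 * (eta * T)" "qeval U (form_Z
    var) = 26 * T"
  using qeval_q(1-3)[of U] by (simp_all add: q_defs U_def section_point_def forms_of_eigenforms)

lemma qeval_U_s: "qeval U (form_A var) / qeval U (form_B var) * eta ^ 2 = tau"
proof -
  have den: "scale_den xi eta \<noteq> 0"
  proof -
    have "scale_den xi eta = of_real (scale_den x y)" by (simp add: scale_den_def xi_def eta_def)
    then show ?thesis using scale_nonzero(2) by simp
  qed
  have AB: "qeval U (form_A var) = form_A U" "qeval U (form_B var) = form_B U"
    by (simp_all add: form_A_def form_B_def qeval_simps)
  have "form_A U * eta ^ 2 * scale_den xi eta - scale_num xi eta * T * form_B U = 0"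
    using on_cover_generic s_relation[of xi T eta]
    by (simp add: U_def section_point_def on_cover_def)
  then have "form_A U * eta ^ 2 * scale_den xi eta = tau * form_B U * scale_den xi eta"
    using tau_T by (simp add: algebra_simps)
  then have "form_A U * eta ^ 2 = tau * form_B U" using den by simp
  then show ?thesis using qeval_U_form_B unfolding AB by (simp add: field_simps)
qed

end

text \<open>
  The function field is generated by the constants and the coordinates, as fractions are determined by
  the values on numerator and denominator.
\<close>

lemma ring_hom_agree:
  fixes \<phi> \<psi> :: "(3 qpoly \<times> 3 qpoly) set \<Rightarrow> (8 qpoly \<times> 8 qpoly) set"
  assumes ev: "evaluable_fractions ideal_C' (affine_fractions ideal_C') h"
    and F: "field function_field_C"
    and hom: "\<phi> \<in> ring_hom function_field_C' function_field_C" "\<psi> \<in> ring_hom function_field_C'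
      function_field_C"
    and coord: "coordinate_assignment \<phi>" "coordinate_assignment \<psi>"
    and a: "a \<in> carrier function_field_C'"
  shows "\<psi> a = \<phi> a"
proof -
  interpret A: evaluable_fractions ideal_C' "affine_fractions ideal_C'" h by (rule ev)
  interpret F: field function_field_C by (rule F)
  note ff = affine_function_field_def
  have D: "(f, 1) \<in> affine_fractions ideal_C'" for f
    using A.D_1 by (simp add: affine_fractions_def)
  have closed: "frac ideal_C' (affine_fractions ideal_C') f g \<in> carrier function_field_C'"
    if "(f, g) \<in> affine_fractions ideal_C'" for f g
    using that by (auto simp: ff A.carrier_frac)
  have mult: "fun_C' (f * g) = fun_C' f \<otimes>\<^bsub>function_field_C'\<^esub> fun_C' g" for f g
    using A.frac_mult[OF D D, of f g] by (simp add: ff)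
  have add: "fun_C' (f + g) = fun_C' f \<oplus>\<^bsub>function_field_C'\<^esub> fun_C' g" for f g
    using A.frac_add[OF D D, of f g] by (simp add: ff)
  have poly: "\<psi> (fun_C' f) = \<phi> (fun_C' f)" for f
  proof (induction f rule: qpoly_induct)
    case (const c)
    then show ?case using coord by (simp add: coordinate_assignment_def)
  next
    case (add f g)
    then show ?case
      unfolding \<open>\<And>f g. fun_C' (f + g) = _\<close>
      by (simp add: ring_hom_add[OF hom(1)] ring_hom_add[OF hom(2)] closed D)
  next
    case (mult i f)
    have "\<psi> (fun_C' (var i)) = \<phi> (fun_C' (var i))"
      using exhaust_3[of i] coord unfolding coordinate_assignment_def by metis
    with mult show ?case
      unfolding \<open>\<And>f g. fun_C' (f * g) = _\<close>
      by (simp add: ring_hom_mult[OF hom(1)] ring_hom_mult[OF hom(2)] closed D)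
  qed
  obtain f g where fg: "(f, g) \<in> affine_fractions ideal_C'" "a = frac ideal_C' (affine_fractions
    ideal_C') f g"
    using a by (auto simp: ff A.carrier_frac)
  have g: "(1, g) \<in> affine_fractions ideal_C'" using fg(1) by (simp add: affine_fractions_def)
  have ag: "a \<otimes>\<^bsub>function_field_C'\<^esub> fun_C' g = fun_C' f"
    using A.frac_mult[OF fg(1) D, of g] fg A.h_denom[OF fg(1)] A.D_mult[OF fg(1) D, of g]
    by (simp add: ff A.frac_eq_iff D A.h_mult A.h_1)
  have g_unit: "frac ideal_C' (affine_fractions ideal_C') 1 g \<otimes>\<^bsub>function_field_C'\<^esub> fun_C' g =
    \<one>\<^bsub>function_field_C'\<^esub>"
    using A.frac_mult[OF g D, of g] A.h_denom[OF g] A.D_mult[OF g D, of g]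
    by (simp add: ff A.frac_one A.frac_eq_iff D A.h_mult A.h_1)
  have "\<phi> (fun_C' g) \<noteq> \<zero>\<^bsub>function_field_C\<^esub>"
  proof
    assume 0: "\<phi> (fun_C' g) = \<zero>\<^bsub>function_field_C\<^esub>"
    have "\<one>\<^bsub>function_field_C\<^esub> = \<phi> (frac ideal_C' (affine_fractions ideal_C') 1 g
      \<otimes>\<^bsub>function_field_C'\<^esub> fun_C' g)"
      unfolding g_unit using ring_hom_one[OF hom(1)] by simp
    also have "\<dots> = \<zero>\<^bsub>function_field_C\<^esub>"
      using ring_hom_closed[OF hom(1) closed[OF g]]
      by (simp add: ring_hom_mult[OF hom(1)] closed D g 0)
    finally show False using F.one_not_zero by simp
  qed
  moreover have "\<psi> a \<otimes>\<^bsub>function_field_C\<^esub> \<phi> (fun_C' g) = \<phi> a \<otimes>\<^bsub>function_field_C\<^esub> \<phi> (fun_C' g)"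
  proof -
    have "\<psi> a \<otimes>\<^bsub>function_field_C\<^esub> \<psi> (fun_C' g) = \<psi> (fun_C' f)"
      unfolding ag[symmetric] using a by (simp add: ring_hom_mult[OF hom(2)] closed D)
    moreover have "\<phi> a \<otimes>\<^bsub>function_field_C\<^esub> \<phi> (fun_C' g) = \<phi> (fun_C' f)"
      unfolding ag[symmetric] using a by (simp add: ring_hom_mult[OF hom(1)] closed D)
    ultimately show ?thesis by (simp add: poly)
  qed
  ultimately show ?thesis
    using F.m_rcancel ring_hom_closed[OF hom(1)] ring_hom_closed[OF hom(2)] a closed[OF D] by auto
qed

context generic_point
begin

text \<open>
  The two fields of values coincide: \<open>x, y, t\<close> are values of the fractions \<open>X / Z\<close>, \<open>Y / Z\<close> and
  \<open>s (Y / Z)\<^sup>2\<close>; conversely \<open>T\<close>, and with it every coordinate of \<open>U\<close>, lies in \<open>\<rat>(x, y, t)\<close>.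
\<close>

lemma function_fields_isomorphic:
  shows "field function_field_C'" "field function_field_C" "s_C \<in> carrier function_field_C"
    "\<exists>\<phi> \<in> ring_iso function_field_C' function_field_C. coordinate_assignment \<phi>"
proof -
  interpret A: evaluable_fractions ideal_C' "affine_fractions ideal_C'" "qeval V" by (rule
    affine_evaluable)
  interpret C: evaluable_fractions ideal_C "projective_fractions ideal_C" "qeval U" by (rule
    projective_evaluable)
  note ffA = affine_function_field_def and ffC = projective_function_field_def
  show "field function_field_C'" "field function_field_C"
    unfolding ffA ffC by (rule A.frac_field, rule C.frac_field)
  have DA: "(f, g) \<in> affine_fractions ideal_C' \<longleftrightarrow> qeval V g \<noteq> 0" for f g
    by (simp add: affine_fractions_def ideal_C'_iff)
  have DC: "(f, g) \<in> projective_fractions ideal_C" if "homogeneous d f" "homogeneous d g" "qeval U g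
    \<noteq> 0" for f g d
    using that homogeneous_ideal_C_iff by (auto simp: projective_fractions_def)
  have fracs: "(const c, 1) \<in> projective_fractions ideal_C"
    "(form_X var, form_Z var) \<in> projective_fractions ideal_C"
    "(form_Y var, form_Z var) \<in> projective_fractions ideal_C"
    "(form_A var, form_B var) \<in> projective_fractions ideal_C" for c
  proof -
    show "(const c, 1) \<in> projective_fractions ideal_C"
      by (rule DC[OF homogeneous_const homogeneous_1]) (simp add: qeval_1)
    show "(form_X var, form_Z var) \<in> projective_fractions ideal_C"
      "(form_Y var, form_Z var) \<in> projective_fractions ideal_C"
      using DC[OF q_homogeneous(1,3)] DC[OF q_homogeneous(2,3)] T_nonzero
      by (simp_all add: q_defs[symmetric] qeval_U_coordinates[folded q_defs])
    have "homogeneous 2 (form_A var)" "homogeneous 2 (form_B var)"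
      unfolding form_A_def form_B_def mult.assoc by (intro homogeneous_intros)+
    then show "(form_A var, form_B var) \<in> projective_fractions ideal_C"
      using qeval_U_form_B by (rule DC)
  qed
  show "s_C \<in> carrier function_field_C"
    unfolding s_C_def ffC C.carrier_frac using fracs(4) by blast
  have ratios: "qeval U (form_X var) / qeval U (form_Z var) = xi" "qeval U (form_Y var) / qeval U
    (form_Z var) = eta"
    using T_nonzero by (simp_all add: qeval_U_coordinates)
  have V_C: "qeval V f \<in> carrier C.values_field" for f
  proof (induction f rule: qpoly_induct)
    case (const c)
    show ?case using fracs(1)[of c] by (force simp: C.carrier_values qeval_const qeval_1)
  next
    case (add f g)
    then show ?case by (simp add: qeval_add C.values_closed)
  next
    case (mult i f)
    have "xi \<in> carrier C.values_field" "eta \<in> carrier C.values_field"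
      unfolding C.carrier_values ratios[symmetric] using fracs by blast+
    moreover have "qeval U (form_A var) / qeval U (form_B var) \<in> carrier C.values_field"
      unfolding C.carrier_values using fracs by blast
    ultimately have "tau \<in> carrier C.values_field"
      unfolding qeval_U_s[symmetric] power2_eq_square by (intro C.values_closed)
    then have "V i \<in> carrier C.values_field"
      using exhaust_3[of i] \<open>xi \<in> _\<close> \<open>eta \<in> _\<close> by (auto simp: V_def coords3_def)
    with mult show ?case by (simp add: qeval_mult qeval_var C.values_closed)
  qed
  have V_A: "qeval V f \<in> carrier A.values_field" for f
  proof -
    have "(f, 1) \<in> affine_fractions ideal_C'" by (simp add: DA qeval_1)
    then have "qeval V f / qeval V 1 \<in> carrier A.values_field" unfolding A.carrier_values by blast
    then show ?thesis by (simp add: qeval_1)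
  qed
  have U_A: "qeval U f \<in> carrier A.values_field" for f
  proof -
    have T: "T \<in> carrier A.values_field"
    proof -
      have "scale_num xi eta = qeval V (scale_num (var 1) (var 2))" "scale_den xi eta = qeval V
        (scale_den (var 1) (var 2))"
        "tau = qeval V (var 3)"
        by (simp_all add: scale_num_def scale_den_def qeval_simps V_def coords3_simps)
      moreover have "scale_num xi eta \<noteq> 0"
      proof -
        have "scale_num xi eta = of_real (scale_num x y)" by (simp add: scale_num_def xi_def eta_def)
        then show ?thesis using scale_nonzero(1) by simp
      qed
      then have "T = tau * scale_den xi eta * inverse (scale_num xi eta)"
        using tau_T by (simp add: field_simps)
      ultimately show ?thesis using V_A by (simp only: A.values_closed)
    qed
    have gen: "qeval (coords3 xi eta T) h \<in> carrier A.values_field" for h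
    proof (induction h rule: qpoly_induct)
      case (const c)
      show ?case using V_A[of "const c"] by (simp add: qeval_const)
    next
      case (add f g)
      then show ?case by (simp add: qeval_add A.values_closed)
    next
      case (mult i f)
      have "coords3 xi eta T i \<in> carrier A.values_field"
        using exhaust_3[of i] V_A[of "var 1"] V_A[of "var 2"] T by (auto simp: qeval_var V_def
          coords3_simps)
      with mult show ?case by (simp add: qeval_mult qeval_var A.values_closed)
    qed
    obtain h where "\<forall>x y t :: complex. qeval (coords3 x y t) h = qeval (section_point x y t) f"
      using substitution by blast
    then show ?thesis using gen[of h] by (simp add: U_def)
  qed
  have "carrier A.values_field = carrier C.values_field"
  proof
    show "carrier A.values_field \<subseteq> carrier C.values_field"
      using V_C C.values_closed(4,6) by (auto simp: A.carrier_values divide_inverse)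
    show "carrier C.values_field \<subseteq> carrier A.values_field"
      using U_A A.values_closed(4,6) by (auto simp: C.carrier_values divide_inverse)
  qed
  then have same: "A.values_field = C.values_field"
    by (simp add: A.values_field_def C.values_field_def)
  define w where "w = inv_into (carrier (frac_ring ideal_C (projective_fractions ideal_C))) C.val"
  define \<phi> where "\<phi> = w \<circ> A.val"
  have "\<phi> \<in> ring_iso function_field_C' function_field_C"
    unfolding \<phi>_def w_def ffA ffC
    by (rule ring_iso_set_trans[OF A.val_iso C.inverse_val_iso[folded same]])
  moreover have "coordinate_assignment \<phi>"
  proof -
    have \<phi>_fun: "\<phi> (fun_C' f) = frac_C g h" if "(g, h) \<in> projective_fractions ideal_C" "qeval V f =
      qeval U g / qeval U h" for f g h
      using C.inverse_val_frac[OF that(1)] that(2) A.val_frac[of f 1]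
      by (simp add: \<phi>_def w_def DA qeval_1)
    note YY = C.D_mult[OF fracs(3) fracs(3)]
    have sq: "frac_C (form_Y var) (form_Z var) [^]\<^bsub>function_field_C\<^esub> (2::nat) =
        frac_C (form_Y var * form_Y var) (form_Z var * form_Z var)"
      unfolding ffC numeral_2_eq_2 nat_pow_def
      by (simp add: C.frac_one C.frac_mult[OF C.D_1 fracs(3)] C.frac_mult[OF fracs(3) fracs(3)])
    have "qeval V (var 3) = qeval U (form_A var * (form_Y var * form_Y var)) / qeval U (form_B var *
      (form_Z var * form_Z var))"
      using qeval_U_s unfolding ratios(2)[symmetric] power2_eq_square
      by (simp add: qeval_mult qeval_var V_def coords3_simps)
    from \<phi>_fun[OF C.D_mult[OF fracs(4) YY] this]
    have "\<phi> (fun_C' (var 3)) =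
        s_C \<otimes>\<^bsub>function_field_C\<^esub> (frac_C (form_Y var) (form_Z var) [^]\<^bsub>function_field_C\<^esub> (2::nat))"
      unfolding sq s_C_def unfolding ffC by (simp add: C.frac_mult[OF fracs(4) YY])
    moreover have "\<phi> (fun_C' (const c)) = frac_C (const c) 1" for c
      by (rule \<phi>_fun[OF fracs(1)]) (simp add: qeval_const qeval_1)
    moreover have "\<phi> (fun_C' (var 1)) = frac_C (form_X var) (form_Z var)"
      by (rule \<phi>_fun[OF fracs(2)]) (simp add: ratios qeval_var V_def coords3_simps)
    moreover have "\<phi> (fun_C' (var 2)) = frac_C (form_Y var) (form_Z var)"
      by (rule \<phi>_fun[OF fracs(3)]) (simp add: ratios qeval_var V_def coords3_simps)
    ultimately show ?thesis by (simp add: coordinate_assignment_def)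
  qed
  ultimately show "\<exists>\<phi> \<in> ring_iso function_field_C' function_field_C. coordinate_assignment \<phi>" by blast
qed

end

theorem mainTheorem5:
  shows "primeideal ideal_C' qpoly_ring \<and> field function_field_C' \<and>
    primeideal ideal_C qpoly_ring \<and> field function_field_C \<and>
    s_C \<in> carrier function_field_C \<and>
    (\<exists>\<phi> \<in> ring_iso function_field_C' function_field_C.
      coordinate_assignment \<phi> \<and>
      (\<forall>\<psi> \<in> ring_hom function_field_C' function_field_C.
        coordinate_assignment \<psi> \<longrightarrow> (\<forall>a \<in> carrier function_field_C'. \<psi> a = \<phi> a)))"
proof -
  obtain x y :: real where "generic_point x y"
    using exists_generic_point by (auto simp: generic_point_def)
  then interpret generic_point x y .
  obtain \<phi> where \<phi>: "\<phi> \<in> ring_iso function_field_C' function_field_C" "coordinate_assignment \<phi>"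
    using function_fields_isomorphic(4) by blast
  then have "\<phi> \<in> ring_hom function_field_C' function_field_C" by (simp add: ring_iso_def)
  from ring_hom_agree[OF affine_evaluable function_fields_isomorphic(2) this _ \<phi>(2)]
  have "\<forall>\<psi> \<in> ring_hom function_field_C' function_field_C.
      coordinate_assignment \<psi> \<longrightarrow> (\<forall>a \<in> carrier function_field_C'. \<psi> a = \<phi> a)"
    by blast
  with \<phi> primeideal_ideal_C' primeideal_ideal_C function_fields_isomorphic(1-3) show ?thesis
    by blast
qed

end
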